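(* Let $(k_n)_{n\ge1}$ be a sequence of positive integers such that $k_n\le n$ for all $n$. Then, as $n\to\infty$, $$\mathbb{E}\big[\mathcal{L}_{<}(S_{k_n;n})\big]=2\sqrt{nk_n}-k_n+o(\sqrt{nk_n}).$$
   Context: A $k$-multiset permutation of size $n$ is a word $s=(s(1),\dots,s(kn))$ with letters in $\{1,\dots,n\}$ in which each letter appears exactly $k$ times; it is identified with the point set $\{(i,s(i)):1\le i\le kn\}\subset[0,\infty)^2$. $S_{k;n}$ denotes a $k$-multiset permutation of size $n$ chosen uniformly at random among all $\frac{(kn)!}{(k!)^n}$ of them. On $[0,\infty)^2$ define the partial orders $(x,y)\prec(x',y')$ iff $x<x'$ and $y<y'$, and $(x,y)\preccurlyeq(x',y')$ iff $x<x'$ and $y\le y'$. For a finite set $\mathcal P\subset[0,\infty)^2$, $\mathcal L_<(\mathcal P)$ is the largest $L$ such that there exist $P_1\prec P_2\prec\dots\prec P_L$ in $\mathcal P$, and $\mathcal L_\le(\mathcal P)$ is the largest $L$ such that there exist $P_1\preccurlyeq\dots\preccurlyeq P_L$ in $\mathcal P$. (Thus $\mathcal L_<(S_{k;n})$ is the length of a longest strictly increasing subsequence and $\mathcal L_\le(S_{k;n})$ of a longest non-decreasing subsequence.) *)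

theory Defs
  imports Complex_Main "HOL-Library.Landau_Symbols"
begin

definition strict_prec :: "real \<times> real \<Rightarrow> real \<times> real \<Rightarrow> bool" where
  "strict_prec p q \<longleftrightarrow> fst p < fst q \<and> snd p < snd q"

definition L_lt :: "(real \<times> real) set \<Rightarrow> nat" where
  "L_lt P = Max {L. \<exists>f :: nat \<Rightarrow> real \<times> real.
      (\<forall>i<L. f i \<in> P) \<and> (\<forall>i. Suc i < L \<longrightarrow> strict_prec (f i) (f (Suc i)))}"

text \<open>k-multiset permutations of size n: words of length k*n (as lists, position i+1
  holds s!i) with letters in {1..n}, each letter appearing exactly k times.\<close>
definition multiset_perms :: "nat \<Rightarrow> nat \<Rightarrow> nat list set" where
  "multiset_perms k n = {s. length s = k * n \<and> set s \<subseteq> {1..n} \<and>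
      (\<forall>a\<in>{1..n}. count_list s a = k)}"

definition word_points :: "nat list \<Rightarrow> (real \<times> real) set" where
  "word_points s = {(real (i + 1), real (s ! i)) | i. i < length s}"

definition expected_L_lt :: "nat \<Rightarrow> nat \<Rightarrow> real" where
  "expected_L_lt k n =
     (\<Sum>s\<in>multiset_perms k n. real (L_lt (word_points s))) / real (card (multiset_perms k n))"

end

theory Submission
  imports Defs "HOL-Combinatorics.Permutations"
begin

text \<open>
  A word with \<open>k\<close> copies of each of \<open>n\<close> letters is compared with a Bernoulli field on an
  \<open>m \<times> n\<close> grid, \<open>m\<close> huge, with about \<open>k\<close> points per row. Adding Bernoulli sources of rate \<open>\<alpha>\<close> on
  the bottom axis and sinks of rate \<open>\<beta>\<close> on the left axis makes the increments of the last-passage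
  function stationary when \<open>p (1 - \<alpha>) (1 - \<beta>) = \<alpha> \<beta>\<close>, so that the mean length with sources and
  sinks is exactly \<open>\<alpha> m + \<beta> n\<close>. Minimising over \<open>\<alpha>\<close> gives the upper bound \<open>2 \<surd>(n k) - k\<close>.

  For the lower bound take the minimising \<open>\<alpha>\<close>. By the upper bound applied to the rest of the grid,
  chains that stay on an axis for a positive fraction of its length are shorter on average by a
  term of order \<open>\<surd>(n k)\<close>. All these lengths have variance at most their mean by the Efron--Stein
  inequality, hence the stationary mean must be attained by chains that leave the axes almost
  immediately, and these are chains of the bulk up to a small error.

  The comparison with Bernoulli fields is made row by row and needs \<open>k\<close> of order \<open>n\<close>. For smaller
  \<open>k\<close>, merging blocks of consecutive letters can only shorten strictly increasing subsequences and
  reduces the lower bound to the previous case; splitting all letters reduces the upper bound to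
  uniform permutations, which only need the total number of points to be controlled.
\<close>

section \<open>Random subsets with independent coordinates\<close>

text \<open>Why the axes lose: for t points per row on average, the stationary mean is a + n t / (a
  + t) up to bounded errors, where a is the expected number of sources. It is smallest at a = s - t
  with s = sqrt (n t), the value being 2 s - t; a \<ge> 0 needs t \<le> n, which is where k \<le> n
  enters. A chain that spends a fraction \<delta> of an axis at this rate sees a remaining rectangle
  with a different optimum, and by convexity its mean is smaller by s (1 - sqrt (1 - \<delta>))^2.
  Being linear in s, this loss beats fluctuations of order sqrt s.

  Why two regimes: a Bernoulli row rarely has exactly k points. With mean (1 + \<delta>) k or (1 -
  \<delta>) k per row, Chebyshev leaves at most of order n / (\<delta>^2 k) rows on the wrong side
  of k. Each costs only one, chains being strictly increasing, but this exceeds sqrt (n k) once k is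
  below n^(1/3). For small k the correction -k is itself negligible, so merging about h sqrt (n / k)
  letters, at a cost of about h sqrt (n k), is affordable.\<close>

definition expect :: "'a set \<Rightarrow> ('a \<Rightarrow> real) \<Rightarrow> ('a set \<Rightarrow> real) \<Rightarrow> real" where
  "expect U p f = (\<Sum>\<omega>\<in>Pow U. (\<Prod>x\<in>\<omega>. p x) * (\<Prod>x\<in>U - \<omega>. 1 - p x) * f \<omega>)"

lemma expect_empty [simp]: "expect {} p f = f {}"
  by (simp add: expect_def)

lemma expect_insert:
  assumes "finite U" "x \<notin> U"
  shows "expect (insert x U) p f = p x * expect U p (\<lambda>\<omega>. f (insert x \<omega>)) + (1 - p x) * expect U p f"
proof -
  let ?w = "\<lambda>U \<omega>. (\<Prod>x\<in>\<omega>. p x) * (\<Prod>x\<in>U - \<omega>. 1 - p x)"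
  have inj: "inj_on (insert x) (Pow U)"
    using assms(2) by (auto simp: inj_on_def)
  have disj: "Pow U \<inter> insert x ` Pow U = {}"
    using assms(2) by auto
  have w1: "?w (insert x U) (insert x \<omega>) = p x * ?w U \<omega>" if "\<omega> \<subseteq> U" for \<omega>
  proof -
    have "finite \<omega>" "x \<notin> \<omega>" using that assms finite_subset by auto
    moreover have "insert x U - insert x \<omega> = U - \<omega>" using assms(2) by auto
    ultimately show ?thesis by simp
  qed
  have w0: "?w (insert x U) \<omega> = (1 - p x) * ?w U \<omega>" if "\<omega> \<subseteq> U" for \<omega>
  proof -
    have "x \<notin> \<omega>" using that assms by auto
    then have "insert x U - \<omega> = insert x (U - \<omega>)" by auto
    then show ?thesis using assms by simp
  qed
  have "expect (insert x U) p f
      = (\<Sum>\<omega>\<in>Pow U. ?w (insert x U) \<omega> * f \<omega>) + (\<Sum>\<omega>\<in>insert x ` Pow U. ?w (insert x U) \<omega> * f \<omega>)"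
    unfolding expect_def Pow_insert using assms disj by (subst sum.union_disjoint) auto
  also have "(\<Sum>\<omega>\<in>insert x ` Pow U. ?w (insert x U) \<omega> * f \<omega>)
      = (\<Sum>\<omega>\<in>Pow U. ?w (insert x U) (insert x \<omega>) * f (insert x \<omega>))"
    by (subst sum.reindex[OF inj]) (simp add: o_def)
  also have "\<dots> = p x * expect U p (\<lambda>\<omega>. f (insert x \<omega>))"
    unfolding expect_def sum_distrib_left by (rule sum.cong) (simp_all only: w1 Pow_iff mult.assoc)
  also have "(\<Sum>\<omega>\<in>Pow U. ?w (insert x U) \<omega> * f \<omega>) = (1 - p x) * expect U p f"
    unfolding expect_def sum_distrib_left by (rule sum.cong) (simp_all only: w0 Pow_iff mult.assoc)
  finally show ?thesis by simp
qed

lemma expect_cong: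
  assumes "U = V" "\<And>x. x \<in> V \<Longrightarrow> p x = q x" "\<And>\<omega>. \<omega> \<subseteq> V \<Longrightarrow> f \<omega> = g \<omega>"
  shows "expect U p f = expect V q g"
  unfolding expect_def assms(1)
proof (rule sum.cong[OF refl])
  fix \<omega> assume "\<omega> \<in> Pow V"
  then have "\<omega> \<subseteq> V" by simp
  then have "(\<Prod>x\<in>\<omega>. p x) = (\<Prod>x\<in>\<omega>. q x)" "(\<Prod>x\<in>V - \<omega>. 1 - p x) = (\<Prod>x\<in>V - \<omega>. 1 - q x)"
    by (auto intro!: prod.cong simp: assms(2) subset_iff)
  then show "(\<Prod>x\<in>\<omega>. p x) * (\<Prod>x\<in>V - \<omega>. 1 - p x) * f \<omega> = (\<Prod>x\<in>\<omega>. q x) * (\<Prod>x\<in>V - \<omega>. 1 - q x) * g \<omega>"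
    using assms(3)[OF \<open>\<omega> \<subseteq> V\<close>] by simp
qed

lemma expect_add: "expect U p (\<lambda>\<omega>. f \<omega> + g \<omega>) = expect U p f + expect U p g"
  by (simp add: expect_def distrib_left sum.distrib)

lemma expect_cmult: "expect U p (\<lambda>\<omega>. c * f \<omega>) = c * expect U p f"
  by (simp add: expect_def sum_distrib_left mult_ac)

lemma expect_diff: "expect U p (\<lambda>\<omega>. f \<omega> - g \<omega>) = expect U p f - expect U p g"
  by (simp add: expect_def right_diff_distrib sum_subtractf)

lemma expect_sum: "expect U p (\<lambda>\<omega>. \<Sum>i\<in>I. f i \<omega>) = (\<Sum>i\<in>I. expect U p (f i))"
  unfolding expect_def sum_distrib_left by (rule sum.swap)

lemma expect_const [simp]: "finite U \<Longrightarrow> expect U p (\<lambda>_. c) = c"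
  by (induction U rule: finite_induct) (simp_all add: expect_insert algebra_simps)

text \<open>The linear identities for \<open>expect\<close> hold for arbitrary real weights; this
  condition is imposed where positivity enters.\<close>

definition prob_on :: "'a set \<Rightarrow> ('a \<Rightarrow> real) \<Rightarrow> bool" where
  "prob_on U p \<longleftrightarrow> (\<forall>x\<in>U. 0 \<le> p x \<and> p x \<le> 1)"

lemma expect_mono:
  assumes "prob_on U p" "\<And>\<omega>. \<omega> \<subseteq> U \<Longrightarrow> f \<omega> \<le> g \<omega>"
  shows "expect U p f \<le> expect U p g"
  unfolding expect_def
  using assms by (intro sum_mono mult_left_mono mult_nonneg_nonneg prod_nonneg) (auto simp: prob_on_def subset_eq)

lemma expect_nonneg:
  assumes "finite U" "prob_on U p" "\<And>\<omega>. \<omega> \<subseteq> U \<Longrightarrow> 0 \<le> f \<omega>"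
  shows "0 \<le> expect U p f"
  using expect_mono[OF assms(2), of "\<lambda>_. 0" f] assms by simp

text \<open>Conditioning on the other coordinates makes the expectation affine in
  \<open>p x\<close>. The slope is the mean gain from adding \<open>x\<close>, nonnegative for an
  increasing \<open>f\<close>.\<close>

lemma expect_mono_prob:
  assumes "finite U" "prob_on U p" "prob_on U q" "\<And>x. x \<in> U \<Longrightarrow> p x \<le> q x"
    and "\<And>\<omega> \<omega>'. \<omega> \<subseteq> \<omega>' \<Longrightarrow> \<omega>' \<subseteq> U \<Longrightarrow> f \<omega> \<le> f \<omega>'"
  shows "expect U p f \<le> expect U q f"
  using assms
proof (induction U arbitrary: f rule: finite_induct)
  case (insert x U)
  note mono = insert.prems(4)
  have pr: "prob_on U p" "prob_on U q" "0 \<le> p x" "p x \<le> q x" "q x \<le> 1"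
    using insert.prems by (auto simp: prob_on_def)
  have 1: "expect U p f \<le> expect U q f"
    using insert.prems pr by (intro insert.IH) (auto intro!: mono)
  have 2: "expect U p (\<lambda>\<omega>. f (insert x \<omega>)) \<le> expect U q (\<lambda>\<omega>. f (insert x \<omega>))"
    using insert.prems pr by (intro insert.IH) (auto intro!: mono)
  have 3: "expect U q f \<le> expect U q (\<lambda>\<omega>. f (insert x \<omega>))"
    using pr by (intro expect_mono mono) auto
  have "expect (insert x U) p f \<le> p x * expect U q (\<lambda>\<omega>. f (insert x \<omega>)) + (1 - p x) * expect U q f"
    unfolding expect_insert[OF insert.hyps] using 1 2 pr
    by (intro add_mono mult_left_mono) auto
  also have "\<dots> = expect U q f + p x * (expect U q (\<lambda>\<omega>. f (insert x \<omega>)) - expect U q f)"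
    by (simp add: algebra_simps)
  also have "\<dots> \<le> expect U q f + q x * (expect U q (\<lambda>\<omega>. f (insert x \<omega>)) - expect U q f)"
    using 3 pr by (intro add_left_mono mult_right_mono) auto
  also have "\<dots> = expect (insert x U) q f"
    unfolding expect_insert[OF insert.hyps] by (simp add: algebra_simps)
  finally show ?case .
qed simp

lemma expect_Un:
  assumes "finite A" "finite B" "A \<inter> B = {}"
  shows "expect (A \<union> B) p f = expect A p (\<lambda>a. expect B p (\<lambda>b. f (a \<union> b)))"
  using assms
proof (induction A arbitrary: f rule: finite_induct)
  case (insert x A)
  have "x \<notin> A \<union> B" "finite (A \<union> B)" using insert by auto
  then have "expect (insert x A \<union> B) p f = p x * expect (A \<union> B) p (\<lambda>\<omega>. f (insert x \<omega>)) + (1 - p x) * expect (A \<union> B) p f"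
    by (simp add: expect_insert)
  then show ?case using insert by (simp add: expect_insert)
qed simp

lemma expect_marginal:
  assumes "finite U" "V \<subseteq> U"
  shows "expect U p (\<lambda>\<omega>. f (\<omega> \<inter> V)) = expect V p f"
proof -
  have fin: "finite V" "finite (U - V)" using assms finite_subset by auto
  have "U = V \<union> (U - V)" using assms by auto
  then have "expect U p (\<lambda>\<omega>. f (\<omega> \<inter> V)) = expect V p (\<lambda>a. expect (U - V) p (\<lambda>b. f ((a \<union> b) \<inter> V)))"
    using expect_Un[of V "U - V" p "\<lambda>\<omega>. f (\<omega> \<inter> V)"] fin by auto
  also have "\<dots> = expect V p (\<lambda>a. expect (U - V) p (\<lambda>b. f a))"
    by (intro expect_cong refl arg_cong[where f=f]) auto
  finally show ?thesis using fin by simp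
qed

lemma expect_reindex:
  assumes "inj_on h U"
  shows "expect (h ` U) p f = expect U (\<lambda>x. p (h x)) (\<lambda>\<omega>. f (h ` \<omega>))"
proof -
  have inj: "inj_on ((`) h) (Pow U)" using assms by (rule inj_on_image_Pow)
  have "expect (h ` U) p f = (\<Sum>\<omega>\<in>Pow U. (\<Prod>x\<in>h ` \<omega>. p x) * (\<Prod>x\<in>h ` U - h ` \<omega>. 1 - p x) * f (h ` \<omega>))"
    unfolding expect_def image_Pow_surj[OF refl, symmetric] by (subst sum.reindex[OF inj]) simp
  also have "\<dots> = expect U (\<lambda>x. p (h x)) (\<lambda>\<omega>. f (h ` \<omega>))"
    unfolding expect_def
  proof (rule sum.cong[OF refl])
    fix \<omega> assume "\<omega> \<in> Pow U"
    then have w: "\<omega> \<subseteq> U" by simp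
    have "inj_on h \<omega>" "inj_on h (U - \<omega>)" using w assms by (auto intro: inj_on_subset)
    moreover have "h ` U - h ` \<omega> = h ` (U - \<omega>)"
      using w assms by (simp add: inj_on_image_set_diff[of h U])
    ultimately show "(\<Prod>x\<in>h ` \<omega>. p x) * (\<Prod>x\<in>h ` U - h ` \<omega>. 1 - p x) * f (h ` \<omega>)
      = (\<Prod>x\<in>\<omega>. p (h x)) * (\<Prod>x\<in>U - \<omega>. 1 - p (h x)) * f (h ` \<omega>)"
      by (simp add: prod.reindex)
  qed
  finally show ?thesis .
qed

text \<open>Writing \<open>\<omega> - {x}\<close> in the second term records that \<open>x\<close>
  is absent, so that indicators of \<open>x \<in> \<omega>\<close> simplify on both sides.\<close>

lemma expect_split:
  assumes "finite U" "x \<in> U"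
  shows "expect U p f = p x * expect (U - {x}) p (\<lambda>\<omega>. f (insert x \<omega>)) + (1 - p x) * expect (U - {x}) p (\<lambda>\<omega>. f (\<omega> - {x}))"
proof -
  have "expect (U - {x}) p (\<lambda>\<omega>. f (\<omega> - {x})) = expect (U - {x}) p f"
    by (rule expect_cong) (auto intro!: arg_cong[where f=f])
  moreover have "expect (insert x (U - {x})) p f
      = p x * expect (U - {x}) p (\<lambda>\<omega>. f (insert x \<omega>)) + (1 - p x) * expect (U - {x}) p f"
    using assms by (intro expect_insert) auto
  ultimately show ?thesis using assms by (simp add: insert_absorb)
qed

lemma expect_mem:
  assumes "finite U" "x \<in> U"
  shows "expect U p (\<lambda>\<omega>. of_bool (x \<in> \<omega>)) = p x"
  using assms by (simp add: expect_split[OF assms])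

lemma expect_mem2:
  assumes "finite U" "x \<in> U" "y \<in> U" "x \<noteq> y"
  shows "expect U p (\<lambda>\<omega>. of_bool (x \<in> \<omega> \<and> y \<in> \<omega>)) = p x * p y"
  using assms by (simp add: expect_split[OF assms(1,2)] expect_mem)

lemma expect_card:
  assumes "finite U" "A \<subseteq> U"
  shows "expect U p (\<lambda>\<omega>. real (card (\<omega> \<inter> A))) = (\<Sum>x\<in>A. p x)"
proof -
  have fin: "finite A" using assms finite_subset by auto
  have "real (card (\<omega> \<inter> A)) = (\<Sum>x\<in>A. of_bool (x \<in> \<omega>))" for \<omega>
    using fin by (simp add: sum_of_bool_eq Int_commute)
  then show ?thesis using assms by (simp add: expect_sum expect_mem subset_iff)
qed

lemma expect_square_le: "finite U \<Longrightarrow> prob_on U p \<Longrightarrow> (expect U p f)\<^sup>2 \<le> expect U p (\<lambda>\<omega>. (f \<omega>)\<^sup>2)"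
proof -
  assume fin: "finite U" and pr: "prob_on U p"
  let ?m = "expect U p f"
  have "0 \<le> expect U p (\<lambda>\<omega>. (f \<omega> - ?m)\<^sup>2)"
    using fin pr by (intro expect_nonneg) auto
  also have "expect U p (\<lambda>\<omega>. (f \<omega> - ?m)\<^sup>2) = expect U p (\<lambda>\<omega>. (f \<omega>)\<^sup>2 - 2 * ?m * f \<omega> + ?m\<^sup>2)"
    by (simp add: power2_diff algebra_simps)
  also have "\<dots> = expect U p (\<lambda>\<omega>. (f \<omega>)\<^sup>2) - ?m\<^sup>2"
    using fin by (simp add: expect_add expect_diff expect_cmult power2_eq_square)
  finally show ?thesis by simp
qed

section \<open>Variance, the Efron-Stein inequality and deviations\<close>

definition variance :: "'a set \<Rightarrow> ('a \<Rightarrow> real) \<Rightarrow> ('a set \<Rightarrow> real) \<Rightarrow> real" where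
  "variance U p f = expect U p (\<lambda>\<omega>. (f \<omega> - expect U p f)\<^sup>2)"

lemma variance_eq:
  assumes "finite U"
  shows "variance U p f = expect U p (\<lambda>\<omega>. (f \<omega>)\<^sup>2) - (expect U p f)\<^sup>2"
proof -
  let ?m = "expect U p f"
  have "variance U p f = expect U p (\<lambda>\<omega>. (f \<omega>)\<^sup>2 - 2 * ?m * f \<omega> + ?m\<^sup>2)"
    by (simp add: variance_def power2_diff algebra_simps)
  also have "\<dots> = expect U p (\<lambda>\<omega>. (f \<omega>)\<^sup>2) - ?m\<^sup>2"
    using assms by (simp add: expect_add expect_diff expect_cmult power2_eq_square)
  finally show ?thesis .
qed

text \<open>Induction over the coordinates by the law of total variance: conditional variances fall
  under the induction hypothesis, and the variance of the conditional mean is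
  \<open>p x * (1 - p x)\<close> times a squared difference of means, to which Jensen
  applies.\<close>

lemma efron_stein:
  assumes "finite U" "prob_on U p"
  shows "variance U p f \<le> (\<Sum>x\<in>U. p x * (1 - p x) * expect U p (\<lambda>\<omega>. (f (insert x \<omega>) - f (\<omega> - {x}))\<^sup>2))"
  using assms
proof (induction U arbitrary: f rule: finite_induct)
  case empty
  then show ?case by (simp add: variance_def)
next
  case (insert x U)
  have pr: "prob_on U p" "0 \<le> p x" "p x \<le> 1" using insert.prems by (auto simp: prob_on_def)
  let ?f1 = "\<lambda>\<omega>. f (insert x \<omega>)"
  let ?D = "\<lambda>f y \<omega>. (f (insert y \<omega>) - f (\<omega> - {y}))\<^sup>2"
  have "variance (insert x U) p f = p x * variance U p ?f1 + (1 - p x) * variance U p f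
      + p x * (1 - p x) * (expect U p ?f1 - expect U p f)\<^sup>2"
    unfolding variance_eq[OF insert.hyps(1)] variance_eq[OF finite.insertI[OF insert.hyps(1)]] expect_insert[OF insert.hyps]
    by algebra
  also have "\<dots> \<le> p x * (\<Sum>y\<in>U. p y * (1 - p y) * expect U p (?D ?f1 y))
      + (1 - p x) * (\<Sum>y\<in>U. p y * (1 - p y) * expect U p (?D f y))
      + p x * (1 - p x) * expect U p (\<lambda>\<omega>. (?f1 \<omega> - f \<omega>)\<^sup>2)"
  proof (intro add_mono mult_left_mono insert.IH pr)
    show "(expect U p ?f1 - expect U p f)\<^sup>2 \<le> expect U p (\<lambda>\<omega>. (?f1 \<omega> - f \<omega>)\<^sup>2)"
      unfolding expect_diff[symmetric] by (rule expect_square_le) (use insert pr in auto)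
  qed (use pr in auto)
  also have "\<dots> = (\<Sum>y\<in>insert x U. p y * (1 - p y) * expect (insert x U) p (?D f y))"
  proof -
    have "expect (insert x U) p (?D f y) = p x * expect U p (?D ?f1 y) + (1 - p x) * expect U p (?D f y)" if "y \<in> U" for y
    proof -
      have "x \<noteq> y" using that insert by auto
      then have "insert x \<omega> - {y} = insert x (\<omega> - {y})" for \<omega> by auto
      then show ?thesis using insert.hyps by (simp add: expect_insert insert_commute)
    qed
    moreover have "expect (insert x U) p (?D f x) = expect U p (\<lambda>\<omega>. (?f1 \<omega> - f \<omega>)\<^sup>2)"
    proof -
      have "expect (insert x U) p (?D f x) = expect U p (?D f x)"
        using insert.hyps by (simp add: expect_insert algebra_simps)
      also have "\<dots> = expect U p (\<lambda>\<omega>. (?f1 \<omega> - f \<omega>)\<^sup>2)"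
        using insert.hyps by (intro expect_cong) (auto intro!: arg_cong[where f="\<lambda>A. (_ - f A)\<^sup>2"])
      finally show ?thesis .
    qed
    moreover have "p x * (\<Sum>y\<in>U. p y * (1 - p y) * expect U p (?D ?f1 y))
      + (1 - p x) * (\<Sum>y\<in>U. p y * (1 - p y) * expect U p (?D f y))
      = (\<Sum>y\<in>U. p y * (1 - p y) * (p x * expect U p (?D ?f1 y) + (1 - p x) * expect U p (?D f y)))"
      unfolding sum_distrib_left sum.distrib[symmetric] by (rule sum.cong) (auto simp: algebra_simps)
    ultimately show ?thesis using insert.hyps by simp
  qed
  finally show ?case .
qed

lemma expect_abs_le_sd:
  assumes "finite U" "prob_on U p"
  shows "expect U p (\<lambda>\<omega>. \<bar>f \<omega> - expect U p f\<bar>) \<le> sqrt (variance U p f)"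
  unfolding variance_def using expect_square_le[OF assms, of "\<lambda>\<omega>. \<bar>f \<omega> - expect U p f\<bar>"]
  by (intro real_le_rsqrt) simp

lemma chebyshev:
  assumes "finite U" "prob_on U p" "c > 0"
  shows "expect U p (\<lambda>\<omega>. of_bool (\<bar>f \<omega> - expect U p f\<bar> \<ge> c)) \<le> variance U p f / c\<^sup>2"
proof -
  have "expect U p (\<lambda>\<omega>. of_bool (\<bar>f \<omega> - expect U p f\<bar> \<ge> c)) \<le> expect U p (\<lambda>\<omega>. (1 / c\<^sup>2) * (f \<omega> - expect U p f)\<^sup>2)"
  proof (rule expect_mono[OF assms(2)])
    fix \<omega>
    have "c\<^sup>2 \<le> (f \<omega> - expect U p f)\<^sup>2" if "\<bar>f \<omega> - expect U p f\<bar> \<ge> c"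
      using power_mono[OF that, of 2] assms(3) by simp
    then show "of_bool (\<bar>f \<omega> - expect U p f\<bar> \<ge> c) \<le> (1 / c\<^sup>2) * (f \<omega> - expect U p f)\<^sup>2"
      using assms(3) by (auto simp: of_bool_def field_simps)
  qed
  then show ?thesis by (simp only: expect_cmult variance_def) simp
qed

section \<open>Chains and their concentration\<close>

text \<open>A cell is a pair (column, row). Cells \<open>(i, 0)\<close> are sources, cells \<open>(0, j)\<close> are sinks and
  all other cells form the bulk, where \<open>before\<close> is the strict order in both coordinates. Along
  either axis a chain may use any number of cells, but never both sources and sinks.\<close>
definition before :: "nat \<times> nat \<Rightarrow> nat \<times> nat \<Rightarrow> bool" where
  "before x y \<longleftrightarrow> fst x < fst y \<and> snd x < snd y
     \<or> snd x = 0 \<and> snd y = 0 \<and> fst x < fst y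
     \<or> fst x = 0 \<and> fst y = 0 \<and> snd x < snd y"

definition chain :: "(nat \<times> nat) set \<Rightarrow> bool" where
  "chain S \<longleftrightarrow> (\<forall>x\<in>S. \<forall>y\<in>S. x \<noteq> y \<longrightarrow> before x y \<or> before y x)"

definition longest :: "(nat \<times> nat) set \<Rightarrow> nat" where
  "longest \<omega> = Max (card ` {S. S \<subseteq> \<omega> \<and> chain S})"

lemma chain_subset: "chain S \<Longrightarrow> T \<subseteq> S \<Longrightarrow> chain T"
  unfolding chain_def by (meson subsetD)

lemma longest_ge: "finite \<omega> \<Longrightarrow> S \<subseteq> \<omega> \<Longrightarrow> chain S \<Longrightarrow> card S \<le> longest \<omega>"
  unfolding longest_def by (intro Max_ge) auto

lemma longest_witness:
  assumes "finite \<omega>"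
  obtains S where "S \<subseteq> \<omega>" "chain S" "card S = longest \<omega>"
proof -
  have "longest \<omega> \<in> card ` {S. S \<subseteq> \<omega> \<and> chain S}"
    unfolding longest_def using assms by (intro Max_in) (auto simp: chain_def intro!: exI[of _ "{}"])
  then show ?thesis using that by auto
qed

lemma longest_leI:
  assumes "finite \<omega>" "\<And>S. S \<subseteq> \<omega> \<Longrightarrow> chain S \<Longrightarrow> card S \<le> c"
  shows "longest \<omega> \<le> c"
  using longest_witness[OF assms(1)] assms(2) by metis

lemma longest_mono: "finite \<omega>' \<Longrightarrow> \<omega> \<subseteq> \<omega>' \<Longrightarrow> longest \<omega> \<le> longest \<omega>'"
  by (rule longest_leI) (auto intro: longest_ge finite_subset)

lemma longest_Un_le:
  assumes "finite A" "finite B" "\<And>S. S \<subseteq> A \<Longrightarrow> chain S \<Longrightarrow> card S \<le> c"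
  shows "longest (A \<union> B) \<le> c + longest B"
proof (rule longest_leI)
  fix S assume S: "S \<subseteq> A \<union> B" "chain S"
  then have "card S \<le> card (S \<inter> A) + card (S \<inter> B)"
    by (metis Int_Un_distrib card_Un_le inf.absorb1)
  also have "card (S \<inter> A) \<le> c"
    using assms(3)[of "S \<inter> A"] chain_subset[OF S(2)] by auto
  also have "card (S \<inter> B) \<le> longest B"
    using assms(2) chain_subset[OF S(2)] by (intro longest_ge) auto
  finally show "card S \<le> c + longest B" by simp
qed (use assms in auto)

lemma longest_Un_card_le: "finite A \<Longrightarrow> finite B \<Longrightarrow> longest (A \<union> B) \<le> card A + longest B"
  by (rule longest_Un_le) (auto intro: card_mono)

text \<open>A chain meets each bulk row at most once, so a whole row costs at most one however many
  points it holds. This makes letters with a wrong number of copies cheap.\<close>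

lemma longest_Un_rows_le:
  assumes "finite A" "finite B" "finite J" "\<And>x. x \<in> A \<Longrightarrow> 0 < fst x \<and> 0 < snd x \<and> snd x \<in> J"
  shows "longest (A \<union> B) \<le> card J + longest B"
proof (rule longest_Un_le)
  fix S assume S: "S \<subseteq> A" "chain S"
  have "inj_on snd S"
  proof (rule inj_onI, rule ccontr)
    fix x y assume xy: "x \<in> S" "y \<in> S" "snd x = snd y" "x \<noteq> y"
    then have "before x y \<or> before y x" using S(2) by (simp add: chain_def)
    then show False using xy S(1) assms(4)[of x] assms(4)[of y] by (auto simp: before_def)
  qed
  moreover have "snd ` S \<subseteq> J" using S assms(4) by auto
  ultimately show "card S \<le> card J" using assms(3) by (metis card_inj_on_le)
qed (use assms in auto)

lemma longest_Un_col_le: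
  assumes "finite A" "finite B" "\<And>x. x \<in> A \<Longrightarrow> fst x = Suc i"
  shows "longest (A \<union> B) \<le> 1 + longest B"
proof (rule longest_Un_le)
  fix S assume S: "S \<subseteq> A" "chain S"
  have "x = y" if "x \<in> S" "y \<in> S" for x y
  proof (rule ccontr)
    assume "x \<noteq> y"
    then have "before x y \<or> before y x" using S(2) that by (simp add: chain_def)
    moreover have "fst x = Suc i" "fst y = Suc i" using that S(1) assms(3) by blast+
    ultimately show False by (auto simp: before_def)
  qed
  then show "card S \<le> 1"
    by (metis One_nat_def card_le_Suc0_iff_eq S(1) assms(1) finite_subset)
qed (use assms in auto)

text \<open>\<open>f\<close> need not be injective: a chain in its image lifts to a set
  \<open>T\<close> of representatives, and irreflexivity of \<open>before\<close> makes
  \<open>g\<close> injective on \<open>T\<close>.\<close>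

lemma longest_image_le:
  assumes "finite D" "\<And>x y. x \<in> D \<Longrightarrow> y \<in> D \<Longrightarrow> before (f x) (f y) \<Longrightarrow> before (g x) (g y)"
  shows "longest (f ` D) \<le> longest (g ` D)"
proof (rule longest_leI)
  fix S assume S: "S \<subseteq> f ` D" "chain S"
  then obtain T where T: "T \<subseteq> D" "inj_on f T" "S = f ` T" by (metis subset_image_inj)
  have before: "before (g x) (g y) \<or> before (g y) (g x)" if "x \<in> T" "y \<in> T" "x \<noteq> y" for x y
  proof -
    have "f x \<noteq> f y" using T(2) that by (meson inj_on_eq_iff)
    then have "before (f x) (f y) \<or> before (f y) (f x)" using S(2) T(3) that by (simp add: chain_def)
    then show ?thesis using assms(2) T(1) that by blast
  qed
  have "inj_on g T"
    using before by (fastforce simp: inj_on_def before_def)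
  then have "card S = card (g ` T)" using T by (simp add: card_image)
  also have "\<dots> \<le> longest (g ` D)"
    using T assms(1) before by (intro longest_ge) (auto simp: chain_def)
  finally show "card S \<le> longest (g ` D)" .
qed (use assms in auto)

lemma longest_iso:
  assumes "finite \<omega>" "\<And>x y. x \<in> \<omega> \<Longrightarrow> y \<in> \<omega> \<Longrightarrow> before (h x) (h y) \<longleftrightarrow> before x y"
  shows "longest (h ` \<omega>) = longest \<omega>"
  using longest_image_le[of \<omega> h "\<lambda>x. x"] longest_image_le[of \<omega> "\<lambda>x. x" h] assms by (simp add: antisym)

text \<open>A point whose removal shortens the longest chains lies on every longest chain, so the
  squared discrete gradient in the Efron--Stein inequality sums up to at most the length itself.\<close>
lemma longest_pivotal_sum:
  assumes "finite \<omega>"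
  shows "(\<Sum>x\<in>\<omega>. (real (longest \<omega>) - real (longest (\<omega> - {x})))\<^sup>2) \<le> real (longest \<omega>)"
proof -
  obtain S where S: "S \<subseteq> \<omega>" "chain S" "card S = longest \<omega>"
    using longest_witness[OF assms] .
  have fS: "finite S" using S assms finite_subset by auto
  have "(\<Sum>x\<in>\<omega>. (real (longest \<omega>) - real (longest (\<omega> - {x})))\<^sup>2) \<le> (\<Sum>x\<in>\<omega>. of_bool (x \<in> S))"
  proof (rule sum_mono)
    fix x assume "x \<in> \<omega>"
    have up: "longest (\<omega> - {x}) \<le> longest \<omega>" using assms by (intro longest_mono) auto
    show "(real (longest \<omega>) - real (longest (\<omega> - {x})))\<^sup>2 \<le> of_bool (x \<in> S)"
    proof (cases "x \<in> S")
      case True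
      have "card (S - {x}) \<le> longest (\<omega> - {x})"
        using S assms by (intro longest_ge) (auto intro: chain_subset)
      then have "real (longest \<omega>) - real (longest (\<omega> - {x})) \<le> 1"
        using True S(3) fS by (simp add: card_Diff_singleton)
      then show ?thesis using True up by (simp add: power_le_one)
    next
      case False
      have "card S \<le> longest (\<omega> - {x})"
        using S False assms by (intro longest_ge) auto
      then show ?thesis using False up S(3) by simp
    qed
  qed
  also have "\<dots> = real (card S)"
    using assms S by (simp add: sum_of_bool_eq Int_absorb1)
  finally show ?thesis using S by simp
qed

text \<open>The gradient at \<open>x\<close> does not depend on whether \<open>x\<close> is present,
  so a factor \<open>p x\<close> amounts to inserting the indicator of
  \<open>x \<in> \<omega>\<close>. The Efron-Stein bound thus becomes a sum over present points,
  which is controlled for each configuration separately. The set \<open>Z\<close> lets the bound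
  apply to every class of exit points.\<close>

lemma variance_longest_le:
  assumes "finite U" "prob_on U p"
  shows "variance U p (\<lambda>\<omega>. real (longest (\<omega> \<inter> Z))) \<le> expect U p (\<lambda>\<omega>. real (longest (\<omega> \<inter> Z)))"
proof -
  let ?f = "\<lambda>\<omega>. real (longest (\<omega> \<inter> Z))"
  let ?g = "\<lambda>x \<omega>. of_bool (x \<in> \<omega>) * (?f \<omega> - ?f (\<omega> - {x}))\<^sup>2"
  have "variance U p ?f \<le> (\<Sum>x\<in>U. p x * (1 - p x) * expect U p (\<lambda>\<omega>. (?f (insert x \<omega>) - ?f (\<omega> - {x}))\<^sup>2))"
    by (rule efron_stein) fact+
  also have "\<dots> \<le> (\<Sum>x\<in>U. expect U p (?g x))"
  proof (rule sum_mono)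
    fix x assume x: "x \<in> U"
    let ?D = "\<lambda>\<omega>. (?f (insert x \<omega>) - ?f (\<omega> - {x}))\<^sup>2"
    have nn: "0 \<le> expect (U - {x}) p ?D"
      using assms by (intro expect_nonneg) (auto simp: prob_on_def)
    have px: "0 \<le> p x" "p x \<le> 1" using assms x by (auto simp: prob_on_def)
    have "expect U p ?D = expect (U - {x}) p ?D"
      unfolding expect_split[OF assms(1) x] by (simp add: algebra_simps)
    moreover have "expect U p (?g x) = p x * expect (U - {x}) p ?D"
      unfolding expect_split[OF assms(1) x] using assms by simp
    ultimately show "p x * (1 - p x) * expect U p ?D \<le> expect U p (?g x)"
      using nn px by (simp add: mult_left_le_one_le mult.assoc mult_left_mono)
  qed
  also have "\<dots> = expect U p (\<lambda>\<omega>. \<Sum>x\<in>U. ?g x \<omega>)"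
    by (simp add: expect_sum)
  also have "\<dots> \<le> expect U p ?f"
  proof (rule expect_mono[OF assms(2)])
    fix \<omega> assume w: "\<omega> \<subseteq> U"
    have fw: "finite \<omega>" using w assms finite_subset by auto
    have "(\<Sum>x\<in>U. ?g x \<omega>) = (\<Sum>x\<in>\<omega> \<inter> Z. (?f \<omega> - ?f (\<omega> - {x}))\<^sup>2)"
    proof (rule sum.mono_neutral_cong_right)
      show "\<forall>x\<in>U - \<omega> \<inter> Z. ?g x \<omega> = 0"
      proof
        fix x assume "x \<in> U - \<omega> \<inter> Z"
        then have "x \<notin> \<omega> \<or> (\<omega> - {x}) \<inter> Z = \<omega> \<inter> Z" by auto
        then show "?g x \<omega> = 0" by auto
      qed
    qed (use assms w in auto)
    also have "\<dots> = (\<Sum>x\<in>\<omega> \<inter> Z. (real (longest (\<omega> \<inter> Z)) - real (longest (\<omega> \<inter> Z - {x})))\<^sup>2)"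
      by (intro sum.cong refl arg_cong[where f="\<lambda>A. (_ - real (longest A))\<^sup>2"]) auto
    also have "\<dots> \<le> ?f \<omega>" using fw by (intro longest_pivotal_sum) auto
    finally show "(\<Sum>x\<in>U. ?g x \<omega>) \<le> ?f \<omega>" .
  qed
  finally show ?thesis .
qed

section \<open>The last-passage function and its recursion\<close>

definition lpp :: "(nat \<times> nat) set \<Rightarrow> nat \<Rightarrow> nat \<Rightarrow> nat" where
  "lpp \<omega> i j = longest (\<omega> \<inter> {..i} \<times> {..j})"

lemma lpp_bottom: "finite \<omega> \<Longrightarrow> lpp \<omega> i 0 = card (\<omega> \<inter> {..i} \<times> {0})"
  unfolding lpp_def
proof (rule antisym)
  assume fin: "finite \<omega>"
  show "longest (\<omega> \<inter> {..i} \<times> {..0}) \<le> card (\<omega> \<inter> {..i} \<times> {0})"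
    using fin by (intro longest_leI card_mono) auto
  show "card (\<omega> \<inter> {..i} \<times> {0}) \<le> longest (\<omega> \<inter> {..i} \<times> {..0})"
    using fin by (intro longest_ge) (auto simp: chain_def before_def)
qed

lemma lpp_left: "finite \<omega> \<Longrightarrow> lpp \<omega> 0 j = card (\<omega> \<inter> {0} \<times> {..j})"
  unfolding lpp_def
proof (rule antisym)
  assume fin: "finite \<omega>"
  show "longest (\<omega> \<inter> {..0} \<times> {..j}) \<le> card (\<omega> \<inter> {0} \<times> {..j})"
    using fin by (intro longest_leI card_mono) auto
  show "card (\<omega> \<inter> {0} \<times> {..j}) \<le> longest (\<omega> \<inter> {..0} \<times> {..j})"
    using fin by (intro longest_ge) (auto simp: chain_def before_def)
qed

text \<open>A chain avoiding the corner cannot touch both the last column and the last row, because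
  a point below the corner and a point to its left are incomparable. A chain using the corner has
  all its other points in the smaller box.\<close>

lemma lpp_rec:
  assumes "finite \<omega>"
  shows "lpp \<omega> (Suc i) (Suc j) = max (max (lpp \<omega> i (Suc j)) (lpp \<omega> (Suc i) j))
    (lpp \<omega> i j + of_bool ((Suc i, Suc j) \<in> \<omega>))"
proof (rule antisym)
  let ?c = "(Suc i, Suc j)"
  show "lpp \<omega> (Suc i) (Suc j) \<le> max (max (lpp \<omega> i (Suc j)) (lpp \<omega> (Suc i) j)) (lpp \<omega> i j + of_bool (?c \<in> \<omega>))"
    unfolding lpp_def[of \<omega> "Suc i" "Suc j"]
  proof (rule longest_leI)
    fix S assume S: "S \<subseteq> \<omega> \<inter> {..Suc i} \<times> {..Suc j}" "chain S"
    have fS: "finite S" using S assms finite_subset by blast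
    show "card S \<le> max (max (lpp \<omega> i (Suc j)) (lpp \<omega> (Suc i) j)) (lpp \<omega> i j + of_bool (?c \<in> \<omega>))"
    proof (cases "?c \<in> S")
      case True
      have "S - {?c} \<subseteq> \<omega> \<inter> {..i} \<times> {..j}"
      proof
        fix x assume x: "x \<in> S - {?c}"
        then have "before x ?c \<or> before ?c x" using S True by (auto simp: chain_def)
        then show "x \<in> \<omega> \<inter> {..i} \<times> {..j}" using x S(1) by (cases x) (auto simp: before_def)
      qed
      then have "card (S - {?c}) \<le> lpp \<omega> i j"
        unfolding lpp_def using assms S by (intro longest_ge) (auto intro: chain_subset)
      then show ?thesis using True S fS by (auto simp: card_Diff_singleton)
    next
      case False
      have "S \<subseteq> \<omega> \<inter> {..i} \<times> {..Suc j} \<or> S \<subseteq> \<omega> \<inter> {..Suc i} \<times> {..j}"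
      proof (rule ccontr)
        assume "\<not> ?thesis"
        then obtain x y where x: "x \<in> S" "x \<notin> {..i} \<times> {..Suc j}" and y: "y \<in> S" "y \<notin> {..Suc i} \<times> {..j}"
          using S(1) by blast
        have "x \<in> {..Suc i} \<times> {..Suc j}" "y \<in> {..Suc i} \<times> {..Suc j}" "x \<noteq> ?c" "y \<noteq> ?c"
          using S(1) x y False by auto
        then have xy: "x \<in> S" "fst x = Suc i" "y \<in> S" "snd y = Suc j" and "snd x \<le> j" "fst y \<le> i"
          using x y by (cases x; cases y; auto simp: le_Suc_eq)+
        moreover have "before x y \<or> before y x"
        proof -
          have "x \<noteq> y" using xy \<open>fst y \<le> i\<close> by auto
          then show ?thesis using S(2) xy by (simp add: chain_def)
        qed
        ultimately show False using xy by (auto simp: before_def)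
      qed
      then have "card S \<le> lpp \<omega> i (Suc j) \<or> card S \<le> lpp \<omega> (Suc i) j"
        unfolding lpp_def using assms S by (auto intro: longest_ge)
      then show ?thesis by auto
    qed
  qed (use assms in auto)
  have 1: "lpp \<omega> i (Suc j) \<le> lpp \<omega> (Suc i) (Suc j)" "lpp \<omega> (Suc i) j \<le> lpp \<omega> (Suc i) (Suc j)"
    "lpp \<omega> i j \<le> lpp \<omega> (Suc i) (Suc j)"
    unfolding lpp_def using assms by (auto intro!: longest_mono)
  have 2: "lpp \<omega> i j + 1 \<le> lpp \<omega> (Suc i) (Suc j)" if c: "?c \<in> \<omega>"
  proof -
    obtain S where S: "S \<subseteq> \<omega> \<inter> {..i} \<times> {..j}" "chain S" "card S = lpp \<omega> i j"
      unfolding lpp_def using longest_witness[of "\<omega> \<inter> {..i} \<times> {..j}"] assms by auto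
    have "finite S" "?c \<notin> S" using S(1) assms finite_subset by fastforce+
    then have "lpp \<omega> i j + 1 = card (insert ?c S)" using S by simp
    also have "\<dots> \<le> lpp \<omega> (Suc i) (Suc j)"
      unfolding lpp_def
    proof (rule longest_ge)
      have "before x ?c" if "x \<in> S" for x
        using that S(1) by (auto simp: before_def)
      then show "chain (insert ?c S)" using S(2) by (auto simp: chain_def)
    qed (use assms S c in auto)
    finally show ?thesis .
  qed
  show "max (max (lpp \<omega> i (Suc j)) (lpp \<omega> (Suc i) j)) (lpp \<omega> i j + of_bool (?c \<in> \<omega>)) \<le> lpp \<omega> (Suc i) (Suc j)"
    using 1 2 by (auto simp: of_bool_def)
qed

lemma lpp_Suc_le: "finite \<omega> \<Longrightarrow> lpp \<omega> (Suc i) j \<le> Suc (lpp \<omega> i j)"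
proof -
  assume fin: "finite \<omega>"
  have "\<omega> \<inter> {..Suc i} \<times> {..j} = (\<omega> \<inter> {Suc i} \<times> {..j}) \<union> (\<omega> \<inter> {..i} \<times> {..j})"
    by (auto simp: le_Suc_eq)
  then show ?thesis
    unfolding lpp_def using fin longest_Un_col_le[of "\<omega> \<inter> {Suc i} \<times> {..j}" "\<omega> \<inter> {..i} \<times> {..j}" i] by auto
qed

section \<open>The stationary process with sources and sinks\<close>

text \<open>If the bottom edge of a cell carries the increment \<open>a\<close>, its left edge the increment \<open>y\<close> and
  \<open>b\<close> tells whether the cell is occupied, then the recursion for \<open>lpp\<close> gives
  \<open>max a y b - y\<close> on the top edge and \<open>max a y b - a\<close> on the right edge.\<close>
definition xout :: "bool \<Rightarrow> bool \<Rightarrow> bool \<Rightarrow> bool" where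
  "xout a y b \<longleftrightarrow> (a \<or> b) \<and> \<not> y"

definition yout :: "bool \<Rightarrow> bool \<Rightarrow> bool \<Rightarrow> bool" where
  "yout a y b \<longleftrightarrow> (y \<or> b) \<and> \<not> a"

text \<open>A row is swept from left to right: \<open>A\<close> holds the increments on its bottom
  edges, \<open>B\<close> its occupied columns and \<open>y\<close> its sink.
  \<open>sink_flow\<close> is the increment on the vertical edge to the right of column
  \<open>i\<close>; \<open>row_update\<close> below collects the increments on the top
  edges.\<close>

primrec sink_flow :: "nat set \<Rightarrow> nat set \<Rightarrow> bool \<Rightarrow> nat \<Rightarrow> bool" where
  "sink_flow A B y 0 = y"
| "sink_flow A B y (Suc i) = yout (Suc i \<in> A) (sink_flow A B y i) (Suc i \<in> B)"

definition row_update :: "nat set \<Rightarrow> nat set \<Rightarrow> bool \<Rightarrow> nat \<Rightarrow> nat set" where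
  "row_update A B y m = {i\<in>{1..m}. xout (i \<in> A) (sink_flow A B y (i - 1)) (i \<in> B)}"

lemma sink_flow_cong:
  "A \<inter> {1..m} = A' \<inter> {1..m} \<Longrightarrow> B \<inter> {1..m} = B' \<inter> {1..m} \<Longrightarrow> i \<le> m \<Longrightarrow> sink_flow A B y i = sink_flow A' B' y i"
proof (induction i)
  case (Suc i)
  have "Suc i \<in> A \<longleftrightarrow> Suc i \<in> A'" "Suc i \<in> B \<longleftrightarrow> Suc i \<in> B'"
    using Suc.prems by (auto simp: set_eq_iff)
  then show ?case using Suc by simp
qed simp

lemma row_update_cong:
  assumes "A \<inter> {1..m} = A' \<inter> {1..m}" "B \<inter> {1..m} = B' \<inter> {1..m}"
  shows "row_update A B y m = row_update A' B' y m"
proof -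
  have "xout (i \<in> A) (sink_flow A B y (i - 1)) (i \<in> B) = xout (i \<in> A') (sink_flow A' B' y (i - 1)) (i \<in> B')"
    if "i \<in> {1..m}" for i
  proof -
    have "i \<in> A \<longleftrightarrow> i \<in> A'" "i \<in> B \<longleftrightarrow> i \<in> B'" using that assms by blast+
    moreover have "sink_flow A B y (i - 1) = sink_flow A' B' y (i - 1)"
      using that by (intro sink_flow_cong[OF assms]) auto
    ultimately show ?thesis by simp
  qed
  then show ?thesis by (auto simp: row_update_def)
qed

lemma row_update_Suc:
  "row_update A B y (Suc m) = row_update A B y m \<union> (if xout (Suc m \<in> A) (sink_flow A B y m) (Suc m \<in> B) then {Suc m} else {})"
  by (auto simp: row_update_def le_Suc_eq)

definition coin :: "real \<Rightarrow> (bool \<Rightarrow> real) \<Rightarrow> real" where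
  "coin q g = q * g True + (1 - q) * g False"

lemma expect_coin: "expect U p (\<lambda>\<omega>. coin q (\<lambda>y. f y \<omega>)) = coin q (\<lambda>y. expect U p (f y))"
  by (simp add: coin_def expect_add expect_cmult)

lemma expect_insert_coin:
  assumes "finite U" "x \<notin> U"
  shows "expect (insert x U) p f = coin (p x) (\<lambda>a. expect U p (\<lambda>\<omega>. f (if a then insert x \<omega> else \<omega>)))"
  using assms by (simp add: expect_insert coin_def)

text \<open>The relation between \<open>\<alpha>\<close>, \<open>\<beta>\<close> and \<open>p\<close> is exactly the condition under which a single cell
  preserves the product law of its two incoming increments.\<close>
lemma burke_row:
  assumes rel: "p * (1 - \<alpha>) * (1 - \<beta>) = \<alpha> * \<beta>"
  shows "expect {1..m} (\<lambda>_. \<alpha>) (\<lambda>A. expect {1..m} (\<lambda>_. p) (\<lambda>B. coin \<beta> (\<lambda>y. F (row_update A B y m) (sink_flow A B y m))))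
       = expect {1..m} (\<lambda>_. \<alpha>) (\<lambda>A. coin \<beta> (F A))"
proof (induction m arbitrary: F)
  case 0
  show ?case by (simp add: row_update_def coin_def)
next
  case (Suc m)
  \<comment> \<open>\<open>F'\<close> averages over the last cell, given what the first
    \<open>m\<close> cells pass on. The induction hypothesis is applied to \<open>F'\<close> instead
    of \<open>F\<close>.\<close>
  define F' where "F' = (\<lambda>A' y'. coin \<alpha> (\<lambda>a. coin p (\<lambda>b.
      F (if xout a y' b then insert (Suc m) A' else A') (yout a y' b))))"
  have ins: "{1..Suc m} = insert (Suc m) {1..m}" by (auto simp: le_Suc_eq)
  have nin: "Suc m \<notin> {1..m}" by simp
  let ?i = "\<lambda>a A. if a then insert (Suc m) A else A"
  have step: "F (row_update (?i a A) (?i b B) y (Suc m)) (sink_flow (?i a A) (?i b B) y (Suc m))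
      = F (?i (xout a (sink_flow A B y m) b) (row_update A B y m)) (yout a (sink_flow A B y m) b)"
    if "A \<subseteq> {1..m}" "B \<subseteq> {1..m}" for a b A B y
  proof -
    have *: "?i a A \<inter> {1..m} = A \<inter> {1..m}" "?i b B \<inter> {1..m} = B \<inter> {1..m}" by auto
    have "row_update (?i a A) (?i b B) y m = row_update A B y m" "sink_flow (?i a A) (?i b B) y m = sink_flow A B y m"
      by (rule row_update_cong[OF *], rule sink_flow_cong[OF * le_refl])
    moreover have "Suc m \<in> ?i a A \<longleftrightarrow> a" "Suc m \<in> ?i b B \<longleftrightarrow> b" using that by auto
    ultimately show ?thesis by (simp only: row_update_Suc sink_flow.simps) auto
  qed
  have "expect {1..Suc m} (\<lambda>_. \<alpha>) (\<lambda>A. expect {1..Suc m} (\<lambda>_. p) (\<lambda>B. coin \<beta> (\<lambda>y. F (row_update A B y (Suc m)) (sink_flow A B y (Suc m)))))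
     = coin \<alpha> (\<lambda>a. expect {1..m} (\<lambda>_. \<alpha>) (\<lambda>A. coin p (\<lambda>b. expect {1..m} (\<lambda>_. p) (\<lambda>B. coin \<beta> (\<lambda>y.
          F (row_update (?i a A) (?i b B) y (Suc m)) (sink_flow (?i a A) (?i b B) y (Suc m)))))))"
    unfolding ins by (simp only: expect_insert_coin[OF finite_atLeastAtMost nin])
  also have "\<dots> = coin \<alpha> (\<lambda>a. expect {1..m} (\<lambda>_. \<alpha>) (\<lambda>A. coin p (\<lambda>b. expect {1..m} (\<lambda>_. p) (\<lambda>B. coin \<beta> (\<lambda>y.
          F (?i (xout a (sink_flow A B y m) b) (row_update A B y m)) (yout a (sink_flow A B y m) b))))))"
    by (intro arg_cong[where f="coin _"] ext expect_cong refl) (simp only: step)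
  also have "\<dots> = expect {1..m} (\<lambda>_. \<alpha>) (\<lambda>A. expect {1..m} (\<lambda>_. p) (\<lambda>B. coin \<beta> (\<lambda>y. F' (row_update A B y m) (sink_flow A B y m))))"
    unfolding F'_def expect_coin[symmetric]
    by (intro expect_cong refl) (simp add: coin_def algebra_simps)
  also have "\<dots> = expect {1..m} (\<lambda>_. \<alpha>) (\<lambda>A. coin \<beta> (F' A))"
    by (rule Suc.IH)
  also have "\<dots> = expect {1..m} (\<lambda>_. \<alpha>) (\<lambda>A. coin \<alpha> (\<lambda>a. coin \<beta> (F (?i a A))))"
  proof (intro expect_cong refl)
    fix A
    \<comment> \<open>Only inputs with \<open>a = y\<close> are altered: two increments annihilate,
      and an occupied cell without incoming increments creates two. The relation says that these two
      events have equal probability.\<close>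
    have "coin \<beta> (F' A) - coin \<alpha> (\<lambda>a. coin \<beta> (F (?i a A)))
       = (p * (1 - \<alpha>) * (1 - \<beta>) - \<alpha> * \<beta>) * (F (insert (Suc m) A) True - F A False)"
      unfolding F'_def coin_def xout_def yout_def by (simp add: algebra_simps)
    then show "coin \<beta> (F' A) = coin \<alpha> (\<lambda>a. coin \<beta> (F (?i a A)))" using rel by simp
  qed
  also have "\<dots> = expect {1..Suc m} (\<lambda>_. \<alpha>) (\<lambda>A. coin \<beta> (F A))"
    unfolding ins by (simp only: expect_insert_coin[OF finite_atLeastAtMost nin] expect_coin) (simp add: coin_def algebra_simps)
  finally show ?case .
qed

section \<open>Stationary increments on a finite grid\<close>

definition grid :: "nat \<Rightarrow> nat \<Rightarrow> (nat \<times> nat) set" where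
  "grid m n = {..m} \<times> {..n} - {(0, 0)}"

text \<open>The origin is the only cell on both axes; \<open>grid\<close> omits it, so source and
  sink rates never conflict.\<close>

definition rates :: "real \<Rightarrow> real \<Rightarrow> real \<Rightarrow> nat \<times> nat \<Rightarrow> real" where
  "rates \<alpha> \<beta> p x = (if snd x = 0 then \<alpha> else if fst x = 0 then \<beta> else p)"

definition increments :: "nat \<Rightarrow> (nat \<times> nat) set \<Rightarrow> nat \<Rightarrow> nat set" where
  "increments m \<omega> j = {i\<in>{1..m}. lpp \<omega> (i - 1) j < lpp \<omega> i j}"

lemma finite_grid [simp]: "finite (grid m n)"
  by (simp add: grid_def)

lemma lpp_col_step:
  assumes "finite \<omega>" "i < m"
  shows "lpp \<omega> (Suc i) j = lpp \<omega> i j + of_bool (Suc i \<in> increments m \<omega> j)"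
proof -
  have "lpp \<omega> i j \<le> lpp \<omega> (Suc i) j"
    unfolding lpp_def using assms by (intro longest_mono) auto
  then show ?thesis using lpp_Suc_le[OF assms(1), of i j] assms(2) by (auto simp: increments_def)
qed

text \<open>Running \<open>lpp_rec\<close> across the row identifies the bits of
  \<open>sink_flow\<close> with the vertical increments of \<open>lpp\<close>.\<close>

lemma lpp_row_step:
  assumes "finite \<omega>" "i \<le> m"
  shows "lpp \<omega> i (Suc j) = lpp \<omega> i j
    + of_bool (sink_flow (increments m \<omega> j) {i. (i, Suc j) \<in> \<omega>} ((0, Suc j) \<in> \<omega>) i)"
  using assms(2)
proof (induction i)
  case 0
  have "\<omega> \<inter> {0} \<times> {..Suc j} = (\<omega> \<inter> {(0, Suc j)}) \<union> (\<omega> \<inter> {0} \<times> {..j})" by (auto simp: le_Suc_eq)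
  moreover have "card ((\<omega> \<inter> {(0, Suc j)}) \<union> (\<omega> \<inter> {0} \<times> {..j})) = card (\<omega> \<inter> {(0, Suc j)}) + card (\<omega> \<inter> {0} \<times> {..j})"
    using assms by (intro card_Un_disjoint) auto
  ultimately show ?case using assms by (simp add: lpp_left)
next
  case (Suc i)
  then have i: "i < m" "i \<le> m" by auto
  show ?case
    unfolding lpp_rec[OF assms(1), of i j] lpp_col_step[OF assms(1) i(1), of j] Suc.IH[OF i(2)]
    by (auto simp: yout_def)
qed

lemma increments_Suc:
  assumes "finite \<omega>"
  shows "increments m \<omega> (Suc j) = row_update (increments m \<omega> j) {i. (i, Suc j) \<in> \<omega>} ((0, Suc j) \<in> \<omega>) m"
proof -
  let ?y = "sink_flow (increments m \<omega> j) {i. (i, Suc j) \<in> \<omega>} ((0, Suc j) \<in> \<omega>)"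
  have "lpp \<omega> i (Suc j) < lpp \<omega> (Suc i) (Suc j) \<longleftrightarrow> xout (Suc i \<in> increments m \<omega> j) (?y i) ((Suc i, Suc j) \<in> \<omega>)"
    if "i < m" for i
    using lpp_row_step[OF assms, of i m j] lpp_row_step[OF assms, of "Suc i" m j] lpp_col_step[OF assms, of i m j] that
    by (auto simp: xout_def yout_def of_bool_def split: if_splits)
  then have "lpp \<omega> (i - 1) (Suc j) < lpp \<omega> i (Suc j) \<longleftrightarrow> xout (i \<in> increments m \<omega> j) (?y (i - 1)) ((i, Suc j) \<in> \<omega>)"
    if "i \<in> {1..m}" for i
    using that by (cases i) auto
  then show ?thesis unfolding increments_def[of m \<omega> "Suc j"] row_update_def by auto
qed

lemma increments_bottom:
  assumes "finite \<omega>"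
  shows "increments m \<omega> 0 = {i\<in>{1..m}. (i, 0) \<in> \<omega>}"
proof -
  have "lpp \<omega> (Suc i) 0 = lpp \<omega> i 0 + of_bool ((Suc i, 0) \<in> \<omega>)" for i
  proof -
    have "\<omega> \<inter> {..Suc i} \<times> {0} = (\<omega> \<inter> {(Suc i, 0)}) \<union> (\<omega> \<inter> {..i} \<times> {0})" by (auto simp: le_Suc_eq)
    moreover have "card ((\<omega> \<inter> {(Suc i, 0)}) \<union> (\<omega> \<inter> {..i} \<times> {0})) = card (\<omega> \<inter> {(Suc i, 0)}) + card (\<omega> \<inter> {..i} \<times> {0})"
      using assms by (intro card_Un_disjoint) auto
    ultimately show ?thesis using assms by (simp add: lpp_bottom)
  qed
  then have "lpp \<omega> (i - 1) 0 < lpp \<omega> i 0 \<longleftrightarrow> (i, 0) \<in> \<omega>" if "i \<in> {1..m}" for i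
    using that by (cases i) (auto simp: of_bool_def)
  then show ?thesis by (auto simp: increments_def)
qed

lemma expect_grid_Suc:
  "expect (grid m (Suc n)) (rates \<alpha> \<beta> p) f = expect (grid m n) (rates \<alpha> \<beta> p) (\<lambda>\<omega>.
     expect {1..m} (\<lambda>_. p) (\<lambda>B. coin \<beta> (\<lambda>y. f (\<omega> \<union> ((\<lambda>i. (i, Suc n)) ` B \<union> (if y then {(0, Suc n)} else {}))))))"
proof -
  let ?h = "\<lambda>i. (i, Suc n)"
  let ?R = "insert (0, Suc n) (?h ` {1..m})"
  have eq: "grid m (Suc n) = grid m n \<union> ?R" unfolding grid_def by (auto simp: le_Suc_eq image_iff)
  have "expect (grid m (Suc n)) (rates \<alpha> \<beta> p) f
      = expect (grid m n) (rates \<alpha> \<beta> p) (\<lambda>\<omega>. expect ?R (rates \<alpha> \<beta> p) (\<lambda>b. f (\<omega> \<union> b)))"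
    unfolding eq by (rule expect_Un) (auto simp: grid_def)
  also have "\<dots> = expect (grid m n) (rates \<alpha> \<beta> p) (\<lambda>\<omega>. coin \<beta> (\<lambda>y. expect {1..m} (\<lambda>_. p)
      (\<lambda>B. f (\<omega> \<union> (if y then insert (0, Suc n) (?h ` B) else ?h ` B)))))"
  proof (intro expect_cong refl)
    fix \<omega>
    have "expect ?R (rates \<alpha> \<beta> p) (\<lambda>b. f (\<omega> \<union> b)) = coin (rates \<alpha> \<beta> p (0, Suc n))
       (\<lambda>y. expect (?h ` {1..m}) (rates \<alpha> \<beta> p) (\<lambda>b. f (\<omega> \<union> (if y then insert (0, Suc n) b else b))))"
      by (rule expect_insert_coin) auto
    also have "\<dots> = coin \<beta> (\<lambda>y. expect {1..m} (\<lambda>i. rates \<alpha> \<beta> p (i, Suc n)) (\<lambda>B. f (\<omega> \<union> (if y then insert (0, Suc n) (?h ` B) else ?h ` B))))"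
      by (subst expect_reindex) (auto simp: inj_on_def rates_def)
    also have "\<dots> = coin \<beta> (\<lambda>y. expect {1..m} (\<lambda>_. p) (\<lambda>B. f (\<omega> \<union> (if y then insert (0, Suc n) (?h ` B) else ?h ` B))))"
      by (intro arg_cong[where f="coin \<beta>"] ext expect_cong refl) (auto simp: rates_def)
    finally show "expect ?R (rates \<alpha> \<beta> p) (\<lambda>b. f (\<omega> \<union> b)) = \<dots>" .
  qed
  also have "\<dots> = expect (grid m n) (rates \<alpha> \<beta> p) (\<lambda>\<omega>.
     expect {1..m} (\<lambda>_. p) (\<lambda>B. coin \<beta> (\<lambda>y. f (\<omega> \<union> (?h ` B \<union> (if y then {(0, Suc n)} else {}))))))"
    unfolding expect_coin[symmetric] by (intro expect_cong arg_cong[where f="coin _"] ext refl arg_cong[where f=f]) auto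
  finally show ?thesis .
qed

lemma lpp_Un_above: "\<omega>' \<inter> {..i} \<times> {..j} = {} \<Longrightarrow> lpp (\<omega> \<union> \<omega>') i j = lpp \<omega> i j"
  unfolding lpp_def by (auto simp: Int_Un_distrib2)

text \<open>The new row is independent of the rows below, which influence it only through
  \<open>increments m \<omega> n\<close>. The law of these increments is therefore all that
  \<open>burke_row\<close> needs. The vertical increment at the right end is kept in the statement
  because the mean is computed from it.\<close>

lemma stationary_step:
  assumes rel: "p * (1 - \<alpha>) * (1 - \<beta>) = \<alpha> * \<beta>"
    and IH: "\<And>F. expect (grid m n) (rates \<alpha> \<beta> p) (\<lambda>\<omega>. F (increments m \<omega> n)) = expect {1..m} (\<lambda>_. \<alpha>) F"
  shows "expect (grid m (Suc n)) (rates \<alpha> \<beta> p) (\<lambda>\<omega>. F (increments m \<omega> (Suc n)) (lpp \<omega> m n < lpp \<omega> m (Suc n)))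
    = expect {1..m} (\<lambda>_. \<alpha>) (\<lambda>A. coin \<beta> (F A))"
proof -
  let ?ext = "\<lambda>\<omega> B y. \<omega> \<union> ((\<lambda>i. (i, Suc n)) ` B \<union> (if y then {(0, Suc n)} else {}))"
  have *: "F (increments m (?ext \<omega> B y) (Suc n)) (lpp (?ext \<omega> B y) m n < lpp (?ext \<omega> B y) m (Suc n))
      = F (row_update (increments m \<omega> n) B y m) (sink_flow (increments m \<omega> n) B y m)"
    if w: "\<omega> \<subseteq> grid m n" and B: "B \<subseteq> {1..m}" for \<omega> B y
  proof -
    have fin: "finite (?ext \<omega> B y)" using w B finite_subset[OF w] finite_subset[OF B] by auto
    have "lpp (?ext \<omega> B y) i n = lpp \<omega> i n" for i
      by (rule lpp_Un_above) auto
    then have x: "increments m (?ext \<omega> B y) n = increments m \<omega> n" by (simp add: increments_def)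
    have y: "(0, Suc n) \<in> ?ext \<omega> B y \<longleftrightarrow> y" using w B by (auto simp: grid_def)
    have b: "{i. (i, Suc n) \<in> ?ext \<omega> B y} \<inter> {1..m} = B \<inter> {1..m}" using w by (auto simp: grid_def)
    have "increments m (?ext \<omega> B y) (Suc n) = row_update (increments m \<omega> n) B y m"
      unfolding increments_Suc[OF fin] x y by (rule row_update_cong[OF refl b])
    moreover have "lpp (?ext \<omega> B y) m n < lpp (?ext \<omega> B y) m (Suc n) \<longleftrightarrow> sink_flow (increments m \<omega> n) B y m"
      unfolding lpp_row_step[OF fin le_refl] x y using sink_flow_cong[OF refl b le_refl] by auto
    ultimately show ?thesis by simp
  qed
  have "expect (grid m (Suc n)) (rates \<alpha> \<beta> p) (\<lambda>\<omega>. F (increments m \<omega> (Suc n)) (lpp \<omega> m n < lpp \<omega> m (Suc n)))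
     = expect (grid m n) (rates \<alpha> \<beta> p) (\<lambda>\<omega>. expect {1..m} (\<lambda>_. p)
         (\<lambda>B. coin \<beta> (\<lambda>y. F (row_update (increments m \<omega> n) B y m) (sink_flow (increments m \<omega> n) B y m))))"
    unfolding expect_grid_Suc by (intro expect_cong refl arg_cong[where f="coin _"] ext) (rule *)
  also have "\<dots> = expect {1..m} (\<lambda>_. \<alpha>) (\<lambda>A. expect {1..m} (\<lambda>_. p)
         (\<lambda>B. coin \<beta> (\<lambda>y. F (row_update A B y m) (sink_flow A B y m))))"
    by (rule IH)
  also have "\<dots> = expect {1..m} (\<lambda>_. \<alpha>) (\<lambda>A. coin \<beta> (F A))"
    by (rule burke_row[OF rel])
  finally show ?thesis .
qed

lemma grid_0: "grid m 0 = (\<lambda>i. (i, 0)) ` {1..m}"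
  by (auto simp: grid_def image_iff)

lemma stationary_increments:
  assumes rel: "p * (1 - \<alpha>) * (1 - \<beta>) = \<alpha> * \<beta>"
  shows "expect (grid m n) (rates \<alpha> \<beta> p) (\<lambda>\<omega>. F (increments m \<omega> n)) = expect {1..m} (\<lambda>_. \<alpha>) F"
proof (induction n arbitrary: F)
  case 0
  have "expect (grid m 0) (rates \<alpha> \<beta> p) (\<lambda>\<omega>. F (increments m \<omega> 0))
      = expect {1..m} (\<lambda>i. rates \<alpha> \<beta> p (i, 0)) (\<lambda>A. F (increments m ((\<lambda>i. (i, 0)) ` A) 0))"
    unfolding grid_0 by (rule expect_reindex) (auto simp: inj_on_def)
  also have "\<dots> = expect {1..m} (\<lambda>_. \<alpha>) F"
  proof (intro expect_cong refl arg_cong[where f=F])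
    fix A :: "nat set" assume "A \<subseteq> {1..m}"
    then show "increments m ((\<lambda>i. (i, 0)) ` A) 0 = A"
      using finite_subset[OF \<open>A \<subseteq> {1..m}\<close>] by (subst increments_bottom) auto
  qed (simp add: rates_def)
  finally show ?case .
next
  case (Suc n)
  show ?case using stationary_step[OF rel Suc.IH, where F="\<lambda>A _. F A"] by (simp add: coin_def algebra_simps)
qed

text \<open>\<open>lpp\<close> is summed along the bottom edge, at rate \<open>\<alpha>\<close>, and
  then up the right edge, where stationarity makes each vertical increment occur with probability
  \<open>\<beta>\<close>.\<close>

lemma expect_stationary:
  assumes rel: "p * (1 - \<alpha>) * (1 - \<beta>) = \<alpha> * \<beta>"
  shows "expect (grid m n) (rates \<alpha> \<beta> p) (\<lambda>\<omega>. real (lpp \<omega> m n)) = \<alpha> * m + \<beta> * n"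
proof (induction n)
  case 0
  have "expect (grid m 0) (rates \<alpha> \<beta> p) (\<lambda>\<omega>. real (lpp \<omega> m 0))
      = expect (grid m 0) (rates \<alpha> \<beta> p) (\<lambda>\<omega>. real (card (\<omega> \<inter> grid m 0)))"
  proof (intro expect_cong refl)
    fix \<omega> assume w: "\<omega> \<subseteq> grid m 0"
    then have "finite \<omega>" using finite_subset[OF w] by simp
    moreover have "\<omega> \<inter> {..m} \<times> {0} = \<omega> \<inter> grid m 0" using w by (auto simp: grid_def)
    ultimately show "real (lpp \<omega> m 0) = real (card (\<omega> \<inter> grid m 0))" by (simp add: lpp_bottom)
  qed
  also have "\<dots> = (\<Sum>x\<in>grid m 0. rates \<alpha> \<beta> p x)"
    by (rule expect_card) auto
  also have "\<dots> = \<alpha> * m"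
    unfolding grid_0 by (subst sum.reindex) (auto simp: inj_on_def rates_def)
  finally show ?case by simp
next
  case (Suc n)
  let ?E = "expect (grid m (Suc n)) (rates \<alpha> \<beta> p)"
  have "?E (\<lambda>\<omega>. real (lpp \<omega> m (Suc n))) = ?E (\<lambda>\<omega>. real (lpp (\<omega> \<inter> grid m n) m n) + of_bool (lpp \<omega> m n < lpp \<omega> m (Suc n)))"
  proof (intro expect_cong refl)
    fix \<omega> assume w: "\<omega> \<subseteq> grid m (Suc n)"
    then have fin: "finite \<omega>" using finite_subset[OF w] by simp
    have "(\<omega> \<inter> grid m n) \<inter> {..m} \<times> {..n} = \<omega> \<inter> {..m} \<times> {..n}" using w by (auto simp: grid_def)
    then have "lpp (\<omega> \<inter> grid m n) m n = lpp \<omega> m n" by (simp add: lpp_def)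
    then show "real (lpp \<omega> m (Suc n)) = real (lpp (\<omega> \<inter> grid m n) m n) + of_bool (lpp \<omega> m n < lpp \<omega> m (Suc n))"
      using lpp_row_step[OF fin le_refl, of m n] by auto
  qed
  also have "\<dots> = ?E (\<lambda>\<omega>. real (lpp (\<omega> \<inter> grid m n) m n)) + ?E (\<lambda>\<omega>. of_bool (lpp \<omega> m n < lpp \<omega> m (Suc n)))"
    by (rule expect_add)
  also have "?E (\<lambda>\<omega>. real (lpp (\<omega> \<inter> grid m n) m n)) = \<alpha> * m + \<beta> * n"
    unfolding Suc.IH[symmetric] by (rule expect_marginal) (auto simp: grid_def)
  also have "?E (\<lambda>\<omega>. of_bool (lpp \<omega> m n < lpp \<omega> m (Suc n))) = \<beta>"
    using stationary_step[OF rel stationary_increments[OF rel], where F="\<lambda>_ y. of_bool y"] by (simp add: coin_def)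
  finally show ?case by (simp add: algebra_simps)
qed

section \<open>Exit points\<close>

definition bulk :: "nat \<Rightarrow> nat \<Rightarrow> (nat \<times> nat) set" where
  "bulk m n = {1..m} \<times> {1..n}"

definition bern_mean :: "nat \<Rightarrow> nat \<Rightarrow> real \<Rightarrow> real" where
  "bern_mean m n p = expect (bulk m n) (\<lambda>_. p) (\<lambda>\<omega>. real (longest \<omega>))"

lemma finite_bulk [simp]: "finite (bulk m n)"
  by (simp add: bulk_def)

definition balanced :: "real \<Rightarrow> real \<Rightarrow> real \<Rightarrow> bool" where
  "balanced \<alpha> \<beta> p \<longleftrightarrow> 0 \<le> \<alpha> \<and> \<alpha> \<le> 1 \<and> 0 \<le> \<beta> \<and> \<beta> \<le> 1 \<and> 0 \<le> p \<and> p \<le> 1 \<and> p * (1 - \<alpha>) * (1 - \<beta>) = \<alpha> * \<beta>"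

lemma balanced_prob_on: "balanced \<alpha> \<beta> p \<Longrightarrow> prob_on U (rates \<alpha> \<beta> p)"
  by (auto simp: balanced_def prob_on_def rates_def)

lemma expect_balanced_le:
  assumes "balanced \<alpha> \<beta> p"
  shows "expect (grid m n) (rates \<alpha> \<beta> p) (\<lambda>\<omega>. real (longest (\<omega> \<inter> Z))) \<le> \<alpha> * m + \<beta> * n"
proof -
  have "expect (grid m n) (rates \<alpha> \<beta> p) (\<lambda>\<omega>. real (longest (\<omega> \<inter> Z)))
      \<le> expect (grid m n) (rates \<alpha> \<beta> p) (\<lambda>\<omega>. real (lpp \<omega> m n))"
  proof (rule expect_mono[OF balanced_prob_on[OF assms]])
    fix \<omega> assume w: "\<omega> \<subseteq> grid m n"
    then have "finite \<omega>" using finite_subset[OF w] by simp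
    then show "real (longest (\<omega> \<inter> Z)) \<le> real (lpp \<omega> m n)"
      using w unfolding lpp_def by (auto intro!: longest_mono simp: grid_def)
  qed
  then show ?thesis using expect_stationary assms by (simp add: balanced_def)
qed

lemma bern_mean_eq_grid: "bern_mean m n p = expect (grid m n) (rates \<alpha> \<beta> p) (\<lambda>\<omega>. real (longest (\<omega> \<inter> bulk m n)))"
proof -
  have "expect (grid m n) (rates \<alpha> \<beta> p) (\<lambda>\<omega>. real (longest (\<omega> \<inter> bulk m n)))
     = expect (bulk m n) (rates \<alpha> \<beta> p) (\<lambda>\<omega>. real (longest \<omega>))"
    by (rule expect_marginal) (auto simp: grid_def bulk_def)
  also have "\<dots> = bern_mean m n p"
    unfolding bern_mean_def by (rule expect_cong) (auto simp: bulk_def rates_def)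
  finally show ?thesis by simp
qed

lemma bern_mean_le: "balanced \<alpha> \<beta> p \<Longrightarrow> bern_mean m n p \<le> \<alpha> * m + \<beta> * n"
  using bern_mean_eq_grid expect_balanced_le by metis

text \<open>Paths that leave the bottom axis after column \<open>z\<close> see a stationary process on the remaining
  columns, in which the source rate may be increased to any balanced \<open>\<alpha>'\<close>.\<close>
lemma expect_late_source_le:
  assumes ab: "balanced \<alpha> \<beta> p" and ab': "balanced \<alpha>' \<beta>' p" and "\<alpha> \<le> \<alpha>'" "z \<le> m"
  shows "expect (grid m n) (rates \<alpha> \<beta> p) (\<lambda>\<omega>. real (longest (\<omega> \<inter> {z<..m} \<times> {..n}))) \<le> \<alpha>' * real (m - z) + \<beta>' * n"
proof -
  let ?h = "\<lambda>x. (fst x + z, snd x) :: nat \<times> nat"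
  let ?C = "{1..m - z} \<times> {..n} :: (nat \<times> nat) set"
  have inj: "inj_on ?h A" for A by (auto simp: inj_on_def)
  have img: "{z<..m} \<times> {..n} = ?h ` ?C"
  proof
    show "{z<..m} \<times> {..n} \<subseteq> ?h ` ?C"
    proof
      fix x :: "nat \<times> nat" assume "x \<in> {z<..m} \<times> {..n}"
      then have "x = ?h (fst x - z, snd x)" "(fst x - z, snd x) \<in> ?C" by auto
      then show "x \<in> ?h ` ?C" by blast
    qed
  qed (use assms(4) in auto)
  have "expect (grid m n) (rates \<alpha> \<beta> p) (\<lambda>\<omega>. real (longest (\<omega> \<inter> {z<..m} \<times> {..n})))
      = expect ({z<..m} \<times> {..n}) (rates \<alpha> \<beta> p) (\<lambda>\<omega>. real (longest \<omega>))"
    by (rule expect_marginal) (auto simp: grid_def)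
  also have "\<dots> = expect ?C (\<lambda>x. rates \<alpha> \<beta> p (?h x)) (\<lambda>\<omega>. real (longest (?h ` \<omega>)))"
    unfolding img by (rule expect_reindex[OF inj])
  also have "\<dots> = expect ?C (rates \<alpha> \<beta> p) (\<lambda>\<omega>. real (longest \<omega>))"
  proof (rule expect_cong[OF refl])
    fix \<omega> assume w: "\<omega> \<subseteq> ?C"
    have "longest (?h ` \<omega>) = longest \<omega>"
      using finite_subset[OF w] w by (intro longest_iso) (auto simp: before_def)
    then show "real (longest (?h ` \<omega>)) = real (longest \<omega>)" by simp
  qed (auto simp: rates_def)
  also have "\<dots> \<le> expect ?C (rates \<alpha>' \<beta>' p) (\<lambda>\<omega>. real (longest \<omega>))"
  proof (rule expect_mono_prob)
    fix \<omega> \<omega>' assume w: "\<omega> \<subseteq> \<omega>'" "\<omega>' \<subseteq> ?C"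
    then show "real (longest \<omega>) \<le> real (longest \<omega>')"
      using finite_subset[OF w(2)] by (auto intro: longest_mono)
  qed (use assms(3) balanced_prob_on[OF ab] balanced_prob_on[OF ab'] in \<open>auto simp: rates_def\<close>)
  also have "\<dots> = expect (grid (m - z) n) (rates \<alpha>' \<beta>' p) (\<lambda>\<omega>. real (longest (\<omega> \<inter> ?C)))"
    by (rule expect_marginal[symmetric]) (auto simp: grid_def)
  also have "\<dots> \<le> \<alpha>' * real (m - z) + \<beta>' * n"
    by (rule expect_balanced_le[OF ab'])
  finally show ?thesis .
qed

text \<open>The rows above \<open>z\<close> contain no sources, so only the sink rate has to be
  raised. Adding a fresh row of sources with rate \<open>\<alpha>'\<close> then completes the strip
  to a stationary grid.\<close>

lemma expect_late_sink_le:
  assumes ab: "balanced \<alpha> \<beta> p" and ab': "balanced \<alpha>' \<beta>' p" and "\<beta> \<le> \<beta>'" "z \<le> n"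
  shows "expect (grid m n) (rates \<alpha> \<beta> p) (\<lambda>\<omega>. real (longest (\<omega> \<inter> {..m} \<times> {z<..n}))) \<le> \<alpha>' * m + \<beta>' * real (n - z)"
proof -
  let ?h = "\<lambda>x. (fst x, snd x + z) :: nat \<times> nat"
  let ?C = "{..m} \<times> {1..n - z} :: (nat \<times> nat) set"
  have inj: "inj_on ?h A" for A by (auto simp: inj_on_def)
  have img: "{..m} \<times> {z<..n} = ?h ` ?C"
  proof
    show "{..m} \<times> {z<..n} \<subseteq> ?h ` ?C"
    proof
      fix x :: "nat \<times> nat" assume "x \<in> {..m} \<times> {z<..n}"
      then have "x = ?h (fst x, snd x - z)" "(fst x, snd x - z) \<in> ?C" by auto
      then show "x \<in> ?h ` ?C" by blast
    qed
  qed (use assms(4) in auto)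
  have "expect (grid m n) (rates \<alpha> \<beta> p) (\<lambda>\<omega>. real (longest (\<omega> \<inter> {..m} \<times> {z<..n})))
      = expect ({..m} \<times> {z<..n}) (rates \<alpha> \<beta> p) (\<lambda>\<omega>. real (longest \<omega>))"
    by (rule expect_marginal) (auto simp: grid_def)
  also have "\<dots> = expect ?C (\<lambda>x. rates \<alpha> \<beta> p (?h x)) (\<lambda>\<omega>. real (longest (?h ` \<omega>)))"
    unfolding img by (rule expect_reindex[OF inj])
  also have "\<dots> = expect ?C (rates \<alpha> \<beta> p) (\<lambda>\<omega>. real (longest \<omega>))"
  proof (rule expect_cong[OF refl])
    fix \<omega> assume w: "\<omega> \<subseteq> ?C"
    have "longest (?h ` \<omega>) = longest \<omega>"
      using finite_subset[OF w] w by (intro longest_iso) (auto simp: before_def)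
    then show "real (longest (?h ` \<omega>)) = real (longest \<omega>)" by simp
  qed (auto simp: rates_def)
  also have "\<dots> \<le> expect ?C (rates \<alpha>' \<beta>' p) (\<lambda>\<omega>. real (longest \<omega>))"
  proof (rule expect_mono_prob)
    fix \<omega> \<omega>' assume w: "\<omega> \<subseteq> \<omega>'" "\<omega>' \<subseteq> ?C"
    then show "real (longest \<omega>) \<le> real (longest \<omega>')"
      using finite_subset[OF w(2)] by (auto intro: longest_mono)
  qed (use assms(3) balanced_prob_on[OF ab] balanced_prob_on[OF ab'] in \<open>auto simp: rates_def\<close>)
  also have "\<dots> = expect (grid m (n - z)) (rates \<alpha>' \<beta>' p) (\<lambda>\<omega>. real (longest (\<omega> \<inter> ?C)))"
    by (rule expect_marginal[symmetric]) (auto simp: grid_def)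
  also have "\<dots> \<le> \<alpha>' * m + \<beta>' * real (n - z)"
    by (rule expect_balanced_le[OF ab'])
  finally show ?thesis .
qed

text \<open>If a chain uses the source \<open>(i, 0)\<close> with \<open>i > z\<close>, everything
  preceding it lies on the bottom axis and everything following it lies further right; so its points
  beyond column \<open>z\<close> stay in the late strip. Sinks behave symmetrically.\<close>

lemma chain_exit_cases:
  assumes S: "S \<subseteq> grid m n" "chain S"
  shows "S \<subseteq> ({1..z} \<times> {0} \<union> {0} \<times> {1..w}) \<union> bulk m n
    \<or> S \<subseteq> {1..z} \<times> {0} \<union> {z<..m} \<times> {..n} \<or> S \<subseteq> {0} \<times> {1..w} \<union> {..m} \<times> {w<..n}"
proof (cases "\<exists>i>z. (i, 0) \<in> S")
  case True
  then obtain i where i: "i > z" "(i, 0) \<in> S" by auto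
  have "x \<in> {1..z} \<times> {0} \<union> {z<..m} \<times> {..n}" if x: "x \<in> S" for x
  proof -
    have "x = (i, 0) \<or> before x (i, 0) \<or> before (i, 0) x" using S(2) i(2) x by (auto simp: chain_def)
    then show ?thesis using S(1) x i by (cases x) (auto simp: before_def grid_def)
  qed
  then show ?thesis by blast
next
  case F1: False
  show ?thesis
  proof (cases "\<exists>j>w. (0, j) \<in> S")
    case True
    then obtain j where j: "j > w" "(0, j) \<in> S" by auto
    have "x \<in> {0} \<times> {1..w} \<union> {..m} \<times> {w<..n}" if x: "x \<in> S" for x
    proof -
      have "x = (0, j) \<or> before x (0, j) \<or> before (0, j) x" using S(2) j(2) x by (auto simp: chain_def)
      then show ?thesis using S(1) x j by (cases x) (auto simp: before_def grid_def)
    qed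
    then show ?thesis by blast
  next
    case False
    have "x \<in> ({1..z} \<times> {0} \<union> {0} \<times> {1..w}) \<union> bulk m n" if x: "x \<in> S" for x
    proof -
      obtain i j where ij: "x = (i, j)" by (cases x)
      have "i \<le> z" if "j = 0" using F1 x ij that by (meson not_le)
      moreover have "j \<le> w" if "i = 0" using False x ij that by (meson not_le)
      moreover have "x \<in> grid m n" using S x by auto
      ultimately show ?thesis using ij by (auto simp: grid_def bulk_def)
    qed
    then show ?thesis by blast
  qed
qed

text \<open>The mean of a maximum can exceed the maximum of the means only through fluctuations, and
  each mean absolute deviation is at most a standard deviation.\<close>

lemma expect_le_max3:
  assumes "finite U" "prob_on U p" "\<And>\<omega>. \<omega> \<subseteq> U \<Longrightarrow> f \<omega> \<le> max (f0 \<omega>) (max (f1 \<omega>) (f2 \<omega>))"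
    and v: "variance U p f0 \<le> v" "variance U p f1 \<le> v" "variance U p f2 \<le> v"
  shows "expect U p f \<le> max (expect U p f0) (max (expect U p f1) (expect U p f2)) + 3 * sqrt v"
proof -
  let ?m = "max (expect U p f0) (max (expect U p f1) (expect U p f2))"
  let ?d = "\<lambda>f \<omega>. \<bar>f \<omega> - expect U p f\<bar>"
  have "expect U p f \<le> expect U p (\<lambda>\<omega>. ?m + ?d f0 \<omega> + ?d f1 \<omega> + ?d f2 \<omega>)"
  proof (rule expect_mono[OF assms(2)])
    fix \<omega> assume "\<omega> \<subseteq> U"
    from assms(3)[OF this] have "f \<omega> \<le> f0 \<omega> \<or> f \<omega> \<le> f1 \<omega> \<or> f \<omega> \<le> f2 \<omega>"
      by (simp add: le_max_iff_disj)
    moreover have "g \<omega> \<le> expect U p g + ?d g \<omega>" "0 \<le> ?d g \<omega>" for g by auto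
    moreover have "expect U p f0 \<le> ?m" "expect U p f1 \<le> ?m" "expect U p f2 \<le> ?m" by auto
    ultimately show "f \<omega> \<le> ?m + ?d f0 \<omega> + ?d f1 \<omega> + ?d f2 \<omega>" by smt
  qed
  also have "\<dots> = ?m + expect U p (?d f0) + expect U p (?d f1) + expect U p (?d f2)"
    using assms(1) by (simp add: expect_add)
  also have "\<dots> \<le> ?m + sqrt v + sqrt v + sqrt v"
    using v by (intro add_mono order.refl order.trans[OF expect_abs_le_sd[OF assms(1,2)]] real_sqrt_le_mono)
  finally show ?thesis by simp
qed

text \<open>The left side is the exact stationary mean; the three entries of the maximum bound the
  means of the three exit classes, axis segments being counted by their expected number of points.
  Once the last two entries fall short, the first must attain the stationary mean, which bounds
  \<open>bern_mean\<close> from below.\<close>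

lemma stationary_exit_bound:
  assumes ab: "balanced \<alpha> \<beta> p" and ab1: "balanced \<alpha>1 \<beta>1 p" and ab2: "balanced \<alpha>2 \<beta>2 p"
    and "\<alpha> \<le> \<alpha>1" "\<beta> \<le> \<beta>2" "z \<le> m" "w \<le> n"
  shows "\<alpha> * m + \<beta> * n \<le> max (bern_mean m n p + \<alpha> * z + \<beta> * w)
     (max (\<alpha> * z + \<alpha>1 * real (m - z) + \<beta>1 * n) (\<beta> * w + \<alpha>2 * m + \<beta>2 * real (n - w)))
     + 3 * sqrt (\<alpha> * m + \<beta> * n)"
proof -
  let ?S = "{1..z} \<times> {0} :: (nat \<times> nat) set" and ?T = "{0} \<times> {1..w} :: (nat \<times> nat) set"
  let ?C1 = "{z<..m} \<times> {..n}" and ?C2 = "{..m} \<times> {w<..n}"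
  let ?E = "expect (grid m n) (rates \<alpha> \<beta> p)"
  let ?L = "\<lambda>Z \<omega>. real (longest (\<omega> \<inter> Z))"
  note pr = balanced_prob_on[OF ab, of "grid m n"]
  have cS: "?E (\<lambda>\<omega>. real (card (\<omega> \<inter> ?S))) = \<alpha> * z"
  proof -
    have "?E (\<lambda>\<omega>. real (card (\<omega> \<inter> ?S))) = (\<Sum>x\<in>?S. rates \<alpha> \<beta> p x)"
      using assms(6) by (intro expect_card) (auto simp: grid_def)
    also have "\<dots> = (\<Sum>x\<in>?S. \<alpha>)" by (rule sum.cong) (auto simp: rates_def)
    finally show ?thesis by simp
  qed
  have cT: "?E (\<lambda>\<omega>. real (card (\<omega> \<inter> ?T))) = \<beta> * w"
  proof -
    have "?E (\<lambda>\<omega>. real (card (\<omega> \<inter> ?T))) = (\<Sum>x\<in>?T. rates \<alpha> \<beta> p x)"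
      using assms(7) by (intro expect_card) (auto simp: grid_def)
    also have "\<dots> = (\<Sum>x\<in>?T. \<beta>)" by (rule sum.cong) (auto simp: rates_def)
    finally show ?thesis by simp
  qed
  have split: "?E (?L (A \<union> B)) \<le> ?E (\<lambda>\<omega>. real (card (\<omega> \<inter> A))) + ?E (?L B)" for A B
    unfolding expect_add[symmetric]
  proof (rule expect_mono[OF pr])
    fix \<omega> assume "\<omega> \<subseteq> grid m n"
    then have "finite \<omega>" using finite_subset finite_grid by blast
    then show "?L (A \<union> B) \<omega> \<le> real (card (\<omega> \<inter> A)) + ?L B \<omega>"
      using longest_Un_card_le[of "\<omega> \<inter> A" "\<omega> \<inter> B"] by (simp add: Int_Un_distrib flip: of_nat_add)
  qed
  have cST: "?E (\<lambda>\<omega>. real (card (\<omega> \<inter> (?S \<union> ?T)))) \<le> \<alpha> * z + \<beta> * w"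
    unfolding cS[symmetric] cT[symmetric] expect_add[symmetric]
    by (rule expect_mono[OF pr]) (simp add: Int_Un_distrib card_Un_le flip: of_nat_add)
  have A0: "?E (?L ((?S \<union> ?T) \<union> bulk m n)) \<le> bern_mean m n p + \<alpha> * z + \<beta> * w"
    using split[of "?S \<union> ?T" "bulk m n"] cST by (simp add: bern_mean_eq_grid[of m n p \<alpha> \<beta>])
  have A1: "?E (?L (?S \<union> ?C1)) \<le> \<alpha> * z + \<alpha>1 * real (m - z) + \<beta>1 * n"
    using split[of ?S ?C1] cS expect_late_source_le[OF ab ab1 assms(4,6), of n] by simp
  have A2: "?E (?L (?T \<union> ?C2)) \<le> \<beta> * w + \<alpha>2 * m + \<beta>2 * real (n - w)"
    using split[of ?T ?C2] cT expect_late_sink_le[OF ab ab2 assms(5,7), of m] by simp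
  have var: "variance (grid m n) (rates \<alpha> \<beta> p) (?L Z) \<le> \<alpha> * m + \<beta> * n" for Z
    using variance_longest_le[OF finite_grid pr, of Z] expect_balanced_le[OF ab, of m n Z] by linarith
  have "\<alpha> * m + \<beta> * n = ?E (\<lambda>\<omega>. real (lpp \<omega> m n))"
    using ab expect_stationary by (simp add: balanced_def)
  also have "\<dots> \<le> max (?E (?L ((?S \<union> ?T) \<union> bulk m n))) (max (?E (?L (?S \<union> ?C1))) (?E (?L (?T \<union> ?C2)))) + 3 * sqrt (\<alpha> * m + \<beta> * n)"
  proof (rule expect_le_max3[OF finite_grid pr _ var var var])
    fix \<omega> assume w: "\<omega> \<subseteq> grid m n"
    then have fin: "finite \<omega>" using finite_subset finite_grid by blast
    obtain S where S: "S \<subseteq> \<omega> \<inter> {..m} \<times> {..n}" "chain S" "card S = lpp \<omega> m n"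
      unfolding lpp_def using longest_witness[of "\<omega> \<inter> {..m} \<times> {..n}"] fin by auto
    have ge: "lpp \<omega> m n \<le> longest (\<omega> \<inter> Z)" if "S \<subseteq> Z" for Z
      using S that fin longest_ge[of "\<omega> \<inter> Z" S] by auto
    have "S \<subseteq> grid m n" using S w by auto
    from chain_exit_cases[OF this S(2), of z w] ge
    show "real (lpp \<omega> m n) \<le> max (?L ((?S \<union> ?T) \<union> bulk m n) \<omega>) (max (?L (?S \<union> ?C1) \<omega>) (?L (?T \<union> ?C2) \<omega>))"
      by (auto simp: le_max_iff_disj)
  qed
  also have "\<dots> \<le> max (bern_mean m n p + \<alpha> * z + \<beta> * w)
     (max (\<alpha> * z + \<alpha>1 * real (m - z) + \<beta>1 * n) (\<beta> * w + \<alpha>2 * m + \<beta>2 * real (n - w)))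
     + 3 * sqrt (\<alpha> * m + \<beta> * n)"
    using A0 A1 A2 by (intro add_mono max.mono) auto
  finally show ?thesis .
qed

section \<open>Bernoulli points with rate of order \<open>1 / m\<close>\<close>

text \<open>The solution \<beta> of the balance relation for source rate \<open>a / m\<close> and
  bulk rate \<open>t / m\<close>. It tends to \<open>t / (a + t)\<close> as \<open>m\<close> grows;
  \<open>sink_rate_le\<close> and \<open>sink_rate_ge\<close> make this quantitative.\<close>

definition sink_rate :: "real \<Rightarrow> real \<Rightarrow> real \<Rightarrow> real" where
  "sink_rate m t a = t * (1 - a / m) / (a + t * (1 - a / m))"

lemma balanced_sink_rate:
  assumes "0 \<le> a" "a < m" "0 < t" "t \<le> m"
  shows "balanced (a / m) (sink_rate m t a) (t / m)"
proof -
  let ?q = "1 - a / m"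
  have m: "0 < m" and q: "0 < ?q" using assms by auto
  have tq: "0 < t * ?q" using q assms(3) by simp
  then have d: "0 < a + t * ?q" using assms(1) by linarith
  have "0 \<le> sink_rate m t a" "sink_rate m t a \<le> 1"
    unfolding sink_rate_def using d tq assms(1) by (simp_all add: divide_le_eq_1)
  moreover have "t / m * ?q * (1 - sink_rate m t a) = a / m * sink_rate m t a"
  proof -
    have "1 - sink_rate m t a = a / (a + t * ?q)"
      unfolding sink_rate_def using d by (simp add: field_simps)
    then show ?thesis unfolding sink_rate_def by simp
  qed
  ultimately show ?thesis unfolding balanced_def using assms m by simp
qed

lemma sink_rate_le:
  assumes "0 \<le> a" "a < m" "0 < t"
  shows "sink_rate m t a \<le> t / (a + t)"
proof -
  define q where "q = 1 - a / m"
  have m: "0 < m" and q: "0 < q" "q \<le> 1" using assms by (auto simp: q_def)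
  have tq: "0 < t * q" using q assms(3) by simp
  then have d: "0 < a + t * q" using assms(1) by linarith
  have "q * a \<le> a" using q assms(1) by (simp add: mult_left_le_one_le)
  then have "t * (q * a) \<le> t * a" using assms(3) by (intro mult_left_mono) auto
  then have "t * q * (a + t) \<le> t * (a + t * q)" by (simp add: algebra_simps)
  then show ?thesis unfolding sink_rate_def q_def[symmetric] using d assms
    by (simp add: divide_le_eq pos_le_divide_eq)
qed

lemma sink_rate_ge:
  assumes "0 \<le> a" "a < m" "0 < t"
  shows "t / (a + t) * (1 - a / m) \<le> sink_rate m t a"
proof -
  let ?q = "1 - a / m"
  have m: "0 < m" and q: "0 < ?q" "?q \<le> 1" using assms by auto
  have tq: "0 < t * ?q" "t * ?q \<le> t" using q assms(3) by (simp_all add: mult_left_le)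
  then have d: "0 < a + t * ?q" using assms(1) by linarith
  have "t * ?q / (a + t) \<le> t * ?q / (a + t * ?q)"
    using tq d by (intro divide_left_mono) auto
  then show ?thesis unfolding sink_rate_def by simp
qed

lemma sink_rate_antimono:
  assumes "0 \<le> a" "a \<le> a'" "a' < m" "0 < t"
  shows "sink_rate m t a' \<le> sink_rate m t a"
proof -
  define q q' where "q = 1 - a / m" and "q' = 1 - a' / m"
  have m: "0 < m" using assms by auto
  have q: "0 < q" "0 < q'" "q' \<le> q" using assms m by (auto simp: q_def q'_def divide_right_mono)
  have tq: "0 < t * q" "0 < t * q'" using q assms(4) by simp_all
  then have d: "0 < a + t * q" "0 < a' + t * q'" using assms(1,2) by linarith+
  have "q' * a \<le> q * a'" using q assms by (intro mult_mono) auto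
  then have "t * (q' * a) \<le> t * (q * a')" using assms(4) by (intro mult_left_mono) auto
  then have "t * q' * (a + t * q) \<le> t * q * (a' + t * q')" by (simp add: algebra_simps)
  then show ?thesis unfolding sink_rate_def q_def[symmetric] q'_def[symmetric] using d by (simp add: divide_le_eq pos_le_divide_eq)
qed

text \<open>Over real \<open>a\<close> with \<open>a + t > 0\<close> the right side is minimal at
  \<open>a = sqrt (n * t) - t\<close>, with value \<open>2 * sqrt (n * t) - t\<close>.\<close>

lemma bern_mean_upper:
  assumes "0 \<le> a" "a < real m" "0 < t" "t \<le> real m"
  shows "bern_mean m n (t / m) \<le> a + n * t / (a + t)"
proof -
  have "bern_mean m n (t / m) \<le> a / m * m + sink_rate m t a * n"
    using bern_mean_le balanced_sink_rate assms by blast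
  also have "\<dots> \<le> a + t / (a + t) * n"
    using assms sink_rate_le[OF assms(1-3)] by (intro add_mono mult_right_mono) auto
  finally show ?thesis by (simp add: mult.commute)
qed

text \<open>After a fraction \<open>\<delta>\<close> of the bottom axis the best bound is
  \<open>\<delta> * a + (1 - \<delta>) * a1 + n * t / (a1 + t)\<close>, which at
  \<open>a1 + t = s / r\<close> equals \<open>2 * r * s + \<delta> * s - t\<close>. The left axis
  gives the same value at \<open>a2 + t = r * s\<close>. Since \<open>r\<close> squares to
  \<open>1 - \<delta>\<close>, this is \<open>2 * s - t\<close> minus \<open>s\<close> times the
  square of \<open>1 - r\<close>.\<close>

lemma bern_mean_lower_cases:
  fixes n m :: nat and t \<delta> :: real
  defines "s \<equiv> sqrt (n * t)" and "r \<equiv> sqrt (1 - \<delta>)"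
  assumes \<delta>: "0 < \<delta>" "\<delta> < 1" and t: "0 < t" "t \<le> (1 - \<delta>) * n"
    and m: "real n ^ 2 \<le> m" "real n / r < m"
  shows "2 * s - t - 1 \<le> max (bern_mean m n (t / m) + 2 * \<delta> * s) (2 * s - t - s * (1 - r)\<^sup>2 + 1) + 3 * sqrt (2 * s)"
proof -
  have r: "0 < r" "r < 1" "r\<^sup>2 = 1 - \<delta>" using \<delta> by (auto simp: r_def)
  have n: "0 < real n" using t \<delta> by (cases n) auto
  have "(1 - \<delta>) * real n < 1 * real n" using n \<delta> by (intro mult_strict_right_mono) auto
  then have tn: "t < n" using t by linarith
  have s: "0 < s" "s\<^sup>2 = n * t" using n t by (auto simp: s_def)
  have sn: "s \<le> n"
  proof -
    have "n * t \<le> real n * real n" using tn n by (intro mult_left_mono) auto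
    then show ?thesis unfolding s_def using n by (simp add: real_le_lsqrt power2_eq_square)
  qed
  \<comment> \<open>This keeps the source parameter \<open>a2\<close> below nonnegative.\<close>
  have trs: "t \<le> r * s"
  proof -
    have "t * t \<le> (1 - \<delta>) * n * t" using t by (intro mult_right_mono) auto
    also have "\<dots> = (r * s)\<^sup>2" using r s by (simp add: power_mult_distrib)
    finally have "t\<^sup>2 \<le> (r * s)\<^sup>2" by (simp add: power2_eq_square)
    moreover have "0 \<le> r * s" using r(1) s(1) by simp
    ultimately show ?thesis by (rule power2_le_imp_le)
  qed
  have rs: "r * s \<le> s" "s \<le> s / r" using r(1,2) s(1) by (simp_all add: pos_le_divide_eq mult_left_le_one_le mult_left_le)
  \<comment> \<open>\<open>a\<close> minimises \<open>a + n t / (a + t)\<close>; \<open>a1\<close> and \<open>a2\<close> are the minimisers after a fraction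
    \<open>\<delta>\<close> of the columns, respectively of the rows, has been removed.\<close>
  define a a1 a2 where "a = s - t" and "a1 = s / r - t" and "a2 = r * s - t"
  have sr: "s / r < m"
  proof -
    have "s / r \<le> n / r" using sn r by (intro divide_right_mono) auto
    then show ?thesis using m by linarith
  qed
  have a: "0 \<le> a2" "a2 \<le> a" "a \<le> a1" "a1 < m" "0 \<le> a" "a < m" "a2 < m" "0 \<le> a1"
    unfolding a_def a1_def a2_def using trs rs sr t by linarith+
  have m0: "0 < real m" using a by linarith
  have nm: "n \<le> real m"
  proof -
    have "real n * 1 \<le> real n * real n" using n by (intro mult_left_mono) auto
    then show ?thesis using m(1) by (simp add: power2_eq_square)
  qed
  have tm: "t \<le> m" using tn nm by linarith
  \<comment> \<open>Rounding down costs one difference of rates, at most 1, in each of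
    \<open>E1\<close> and \<open>E2\<close>; hence the \<open>+ 1\<close> in the conclusion.\<close>
  define z w where "z = nat \<lfloor>\<delta> * m\<rfloor>" and "w = nat \<lfloor>\<delta> * n\<rfloor>"
  have z: "real z \<le> \<delta> * m" "\<delta> * m - 1 \<le> real z" and w: "real w \<le> \<delta> * n" "\<delta> * n - 1 \<le> real w"
    using \<delta> m0 n by (auto simp: z_def w_def)
  have zm: "z \<le> m" "w \<le> n"
  proof -
    have "\<delta> * m \<le> m" "\<delta> * n \<le> n" using \<delta> by (auto simp: mult_left_le_one_le)
    then have "real z \<le> m" "real w \<le> n" using z w by linarith+
    then show "z \<le> m" "w \<le> n" by auto
  qed
  let ?b = "sink_rate m t"
  note bal = balanced_sink_rate[OF a(5,6) t(1) tm] balanced_sink_rate[OF a(8,4) t(1) tm] balanced_sink_rate[OF a(1,7) t(1) tm]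
  have b: "0 \<le> ?b a" "?b a \<le> t / s" "0 \<le> ?b a1" "?b a1 \<le> t * r / s" "0 \<le> ?b a2" "?b a2 \<le> t / (r * s)" "?b a2 \<le> 1"
    "?b a \<le> ?b a2"
    using bal sink_rate_le[OF a(5,6) t(1)] sink_rate_le[OF a(8,4) t(1)] sink_rate_le[OF a(1,7) t(1)]
      sink_rate_antimono[OF a(1,2,6) t(1)]
    by (auto simp: balanced_def a_def a1_def a2_def)
  have nts: "real n * (t / s) = s" using s by (simp add: field_simps power2_eq_square)
  have V: "2 * s - t - 1 \<le> a / m * m + ?b a * n" "a / m * m + ?b a * n \<le> 2 * s"
  proof -
    \<comment> \<open>This is the error in replacing \<open>?b a * n\<close> by its limit
      \<open>s\<close>; it is bounded because \<open>m\<close> is at least the square of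
      \<open>n\<close>.\<close>
    have "s * (a / m) \<le> 1"
    proof -
      have "s * a \<le> s * s" using s t by (intro mult_left_mono) (auto simp: a_def)
      also have "\<dots> \<le> real n * real n" using sn s by (intro mult_mono) auto
      also have "\<dots> \<le> m" using m(1) by (simp add: power2_eq_square)
      finally show ?thesis using m0 by (simp add: divide_le_eq)
    qed
    moreover have "s * (1 - a / m) \<le> ?b a * n"
    proof -
      have "t / s * (1 - a / m) \<le> ?b a" using sink_rate_ge[OF a(5,6) t(1)] by (simp add: a_def)
      then have "n * (t / s * (1 - a / m)) \<le> n * ?b a" by (intro mult_left_mono) auto
      moreover have "n * (t / s * (1 - a / m)) = n * (t / s) * (1 - a / m)" by (simp only: mult.assoc)
      ultimately show ?thesis unfolding nts by (simp add: mult.commute)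
    qed
    moreover have "s * (1 - a / m) = s - s * (a / m)" by (simp only: right_diff_distrib mult_1_right)
    moreover have "a / m * m = s - t" using m0 by (simp add: a_def)
    ultimately show "2 * s - t - 1 \<le> a / m * m + ?b a * n" by linarith
    have "n * ?b a \<le> n * (t / s)" using b by (intro mult_left_mono) auto
    then show "a / m * m + ?b a * n \<le> 2 * s" using nts m0 t by (simp add: a_def mult.commute)
  qed
  have E0: "a / m * z + ?b a * w \<le> 2 * \<delta> * s"
  proof -
    have "a / m * z \<le> a / m * (\<delta> * m)" using a m0 z by (intro mult_left_mono) auto
    also have "\<dots> = \<delta> * a" using m0 by simp
    also have "\<dots> \<le> \<delta> * s" using \<delta> t by (simp add: a_def)
    finally have 1: "a / m * z \<le> \<delta> * s" .
    have "?b a * w \<le> t / s * (\<delta> * n)" using b w t s by (intro mult_mono) auto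
    also have "\<dots> = \<delta> * (n * (t / s))" by simp
    finally have 2: "?b a * w \<le> \<delta> * s" unfolding nts .
    show ?thesis using 1 2 by simp
  qed
  have tot: "2 * (r * s) + \<delta> * s - t + 1 = 2 * s - t - s * (1 - r)\<^sup>2 + 1"
  proof -
    have "(1 - r)\<^sup>2 = 2 - 2 * r - \<delta>" using r(3) by (simp add: power2_diff)
    then have "s * (1 - r)\<^sup>2 = 2 * s - 2 * (r * s) - \<delta> * s"
      by (simp only:) (simp add: algebra_simps)
    then show ?thesis by linarith
  qed
  have E1: "a / m * z + a1 / m * real (m - z) + ?b a1 * n \<le> 2 * s - t - s * (1 - r)\<^sup>2 + 1"
  proof -
    have al: "a / m \<le> a1 / m" "a1 / m \<le> 1" "0 \<le> a / m" using a m0 by (auto simp: divide_right_mono)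
    have "(a1 / m - a / m) * (\<delta> * m - 1) \<le> (a1 / m - a / m) * z"
      using al z by (intro mult_left_mono) auto
    moreover have "(a1 / m - a / m) * (\<delta> * m - 1) = (a1 - a) * \<delta> - (a1 / m - a / m)"
      using m0 by (simp add: field_simps)
    moreover have "a / m * z + a1 / m * real (m - z) = a1 - (a1 / m - a / m) * z"
      using m0 zm by (simp add: of_nat_diff field_simps)
    ultimately have "a / m * z + a1 / m * real (m - z) \<le> a1 - (a1 - a) * \<delta> + (a1 / m - a / m)"
      by linarith
    moreover have "a1 / m - a / m \<le> 1" using al by linarith
    moreover have "?b a1 * n \<le> r * s"
    proof -
      have "n * ?b a1 \<le> n * (t * r / s)" using b by (intro mult_left_mono) auto
      also have "\<dots> = r * (n * (t / s))" by simp
      finally show ?thesis unfolding nts by (simp add: mult.commute)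
    qed
    moreover have "a1 - (a1 - a) * \<delta> = r * s + \<delta> * s - t"
    proof -
      have "(u - t) - ((u - t) - (s - t)) * \<delta> = u * (1 - \<delta>) + \<delta> * s - t" for u
        by (simp add: algebra_simps)
      then have "a1 - (a1 - a) * \<delta> = (s / r) * (1 - \<delta>) + \<delta> * s - t" unfolding a1_def a_def .
      also have "(s / r) * (1 - \<delta>) = r * s" using r by (simp add: r(3)[symmetric] power2_eq_square)
      finally show ?thesis .
    qed
    ultimately show ?thesis using tot by linarith
  qed
  have E2: "?b a * w + a2 / m * m + ?b a2 * real (n - w) \<le> 2 * s - t - s * (1 - r)\<^sup>2 + 1"
  proof -
    have "(?b a2 - ?b a) * (\<delta> * n - 1) \<le> (?b a2 - ?b a) * w"
      using b w by (intro mult_left_mono) auto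
    then have "?b a * w + ?b a2 * real (n - w) \<le> ?b a2 * n * (1 - \<delta>) + ?b a * n * \<delta> + (?b a2 - ?b a)"
      using zm by (simp add: of_nat_diff algebra_simps)
    moreover have "?b a2 - ?b a \<le> 1" using b by linarith
    moreover have "?b a * n * \<delta> \<le> \<delta> * s"
    proof -
      have "n * ?b a \<le> n * (t / s)" using b by (intro mult_left_mono) auto
      then show ?thesis unfolding nts using \<delta> by (simp add: mult.commute)
    qed
    moreover have "?b a2 * n * (1 - \<delta>) \<le> r * s"
    proof -
      have "n * ?b a2 \<le> n * (t / (r * s))" using b by (intro mult_left_mono) auto
      also have "\<dots> = n * (t / s) / r" by simp
      also have "\<dots> = s / r" unfolding nts ..
      finally have "(n * ?b a2) * (1 - \<delta>) \<le> s / r * (1 - \<delta>)" using \<delta> by (intro mult_right_mono) auto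
      also have "s / r * (1 - \<delta>) = r * s" using r by (simp add: r(3)[symmetric] power2_eq_square)
      finally show ?thesis by (simp add: mult.commute)
    qed
    moreover have "a2 / m * m = r * s - t" using m0 by (simp add: a2_def)
    ultimately show ?thesis using tot by linarith
  qed
  have "a / m \<le> a1 / m" using a m0 by (auto simp: divide_right_mono)
  from stationary_exit_bound[OF bal this b(8) zm]
  have "a / m * m + ?b a * n \<le> max (bern_mean m n (t / m) + 2 * \<delta> * s) (2 * s - t - s * (1 - r)\<^sup>2 + 1) + 3 * sqrt (a / m * m + ?b a * n)"
    using E0 E1 E2 by (auto simp: max_def split: if_splits)
  moreover have "sqrt (a / m * m + ?b a * n) \<le> sqrt (2 * s)" using V(2) by (rule real_sqrt_le_mono)
  ultimately show ?thesis using V(1) by linarith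
qed

section \<open>Random permutations\<close>

text \<open>The two \<open>Suc\<close> move all points off the axes, so that \<open>before\<close>
  is the strict order in both coordinates on them.\<close>

definition perm_points :: "(nat \<Rightarrow> nat) \<Rightarrow> nat \<Rightarrow> nat set \<Rightarrow> (nat \<times> nat) set" where
  "perm_points c K D = (\<lambda>x. (Suc (c x), Suc (x div K))) ` D"

lemma finite_perm_points [simp]: "finite D \<Longrightarrow> finite (perm_points c K D)"
  by (simp add: perm_points_def)

definition perm_avg :: "nat \<Rightarrow> ((nat \<Rightarrow> nat) \<Rightarrow> real) \<Rightarrow> real" where
  "perm_avg M F = (\<Sum>\<sigma> | \<sigma> permutes {..<M}. F \<sigma>) / fact M"

text \<open>Merging \<open>K\<close> consecutive letters of a uniform permutation of \<open>N\<close> letters: the label \<open>x\<close> sits in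
  column \<open>\<sigma> x\<close> and row \<open>x div K\<close>. If \<open>K\<close> does not divide \<open>N\<close>, the last row is incomplete.\<close>
definition perm_mean :: "nat \<Rightarrow> nat \<Rightarrow> real" where
  "perm_mean N K = perm_avg N (\<lambda>\<sigma>. real (longest (perm_points \<sigma> K {..<N})))"

lemma perm_avg_compose: "\<pi> permutes {..<M} \<Longrightarrow> perm_avg M (\<lambda>\<sigma>. F (\<sigma> \<circ> \<pi>)) = perm_avg M F"
  unfolding perm_avg_def by (subst (2) sum_permutations_compose_right) auto

lemma perm_avg_mono: "(\<And>\<sigma>. \<sigma> permutes {..<M} \<Longrightarrow> F \<sigma> \<le> G \<sigma>) \<Longrightarrow> perm_avg M F \<le> perm_avg M G"
  unfolding perm_avg_def by (intro divide_right_mono sum_mono) auto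

lemma perm_avg_cong: "(\<And>\<sigma>. \<sigma> permutes {..<M} \<Longrightarrow> F \<sigma> = G \<sigma>) \<Longrightarrow> perm_avg M F = perm_avg M G"
  unfolding perm_avg_def by (auto intro!: sum.cong)

lemma perm_avg_const [simp]: "perm_avg M (\<lambda>_. c) = c"
  unfolding perm_avg_def by (simp add: card_permutations[of _ M])

lemma perm_avg_add: "perm_avg M (\<lambda>\<sigma>. F \<sigma> + G \<sigma>) = perm_avg M F + perm_avg M G"
  unfolding perm_avg_def by (simp add: sum.distrib add_divide_distrib)

lemma longest_perm_points_order:
  assumes "finite D" "\<And>x y. x \<in> D \<Longrightarrow> y \<in> D \<Longrightarrow> c x < c y \<longleftrightarrow> c' x < c' y"
  shows "longest (perm_points c K D) = longest (perm_points c' K D)"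
  unfolding perm_points_def using assms
  by (intro antisym longest_image_le) (auto simp: before_def)

text \<open>Standardisation: each label is sent to the number of smaller values of
  \<open>c\<close>.\<close>

lemma rank_permutation:
  fixes c :: "nat \<Rightarrow> nat"
  assumes "inj_on c {..<N}"
  obtains \<rho> where "\<rho> permutes {..<N}" "\<And>x y. x < N \<Longrightarrow> y < N \<Longrightarrow> c x < c y \<longleftrightarrow> \<rho> x < \<rho> y"
proof
  define rk where "rk = (\<lambda>x. card {y\<in>{..<N}. c y < c x})"
  let ?\<rho> = "\<lambda>x. if x < N then rk x else x"
  have less: "rk x < rk y" if "c x < c y" "x < N" for x y
    unfolding rk_def using that by (intro psubset_card_mono) auto
  have iff: "c x < c y \<longleftrightarrow> rk x < rk y" if "x < N" "y < N" for x y
  proof -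
    have "c x = c y \<Longrightarrow> x = y" using assms that by (auto simp: inj_on_def)
    then show ?thesis using less[of x y] less[of y x] that
      by (metis linorder_cases order_less_asym order_less_irrefl)
  qed
  have inj: "inj_on rk {..<N}"
  proof (rule inj_onI)
    fix x y assume xy: "x \<in> {..<N}" "y \<in> {..<N}" "rk x = rk y"
    then have "c x = c y" using iff[of x y] iff[of y x] by auto
    then show "x = y" using assms xy by (auto simp: inj_on_def)
  qed
  have "rk x < N" if "x < N" for x
  proof -
    have "rk x < card {..<N}" unfolding rk_def using that by (intro psubset_card_mono) auto
    then show ?thesis by simp
  qed
  then have "rk ` {..<N} = {..<N}" using inj by (intro endo_inj_surj) auto
  then have "bij_betw ?\<rho> {..<N} {..<N}" using inj by (subst bij_betw_cong[of _ _ rk]) (auto simp: bij_betw_def)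
  then show "?\<rho> permutes {..<N}" by (rule bij_imp_permutes) auto
  show "c x < c y \<longleftrightarrow> ?\<rho> x < ?\<rho> y" if "x < N" "y < N" for x y using iff that by simp
qed

text \<open>Only the relative order of the values of \<open>c\<close> matters, so \<open>c\<close>
  may be replaced by its rank permutation, which left composition absorbs.\<close>

lemma sum_perm_pattern:
  assumes "inj_on c {..<N}"
  shows "(\<Sum>\<tau> | \<tau> permutes {..<N}. real (longest (perm_points (c \<circ> \<tau>) K {..<N}))) = fact N * perm_mean N K"
proof -
  obtain \<rho> where \<rho>: "\<rho> permutes {..<N}" "\<And>x y. x < N \<Longrightarrow> y < N \<Longrightarrow> c x < c y \<longleftrightarrow> \<rho> x < \<rho> y"
    using rank_permutation[OF assms] by metis
  have "(\<Sum>\<tau> | \<tau> permutes {..<N}. real (longest (perm_points (c \<circ> \<tau>) K {..<N})))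
      = (\<Sum>\<tau> | \<tau> permutes {..<N}. real (longest (perm_points (\<rho> \<circ> \<tau>) K {..<N})))"
  proof (rule sum.cong[OF refl])
    fix \<tau> assume "\<tau> \<in> {\<tau>. \<tau> permutes {..<N}}"
    then have "\<tau> x < N" if "x < N" for x using that permutes_in_image by fastforce
    then have "longest (perm_points (c \<circ> \<tau>) K {..<N}) = longest (perm_points (\<rho> \<circ> \<tau>) K {..<N})"
      using \<rho>(2) by (intro longest_perm_points_order) auto
    then show "real (longest (perm_points (c \<circ> \<tau>) K {..<N})) = real (longest (perm_points (\<rho> \<circ> \<tau>) K {..<N}))" by simp
  qed
  also have "\<dots> = (\<Sum>\<tau> | \<tau> permutes {..<N}. real (longest (perm_points \<tau> K {..<N})))"
    by (rule setum_permutations_compose_left[OF \<rho>(1), symmetric])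
  finally show ?thesis by (simp add: perm_mean_def perm_avg_def)
qed

text \<open>The relative order of the first \<open>N\<close> values of a uniform permutation is
  uniform. Double counting: precomposing with permutations of \<open>{..<N}\<close> leaves the sum
  over \<sigma> unchanged, while for fixed \<sigma> the sum over them depends only on
  \<open>N\<close>.\<close>

lemma perm_avg_pattern:
  assumes "N \<le> M"
  shows "perm_avg M (\<lambda>\<sigma>. real (longest (perm_points \<sigma> K {..<N}))) = perm_mean N K"
proof -
  let ?f = "\<lambda>\<sigma>. real (longest (perm_points \<sigma> K {..<N}))"
  let ?S = "\<lambda>n. {\<sigma>. \<sigma> permutes {..<n}}"
  have "fact N * (\<Sum>\<sigma>\<in>?S M. ?f \<sigma>) = (\<Sum>\<tau>\<in>?S N. \<Sum>\<sigma>\<in>?S M. ?f (\<sigma> \<circ> \<tau>))"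
  proof -
    have "(\<Sum>\<sigma>\<in>?S M. ?f (\<sigma> \<circ> \<tau>)) = (\<Sum>\<sigma>\<in>?S M. ?f \<sigma>)" if "\<tau> \<in> ?S N" for \<tau>
      using that assms sum_permutations_compose_right[of \<tau> "{..<M}" ?f] permutes_subset[of \<tau> "{..<N}" "{..<M}"] by auto
    then show ?thesis by (simp add: card_permutations[of _ N])
  qed
  also have "\<dots> = (\<Sum>\<sigma>\<in>?S M. \<Sum>\<tau>\<in>?S N. ?f (\<sigma> \<circ> \<tau>))" by (rule sum.swap)
  also have "\<dots> = (\<Sum>\<sigma>\<in>?S M. fact N * perm_mean N K)"
    by (rule sum.cong) (auto intro!: sum_perm_pattern permutes_inj_on)
  also have "\<dots> = fact N * (fact M * perm_mean N K)" by (simp add: card_permutations[of _ M])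
  finally have "(\<Sum>\<sigma>\<in>?S M. ?f \<sigma>) = fact M * perm_mean N K" by simp
  then show ?thesis by (simp add: perm_avg_def)
qed

lemma inj_on_extends_permutes:
  assumes "finite A" "D \<subseteq> A" "inj_on c D" "c ` D \<subseteq> A"
  obtains \<pi> where "\<pi> permutes A" "\<And>x. x \<in> D \<Longrightarrow> \<pi> x = c x"
proof -
  have fin: "finite D" using assms finite_subset by auto
  have "card (A - D) = card (A - c ` D)"
    using assms fin by (simp add: card_Diff_subset card_image)
  then obtain g where g: "bij_betw g (A - D) (A - c ` D)"
    using assms(1) finite_same_card_bij[of "A - D" "A - c ` D"] by auto
  let ?\<pi> = "\<lambda>x. if x \<in> D then c x else if x \<in> A then g x else x"
  have "bij_betw ?\<pi> D (c ` D)" using assms(3) by (subst bij_betw_cong[of _ _ c]) (auto simp: bij_betw_def)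
  moreover have "bij_betw ?\<pi> (A - D) (A - c ` D)" using g by (subst bij_betw_cong[of _ _ g]) auto
  ultimately have "bij_betw ?\<pi> (D \<union> (A - D)) (c ` D \<union> (A - c ` D))"
    by (rule bij_betw_combine) auto
  moreover have "D \<union> (A - D) = A" "c ` D \<union> (A - c ` D) = A" using assms by auto
  ultimately have "?\<pi> permutes A" using assms(2) by (intro bij_imp_permutes) auto
  then show ?thesis using that[of ?\<pi>] by simp
qed

text \<open>Scattering a prescribed set of columns by a uniform permutation of all \<open>M\<close> columns makes the
  relative order of the points uniform; the columns themselves do not matter.\<close>
lemma perm_avg_partial:
  assumes "D \<subseteq> {..<N}" "N \<le> M" "inj_on c D" "c ` D \<subseteq> {..<M}"
  shows "perm_avg M (\<lambda>\<sigma>. real (longest (perm_points (\<sigma> \<circ> c) K D))) \<le> perm_mean N K"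
    and "finite J \<Longrightarrow> (\<And>x. x \<in> {..<N} - D \<Longrightarrow> x div K \<in> J) \<Longrightarrow>
      perm_mean N K \<le> perm_avg M (\<lambda>\<sigma>. real (longest (perm_points (\<sigma> \<circ> c) K D))) + card J"
proof -
  obtain \<pi> where \<pi>: "\<pi> permutes {..<M}" "\<And>x. x \<in> D \<Longrightarrow> \<pi> x = c x"
  proof -
    have "D \<subseteq> {..<M}" using assms(1,2) by auto
    then show ?thesis using that inj_on_extends_permutes[of "{..<M}" D c] assms(3,4) by (metis finite_lessThan)
  qed
  have eq: "perm_points (\<sigma> \<circ> c) K D = perm_points (\<sigma> \<circ> \<pi>) K D" for \<sigma> using \<pi>(2) by (auto simp: perm_points_def)
  have perm_mean: "perm_mean N K = perm_avg M (\<lambda>\<sigma>. real (longest (perm_points (\<sigma> \<circ> \<pi>) K {..<N})))"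
    using perm_avg_compose[OF \<pi>(1), of "\<lambda>\<sigma>. real (longest (perm_points \<sigma> K {..<N}))"] perm_avg_pattern[OF assms(2)] by simp
  show "perm_avg M (\<lambda>\<sigma>. real (longest (perm_points (\<sigma> \<circ> c) K D))) \<le> perm_mean N K"
    unfolding eq perm_mean using assms(1) by (intro perm_avg_mono of_nat_mono longest_mono) (auto simp: perm_points_def)
  assume J: "finite J" "\<And>x. x \<in> {..<N} - D \<Longrightarrow> x div K \<in> J"
  have finD: "finite D" using assms(1) finite_subset by auto
  have "perm_mean N K \<le> perm_avg M (\<lambda>\<sigma>. real (longest (perm_points (\<sigma> \<circ> c) K D)) + card J)"
    unfolding perm_mean eq
  proof (rule perm_avg_mono)
    fix \<sigma>
    have "perm_points (\<sigma> \<circ> \<pi>) K {..<N} = perm_points (\<sigma> \<circ> \<pi>) K ({..<N} - D) \<union> perm_points (\<sigma> \<circ> \<pi>) K D"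
      using assms(1) by (auto simp: perm_points_def)
    also have "longest \<dots> \<le> card (Suc ` J) + longest (perm_points (\<sigma> \<circ> \<pi>) K D)"
      using J finD by (intro longest_Un_rows_le) (auto simp: perm_points_def)
    also have "card (Suc ` J) = card J" by (simp add: card_image)
    finally show "real (longest (perm_points (\<sigma> \<circ> \<pi>) K {..<N})) \<le> real (longest (perm_points (\<sigma> \<circ> \<pi>) K D)) + real (card J)"
      unfolding of_nat_add[symmetric] of_nat_le_iff by (simp only: add.commute)
  qed
  then show "perm_mean N K \<le> perm_avg M (\<lambda>\<sigma>. real (longest (perm_points (\<sigma> \<circ> c) K D))) + card J"
    by (simp add: perm_avg_add)
qed

text \<open>Labels in increasing coarse blocks lie in increasing fine blocks. Allowing
  \<open>N' < N\<close> discards the letters left over when \<open>q\<close> does not divide their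
  number.\<close>

lemma perm_mean_merge:
  assumes "N' \<le> N"
  shows "perm_mean N' (K * q) \<le> perm_mean N K"
proof -
  have "perm_mean N' (K * q) = perm_avg N (\<lambda>\<sigma>. real (longest (perm_points \<sigma> (K * q) {..<N'})))"
    by (rule perm_avg_pattern[OF assms, symmetric])
  also have "\<dots> \<le> perm_avg N (\<lambda>\<sigma>. real (longest (perm_points \<sigma> K {..<N})))"
  proof (intro perm_avg_mono of_nat_mono)
    fix \<sigma>
    have "x div K < y div K" if "x div (K * q) < y div (K * q)" for x y
      using that by (metis div_le_mono div_mult2_eq not_le)
    then have "longest (perm_points \<sigma> (K * q) {..<N'}) \<le> longest (perm_points \<sigma> K {..<N'})"
      unfolding perm_points_def by (intro longest_image_le) (auto simp: before_def)
    also have "\<dots> \<le> longest (perm_points \<sigma> K {..<N})"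
      using assms by (intro longest_mono) (auto simp: perm_points_def)
    finally show "longest (perm_points \<sigma> (K * q) {..<N'}) \<le> longest (perm_points \<sigma> K {..<N})" .
  qed
  finally show ?thesis by (simp add: perm_mean_def)
qed

lemma perm_mean_bounds:
  assumes "0 < K"
  shows "0 \<le> perm_mean N K" "perm_mean (K * n) K \<le> n" "perm_mean N K \<le> N"
proof -
  show "0 \<le> perm_mean N K" unfolding perm_mean_def perm_avg_def by (simp add: sum_nonneg)
  have "perm_mean (K * n) K \<le> perm_avg (K * n) (\<lambda>_. real n)" unfolding perm_mean_def
  proof (intro perm_avg_mono of_nat_mono)
    fix \<sigma>
    have "longest (perm_points \<sigma> K {..<K * n} \<union> {}) \<le> card {1..n} + longest {}"
      using assms by (intro longest_Un_rows_le) (auto simp: perm_points_def less_mult_imp_div_less mult.commute Suc_leI)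
    moreover have "longest {} = 0" using longest_leI[of "{}" 0] by auto
    ultimately show "longest (perm_points \<sigma> K {..<K * n}) \<le> n" by simp
  qed
  then show "perm_mean (K * n) K \<le> n" by simp
  have "perm_mean N K \<le> perm_avg N (\<lambda>_. real N)" unfolding perm_mean_def
  proof (intro perm_avg_mono of_nat_mono)
    fix \<sigma>
    have "longest (perm_points \<sigma> K {..<N}) \<le> card (perm_points \<sigma> K {..<N})" by (intro longest_leI) (auto intro: card_mono)
    also have "\<dots> \<le> N" unfolding perm_points_def using card_image_le[of "{..<N}"] by fastforce
    finally show "longest (perm_points \<sigma> K {..<N}) \<le> N" .
  qed
  then show "perm_mean N K \<le> N" by simp
qed

section \<open>Multiset permutations as merged permutations\<close>

text \<open>Positivity excludes the axes, where \<open>before\<close> is weaker than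
  \<open>strict_prec\<close>. A chain becomes a sequence by sorting its points by first coordinate;
  conversely a strictly increasing sequence has distinct terms, which also bounds the set under
  \<open>Max\<close>.\<close>

lemma L_lt_eq_longest:
  assumes fin: "finite \<omega>" and pos: "\<And>x. x \<in> \<omega> \<Longrightarrow> 0 < fst x \<and> 0 < snd x"
  shows "L_lt ((\<lambda>x. (real (fst x), real (snd x))) ` \<omega>) = longest \<omega>"
proof -
  let ?h = "\<lambda>x :: nat \<times> nat. (real (fst x), real (snd x))"
  let ?A = "{L. \<exists>f :: nat \<Rightarrow> real \<times> real.
      (\<forall>i<L. f i \<in> ?h ` \<omega>) \<and> (\<forall>i. Suc i < L \<longrightarrow> strict_prec (f i) (f (Suc i)))}"
  have le: "L \<le> longest \<omega>" if L: "L \<in> ?A" for L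
  proof -
    obtain f where f: "\<forall>i<L. f i \<in> ?h ` \<omega>" "\<forall>i. Suc i < L \<longrightarrow> strict_prec (f i) (f (Suc i))"
      using L by auto
    have "\<forall>i. \<exists>x. i < L \<longrightarrow> x \<in> \<omega> \<and> f i = ?h x" using f(1) by blast
    then obtain g where g: "\<And>i. i < L \<Longrightarrow> g i \<in> \<omega> \<and> f i = ?h (g i)" by metis
    have mono: "fst (g i) < fst (g j) \<and> snd (g i) < snd (g j)" if "i < j" "j < L" for i j
      using that
    proof (induction j)
      case (Suc j)
      have "fst (g j) < fst (g (Suc j)) \<and> snd (g j) < snd (g (Suc j))"
        using f(2) g[of j] g[of "Suc j"] Suc.prems by (auto simp: strict_prec_def)
      then show ?case using Suc by (cases "i = j") auto
    qed simp
    have inj: "inj_on g {..<L}"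
    proof (rule inj_onI)
      fix i j assume "i \<in> {..<L}" "j \<in> {..<L}" "g i = g j"
      then show "i = j" using mono[of i j] mono[of j i] by (metis lessThan_iff nat_neq_iff order_less_irrefl)
    qed
    have "before (g i) (g j) \<or> before (g j) (g i)" if "i < L" "j < L" "g i \<noteq> g j" for i j
      using mono[of i j] mono[of j i] that by (metis before_def nat_neq_iff)
    then have "chain (g ` {..<L})" by (auto simp: chain_def)
    then have "card (g ` {..<L}) \<le> longest \<omega>" using g fin by (intro longest_ge) auto
    then show ?thesis using inj by (simp add: card_image)
  qed
  have mem: "longest \<omega> \<in> ?A"
  proof -
    obtain S where S: "S \<subseteq> \<omega>" "chain S" "card S = longest \<omega>" using longest_witness[OF fin] .
    have finS: "finite S" using S fin finite_subset by auto
    have cmp: "fst x < fst y \<and> snd x < snd y \<or> fst y < fst x \<and> snd y < snd x" if "x \<in> S" "y \<in> S" "x \<noteq> y" for x y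
    proof -
      have "before x y \<or> before y x" using S(2) that by (simp add: chain_def)
      moreover have "0 < fst x" "0 < snd x" "0 < fst y" "0 < snd y" using pos S(1) that by blast+
      ultimately show ?thesis by (auto simp: before_def)
    qed
    have inj: "inj_on fst S" using cmp by (metis inj_onI order_less_irrefl)
    define xs where "xs = sorted_list_of_set (fst ` S)"
    have len: "length xs = longest \<omega>" using inj S(3) by (simp add: xs_def card_image)
    have set: "set xs = fst ` S" using finS by (simp add: xs_def)
    define g where "g = (\<lambda>i. inv_into S fst (xs ! i))"
    have g: "g i \<in> S" "fst (g i) = xs ! i" if "i < longest \<omega>" for i
    proof -
      have "xs ! i \<in> fst ` S" using that len set nth_mem by metis
      then show "g i \<in> S" "fst (g i) = xs ! i" by (auto simp: g_def inv_into_into f_inv_into_f)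
    qed
    have "strict_prec (?h (g i)) (?h (g (Suc i)))" if "Suc i < longest \<omega>" for i
    proof -
      have "xs ! i < xs ! Suc i"
        using that len by (intro sorted_wrt_nth_less[of "(<)"]) (auto simp: xs_def)
      then have "fst (g i) < fst (g (Suc i))" using g[of i] g[of "Suc i"] that by simp
      moreover from this have "g i \<noteq> g (Suc i)" by auto
      moreover have "g i \<in> S" "g (Suc i) \<in> S" using g that by auto
      ultimately show ?thesis using cmp[of "g i" "g (Suc i)"] by (auto simp: strict_prec_def)
    qed
    then show ?thesis using g(1) S(1) by (intro CollectI exI[of _ "\<lambda>i. ?h (g i)"]) blast
  qed
  have "?A \<subseteq> {..longest \<omega>}" by (rule subsetI, rule iffD2[OF atMost_iff], rule le)
  then have "finite ?A" by (rule finite_subset) simp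
  then show ?thesis unfolding L_lt_def by (rule Max_eqI[OF _ le mem])
qed

lemma div_block_iff:
  fixes K :: nat
  assumes "0 < K"
  shows "x \<in> {a * K..<a * K + K} \<longleftrightarrow> x div K = a"
proof
  assume "x \<in> {a * K..<a * K + K}"
  then have "a * K \<le> x" "x < Suc a * K" by auto
  then show "x div K = a" by (metis div_nat_eqI mult.commute)
next
  assume "x div K = a"
  then have "x = a * K + x mod K" "x mod K < K" using assms div_mult_mod_eq[of x K] by auto
  then show "x \<in> {a * K..<a * K + K}" by (metis atLeastLessThan_iff le_add1 nat_add_left_cancel_less)
qed

lemma card_div_block:
  fixes k :: nat
  assumes "a < n"
  shows "card {i. i < k * n \<and> i div k = a} = k"
proof (cases "k = 0")
  case False
  have "{i. i < k * n \<and> i div k = a} = {a * k..<a * k + k}"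
  proof (intro set_eqI)
    fix i
    have "i < k * n" if "i div k = a"
      using that assms False by (metis div_less_iff_less_mult mult.commute neq0_conv)
    then show "i \<in> {i. i < k * n \<and> i div k = a} \<longleftrightarrow> i \<in> {a * k..<a * k + k}"
      using div_block_iff[of k i a] False by auto
  qed
  then show ?thesis by simp
qed simp

text \<open>The sorted word. With 0-based positions, the copies of a letter occupy one block of
  length \<open>k\<close>, matching the rows of \<open>perm_points\<close>.\<close>

definition base_word :: "nat \<Rightarrow> nat \<Rightarrow> nat list" where
  "base_word k n = map (\<lambda>i. Suc (i div k)) [0..<k * n]"

lemma count_base_word: "a \<in> {1..n} \<Longrightarrow> count_list (base_word k n) a = k"
proof -
  assume a: "a \<in> {1..n}"
  have "count_list (base_word k n) a = card {i. i < k * n \<and> a = Suc (i div k)}"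
    unfolding count_list_eq_length_filter length_filter_conv_card
    by (rule arg_cong[of _ _ card]) (auto simp: base_word_def)
  also have "{i. i < k * n \<and> a = Suc (i div k)} = {i. i < k * n \<and> i div k = a - 1}" using a by auto
  also have "card \<dots> = k" using a by (intro card_div_block) auto
  finally show ?thesis .
qed

lemma set_base_word: "set (base_word k n) \<subseteq> {1..n}"
  by (auto simp: base_word_def less_mult_imp_div_less mult.commute Suc_leI)

lemma multiset_perms_iff: "s \<in> multiset_perms k n \<longleftrightarrow> mset s = mset (base_word k n)"
proof
  have base: "base_word k n \<in> multiset_perms k n"
    unfolding multiset_perms_def using count_base_word[of _ n k] set_base_word[of k n]
    by (simp add: base_word_def)
  assume s: "s \<in> multiset_perms k n"
  show "mset s = mset (base_word k n)"
  proof (rule multiset_eqI)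
    fix a
    have c: "count (mset w) a = (if a \<in> {1..n} then k else 0)" if "w \<in> multiset_perms k n" for w
    proof (cases "a \<in> {1..n}")
      case True
      then show ?thesis using that by (simp add: multiset_perms_def count_mset count_list_eq_length_filter)
    next
      case False
      then have "a \<notin> set w" using that by (auto simp: multiset_perms_def)
      then have "count (mset w) a = 0" by simp
      then show ?thesis using False by (simp only: if_False)
    qed
    show "count (mset s) a = count (mset (base_word k n)) a" using c[OF s] c[OF base] by simp
  qed
next
  assume eq: "mset s = mset (base_word k n)"
  have "set s = set (base_word k n)" using eq by (rule mset_eq_setD)
  then have "set s \<subseteq> {1..n}" using set_base_word by simp
  moreover have "length s = k * n" using mset_eq_length[OF eq] by (simp add: base_word_def)
  moreover have "count_list s a = count_list (base_word k n) a" for a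
    using arg_cong[OF eq, of "\<lambda>M. count M a"] by (simp add: count_mset count_list_eq_length_filter)
  ultimately show "s \<in> multiset_perms k n" by (simp add: multiset_perms_def count_base_word)
qed

text \<open>The symmetric group acts transitively on the words, so all fibres have the same size.\<close>
lemma sum_permute_list:
  fixes g :: "'a list \<Rightarrow> real"
  shows "(\<Sum>\<sigma> | \<sigma> permutes {..<length xs}. g (permute_list \<sigma> xs)) / fact (length xs)
    = (\<Sum>s | mset s = mset xs. g s) / card {s. mset s = mset xs}"
proof -
  let ?W = "{s. mset s = mset xs}"
  let ?N = "length xs"
  let ?S = "{\<sigma>. \<sigma> permutes {..<?N}}"
  let ?fib = "\<lambda>s. {\<sigma>\<in>?S. permute_list \<sigma> xs = s}"
  have finS: "finite ?S" by (rule finite_permutations) simp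
  have img: "(\<lambda>\<sigma>. permute_list \<sigma> xs) ` ?S = ?W"
  proof
    show "?W \<subseteq> (\<lambda>\<sigma>. permute_list \<sigma> xs) ` ?S"
    proof
      fix s assume "s \<in> ?W"
      then have "mset s = mset xs" by simp
      then obtain p where "p permutes {..<?N}" "permute_list p xs = s" by (rule mset_eq_permutation)
      then show "s \<in> (\<lambda>\<sigma>. permute_list \<sigma> xs) ` ?S" by auto
    qed
  qed auto
  then have finW: "finite (?W)" using finS by (metis finite_imageI)
  have fib: "card (?fib s) = card (?fib xs)" if s: "s \<in> ?W" for s
  proof -
    obtain \<tau> where \<tau>: "\<tau> permutes {..<?N}" "permute_list \<tau> xs = s" using s by (auto elim: mset_eq_permutation)
    have "bij_betw (\<lambda>\<sigma>. \<sigma> \<circ> \<tau>) (?fib xs) (?fib s)"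
    proof (rule bij_betwI[where g="\<lambda>\<sigma>. \<sigma> \<circ> inv \<tau>"])
      show "(\<lambda>\<sigma>. \<sigma> \<circ> \<tau>) \<in> ?fib xs \<rightarrow> ?fib s"
        using \<tau> by (auto simp: permute_list_compose permutes_compose)
      show "(\<lambda>\<sigma>. \<sigma> \<circ> inv \<tau>) \<in> ?fib s \<rightarrow> ?fib xs"
      proof
        fix \<sigma> assume \<sigma>: "\<sigma> \<in> ?fib s"
        have "permute_list (\<sigma> \<circ> inv \<tau>) xs = permute_list (inv \<tau>) (permute_list \<tau> xs)"
          using \<sigma> \<tau> by (simp add: permute_list_compose permutes_inv)
        also have "\<dots> = permute_list (\<tau> \<circ> inv \<tau>) xs"
          using \<tau> by (simp add: permute_list_compose permutes_inv)
        also have "\<dots> = xs" using permutes_inv_o(1)[OF \<tau>(1)] by simp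
        finally show "\<sigma> \<circ> inv \<tau> \<in> ?fib xs" using \<sigma> \<tau> by (auto intro: permutes_compose permutes_inv)
      qed
      show "\<sigma> \<circ> \<tau> \<circ> inv \<tau> = \<sigma>" for \<sigma> using permutes_inv_o(1)[OF \<tau>(1)] by (simp add: comp_assoc)
      show "\<sigma> \<circ> inv \<tau> \<circ> \<tau> = \<sigma>" for \<sigma> using permutes_inv_o(2)[OF \<tau>(1)] by (simp add: comp_assoc)
    qed
    then show ?thesis by (rule bij_betw_same_card[symmetric])
  qed
  have total: "(\<Sum>\<sigma>\<in>?S. h (permute_list \<sigma> xs)) = card (?fib xs) * (\<Sum>s\<in>?W. h s)" for h :: "'a list \<Rightarrow> real"
  proof -
    have "(\<Sum>\<sigma>\<in>?S. h (permute_list \<sigma> xs)) = (\<Sum>s\<in>?W. \<Sum>\<sigma>\<in>?fib s. h (permute_list \<sigma> xs))"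
      by (rule sum.group[OF finS finW, symmetric]) (simp only: img order.refl)
    also have "\<dots> = (\<Sum>s\<in>?W. card (?fib xs) * h s)"
    proof (rule sum.cong[OF refl])
      fix s assume "s \<in> ?W"
      have "(\<Sum>\<sigma>\<in>?fib s. h (permute_list \<sigma> xs)) = (\<Sum>\<sigma>\<in>?fib s. h s)" by (rule sum.cong) auto
      then show "(\<Sum>\<sigma>\<in>?fib s. h (permute_list \<sigma> xs)) = card (?fib xs) * h s"
        by (simp only: sum_constant fib[OF \<open>s \<in> ?W\<close>])
    qed
    finally show ?thesis by (simp only: sum_distrib_left)
  qed
  have "real (fact ?N) = card (?fib xs) * real (card ?W)"
    using total[of "\<lambda>_. 1"] by (simp add: card_permutations[of _ ?N])
  moreover from this have "real (card (?fib xs)) \<noteq> 0" by (metis fact_nonzero mult_zero_left of_nat_eq_0_iff)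
  ultimately show ?thesis unfolding total[of g] by simp
qed

text \<open>\<open>permute_list \<sigma>\<close> puts label \<open>\<sigma> i\<close> at position
  \<open>i\<close>, so label \<open>x\<close> sits in column \<open>inv \<sigma> x\<close>;
  inversion preserves the uniform average.\<close>

lemma expected_L_lt_eq_perm_mean: "expected_L_lt k n = perm_mean (k * n) k"
proof -
  let ?b = "base_word k n" and ?N = "k * n"
  let ?g = "\<lambda>s. real (L_lt (word_points s))"
  have len: "length ?b = ?N" by (simp add: base_word_def)
  have "?g (permute_list \<sigma> ?b) = real (longest (perm_points (inv \<sigma>) k {..<?N}))" if \<sigma>: "\<sigma> permutes {..<?N}" for \<sigma>
  proof -
    have s: "\<sigma> i < ?N \<longleftrightarrow> i < ?N" for i using permutes_in_image[OF \<sigma>, of i] by simp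
    have nth: "permute_list \<sigma> ?b ! i = Suc (\<sigma> i div k)" if "i < ?N" for i
    proof -
      have "permute_list \<sigma> ?b ! i = ?b ! \<sigma> i" using \<sigma> that by (intro permute_list_nth) (auto simp: len)
      then show ?thesis using s[of i] that by (simp add: base_word_def)
    qed
    have "perm_points (inv \<sigma>) k {..<?N} = perm_points (inv \<sigma>) k (\<sigma> ` {..<?N})" using permutes_image[OF \<sigma>] by simp
    also have "\<dots> = (\<lambda>i. (Suc i, Suc (\<sigma> i div k))) ` {..<?N}"
      unfolding perm_points_def image_image using permutes_inverses(2)[OF \<sigma>] by simp
    also have "(\<lambda>x. (real (fst x), real (snd x))) ` \<dots> = word_points (permute_list \<sigma> ?b)"
      unfolding word_points_def image_image using nth by (force simp: len)
    finally have "word_points (permute_list \<sigma> ?b) = (\<lambda>x. (real (fst x), real (snd x))) ` perm_points (inv \<sigma>) k {..<?N}" ..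
    moreover have "L_lt ((\<lambda>x. (real (fst x), real (snd x))) ` perm_points (inv \<sigma>) k {..<?N}) = longest (perm_points (inv \<sigma>) k {..<?N})"
      by (rule L_lt_eq_longest) (auto simp: perm_points_def)
    ultimately show ?thesis by simp
  qed
  then have "(\<Sum>\<sigma> | \<sigma> permutes {..<?N}. ?g (permute_list \<sigma> ?b))
     = (\<Sum>\<sigma> | \<sigma> permutes {..<?N}. real (longest (perm_points (inv \<sigma>) k {..<?N})))"
    by (intro sum.cong) auto
  also have "\<dots> = (\<Sum>\<sigma> | \<sigma> permutes {..<?N}. real (longest (perm_points \<sigma> k {..<?N})))"
    by (rule sum_permutations_inverse[symmetric])
  finally have "perm_mean ?N k = (\<Sum>\<sigma> | \<sigma> permutes {..<length ?b}. ?g (permute_list \<sigma> ?b)) / fact (length ?b)"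
    by (simp add: perm_mean_def perm_avg_def len)
  also have "\<dots> = expected_L_lt k n"
    unfolding sum_permute_list[of ?g ?b] expected_L_lt_def multiset_perms_iff[symmetric] Collect_mem_eq ..
  finally show ?thesis ..
qed

section \<open>From Bernoulli points to permutations\<close>

definition act :: "(nat \<Rightarrow> nat) \<Rightarrow> nat \<times> nat \<Rightarrow> nat \<times> nat" where
  "act \<sigma> x = (Suc (\<sigma> (fst x - 1)), snd x)"

lemma act_bulk:
  assumes "\<sigma> permutes {..<M}"
  shows "inj_on (act \<sigma>) (bulk M n)" "act \<sigma> ` bulk M n = bulk M n"
proof -
  have lt: "\<sigma> i < M \<longleftrightarrow> i < M" for i using permutes_in_image[OF assms, of i] by simp
  show inj: "inj_on (act \<sigma>) (bulk M n)"
  proof (rule inj_onI)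
    fix x y assume xy: "x \<in> bulk M n" "y \<in> bulk M n" "act \<sigma> x = act \<sigma> y"
    then have "fst x - 1 = fst y - 1" using permutes_inj[OF assms] by (simp add: act_def inj_eq)
    then show "x = y" using xy by (cases x; cases y) (auto simp: act_def bulk_def)
  qed
  have "act \<sigma> ` bulk M n \<subseteq> bulk M n"
  proof (rule image_subsetI)
    fix x assume x: "x \<in> bulk M n"
    then have "\<sigma> (fst x - 1) < M" unfolding lt by (auto simp: bulk_def)
    then show "act \<sigma> x \<in> bulk M n" using x by (auto simp: act_def bulk_def)
  qed
  then show "act \<sigma> ` bulk M n = bulk M n" using inj by (intro endo_inj_surj) auto
qed

text \<open>The columns of the Bernoulli field are exchangeable, so a uniform shuffle of them may be
  inserted. For fixed \<open>\<omega>\<close> the remaining randomness is then a uniform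
  permutation.\<close>

lemma expect_perm_avg:
  "expect (bulk M n) (\<lambda>_. p) F = expect (bulk M n) (\<lambda>_. p) (\<lambda>\<omega>. perm_avg M (\<lambda>\<sigma>. F (act \<sigma> ` \<omega>)))"
proof -
  let ?E = "expect (bulk M n) (\<lambda>_. p)"
  have "?E (\<lambda>\<omega>. F (act \<sigma> ` \<omega>)) = ?E F" if "\<sigma> permutes {..<M}" for \<sigma>
    using expect_reindex[OF act_bulk(1)[OF that], of n "\<lambda>_. p" F] act_bulk(2)[OF that, of n] by simp
  then have "perm_avg M (\<lambda>\<sigma>. ?E (\<lambda>\<omega>. F (act \<sigma> ` \<omega>))) = perm_avg M (\<lambda>\<sigma>. ?E F)"
    by (intro perm_avg_cong)
  moreover have "?E (\<lambda>\<omega>. perm_avg M (\<lambda>\<sigma>. F (act \<sigma> ` \<omega>))) = perm_avg M (\<lambda>\<sigma>. ?E (\<lambda>\<omega>. F (act \<sigma> ` \<omega>)))"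
    unfolding perm_avg_def divide_inverse mult.commute[of _ "inverse (fact M)"] expect_cmult expect_sum ..
  ultimately show ?thesis by simp
qed

abbreviation row :: "nat \<Rightarrow> (nat \<times> nat) set \<Rightarrow> (nat \<times> nat) set" where
  "row j \<omega> \<equiv> {x\<in>\<omega>. snd x = j}"

text \<open>A row with at most \<open>K\<close> points embeds into its block of \<open>K\<close>
  labels by \<open>g\<close>, so these rows form part of a merged permutation, with distinct columns
  by injectivity of \<open>fst\<close>. Each overfull row is deleted at a cost of one.\<close>

lemma perm_avg_le_perm_mean:
  assumes w: "\<omega> \<subseteq> bulk M n" "inj_on fst \<omega>" and K: "0 < K" "K * n \<le> M"
  shows "perm_avg M (\<lambda>\<sigma>. real (longest (act \<sigma> ` \<omega>))) \<le> perm_mean (K * n) K + card {j\<in>{1..n}. K < card (row j \<omega>)}"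
proof -
  have fin: "finite \<omega>" using w(1) finite_subset finite_bulk by blast
  let ?J = "{j\<in>{1..n}. K < card (row j \<omega>)}"
  define \<omega>' where "\<omega>' = {x\<in>\<omega>. snd x \<notin> ?J}"
  have "\<forall>j\<in>{j. card (row j \<omega>) \<le> K}. \<exists>g. g ` row j \<omega> \<subseteq> {(j - 1) * K..<(j - 1) * K + K} \<and> inj_on g (row j \<omega>)"
    by (intro ballI card_le_inj) (simp_all add: fin)
  from bchoice[OF this] obtain g where
    "\<forall>j\<in>{j. card (row j \<omega>) \<le> K}. g j ` row j \<omega> \<subseteq> {(j - 1) * K..<(j - 1) * K + K} \<and> inj_on (g j) (row j \<omega>)" ..
  then have g: "g j ` row j \<omega> \<subseteq> {(j - 1) * K..<(j - 1) * K + K}" "inj_on (g j) (row j \<omega>)" if "card (row j \<omega>) \<le> K" for j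
    using that by simp_all
  define l where "l = (\<lambda>x. g (snd x) x)"
  have bulk: "1 \<le> fst x" "fst x \<le> M" "1 \<le> snd x" "snd x \<le> n" if "x \<in> \<omega>" for x
    using that w(1) by (auto simp: bulk_def)
  have small: "card (row (snd x) \<omega>) \<le> K" if "x \<in> \<omega>'" for x
    using that bulk[of x] by (auto simp: \<omega>'_def)
  have ldiv: "l x div K = snd x - 1" if "x \<in> \<omega>'" for x
  proof -
    have "l x \<in> {(snd x - 1) * K..<(snd x - 1) * K + K}"
      using g(1)[OF small[OF that]] that unfolding l_def \<omega>'_def by blast
    then show ?thesis using div_block_iff[OF K(1)] by blast
  qed
  have linj: "inj_on l \<omega>'"
  proof (rule inj_onI)
    fix x y assume xy: "x \<in> \<omega>'" "y \<in> \<omega>'" "l x = l y"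
    then have "x \<in> \<omega>" "y \<in> \<omega>" by (auto simp: \<omega>'_def)
    moreover have "snd x - 1 = snd y - 1" using ldiv xy by metis
    ultimately have s: "snd x = snd y" using bulk(3)[of x] bulk(3)[of y] by linarith
    from g(2)[OF small[OF xy(1)]] show "x = y"
      by (rule inj_onD) (use xy(3) s \<open>x \<in> \<omega>\<close> \<open>y \<in> \<omega>\<close> in \<open>simp_all add: l_def\<close>)
  qed
  define D where "D = l ` \<omega>'"
  define c where "c = (\<lambda>d. fst (inv_into \<omega>' l d) - 1)"
  have cl: "c (l x) = fst x - 1" if "x \<in> \<omega>'" for x
    using that linj by (simp add: c_def)
  have sub: "\<omega>' \<subseteq> \<omega>" by (auto simp: \<omega>'_def)
  have "D \<subseteq> {..<K * n}"
  proof
    fix d assume "d \<in> D"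
    then obtain x where x: "x \<in> \<omega>'" "d = l x" by (auto simp: D_def)
    have "d div K < n" using ldiv[OF x(1)] x bulk[of x] sub by auto
    then show "d \<in> {..<K * n}" using K(1) by (metis lessThan_iff div_less_iff_less_mult mult.commute)
  qed
  moreover have "inj_on c D"
  proof (rule inj_onI)
    fix d e assume "d \<in> D" "e \<in> D" "c d = c e"
    then obtain x y where xy: "x \<in> \<omega>'" "d = l x" "y \<in> \<omega>'" "e = l y" "fst x - 1 = fst y - 1"
      using cl by (auto simp: D_def)
    then have "x \<in> \<omega>" "y \<in> \<omega>" using sub by auto
    then have "fst x = fst y" using bulk[of x] bulk[of y] xy(5) by linarith
    then show "d = e" using xy w(2) \<open>x \<in> \<omega>\<close> \<open>y \<in> \<omega>\<close> by (metis inj_on_eq_iff)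
  qed
  moreover have "c ` D \<subseteq> {..<M}"
  proof -
    have "fst x - 1 < M" if "x \<in> \<omega>'" for x using that bulk[of x] sub by auto
    then show ?thesis using cl by (auto simp: D_def)
  qed
  ultimately have avg: "perm_avg M (\<lambda>\<sigma>. real (longest (perm_points (\<sigma> \<circ> c) K D))) \<le> perm_mean (K * n) K"
    using perm_avg_partial(1)[of D "K * n" M c K] K(2) by blast
  have eq: "perm_points (\<sigma> \<circ> c) K D = act \<sigma> ` \<omega>'" for \<sigma>
  proof -
    have "(Suc ((\<sigma> \<circ> c) (l x)), Suc (l x div K)) = act \<sigma> x" if "x \<in> \<omega>'" for x
      using cl[OF that] ldiv[OF that] bulk(3)[of x] sub that by (auto simp: act_def)
    then show ?thesis unfolding perm_points_def D_def image_image by (intro image_cong refl)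
  qed
  have "perm_avg M (\<lambda>\<sigma>. real (longest (act \<sigma> ` \<omega>))) \<le> perm_avg M (\<lambda>\<sigma>. real (longest (perm_points (\<sigma> \<circ> c) K D)) + card ?J)"
  proof (rule perm_avg_mono)
    fix \<sigma>
    have "act \<sigma> ` \<omega> = act \<sigma> ` (\<omega> - \<omega>') \<union> act \<sigma> ` \<omega>'" using sub by auto
    also have "longest \<dots> \<le> card ?J + longest (act \<sigma> ` \<omega>')"
      using fin bulk(3) by (intro longest_Un_rows_le) (auto simp: \<omega>'_def act_def Suc_le_eq)
    finally show "real (longest (act \<sigma> ` \<omega>)) \<le> real (longest (perm_points (\<sigma> \<circ> c) K D)) + card ?J"
      unfolding eq of_nat_add[symmetric] of_nat_le_iff by (simp only: add.commute)
  qed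
  then show ?thesis using avg by (simp add: perm_avg_add)
qed

text \<open>The embedding now runs the other way: the block of \<open>K\<close> labels of a row with
  at least \<open>K\<close> points is mapped into that row, so the labelled points form a subset of
  \<open>\<omega>\<close>. The labels of deficient rows are lost at a cost of one per row.\<close>

lemma perm_mean_le_perm_avg:
  assumes w: "\<omega> \<subseteq> bulk M n" "inj_on fst \<omega>" and K: "0 < K" "K * n \<le> M"
  shows "perm_mean (K * n) K \<le> perm_avg M (\<lambda>\<sigma>. real (longest (act \<sigma> ` \<omega>))) + card {j\<in>{1..n}. card (row j \<omega>) < K}"
proof -
  have fin: "finite \<omega>" using w(1) finite_subset finite_bulk by blast
  let ?J = "{j\<in>{1..n}. card (row j \<omega>) < K}"
  let ?B = "\<lambda>j. {(j - 1) * K..<(j - 1) * K + K}"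
  have "\<forall>j\<in>{j. K \<le> card (row j \<omega>)}. \<exists>g. g ` ?B j \<subseteq> row j \<omega> \<and> inj_on g (?B j)"
    by (intro ballI card_le_inj) (simp_all add: fin)
  from bchoice[OF this] obtain g where
    "\<forall>j\<in>{j. K \<le> card (row j \<omega>)}. g j ` ?B j \<subseteq> row j \<omega> \<and> inj_on (g j) (?B j)" ..
  then have g: "g j ` ?B j \<subseteq> row j \<omega>" "inj_on (g j) (?B j)" if "K \<le> card (row j \<omega>)" for j
    using that by simp_all
  define D where "D = {x. x < K * n \<and> Suc (x div K) \<notin> ?J}"
  define e where "e = (\<lambda>x. g (Suc (x div K)) x)"
  have xB: "x \<in> ?B (Suc (x div K))" for x using div_block_iff[OF K(1), of x "x div K"] by simp
  have big: "K \<le> card (row (Suc (x div K)) \<omega>)" if "x \<in> D" for x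
  proof -
    have "x div K < n" using that by (simp add: D_def less_mult_imp_div_less mult.commute)
    then show ?thesis using that by (auto simp: D_def)
  qed
  have e: "e x \<in> \<omega>" "snd (e x) = Suc (x div K)" if "x \<in> D" for x
    using g(1)[OF big[OF that]] xB[of x] unfolding e_def by blast+
  have bulk: "1 \<le> fst x" "fst x \<le> M" if "x \<in> \<omega>" for x
    using that w(1) by (auto simp: bulk_def)
  have einj: "inj_on e D"
  proof (rule inj_onI)
    fix x y assume xy: "x \<in> D" "y \<in> D" "e x = e y"
    then have s: "x div K = y div K" using e(2) by (metis Suc_inject)
    from g(2)[OF big[OF xy(1)]] show "x = y"
      by (rule inj_onD) (use xy(3) xB[of x] xB[of y] s in \<open>simp_all add: e_def\<close>)
  qed
  define c where "c = (\<lambda>x. fst (e x) - 1)"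
  have "inj_on c D"
  proof (rule inj_onI)
    fix x y assume xy: "x \<in> D" "y \<in> D" "c x = c y"
    then have "fst (e x) = fst (e y)" using bulk(1)[OF e(1)[OF xy(1)]] bulk(1)[OF e(1)[OF xy(2)]] by (simp add: c_def)
    then have "e x = e y" using w(2) e xy by (meson inj_onD)
    then show "x = y" using einj xy by (meson inj_onD)
  qed
  moreover have "c ` D \<subseteq> {..<M}"
  proof (rule image_subsetI)
    fix x assume "x \<in> D"
    then show "c x \<in> {..<M}" using bulk[OF e(1)[OF \<open>x \<in> D\<close>]] by (auto simp: c_def)
  qed
  moreover have "x div K \<in> (\<lambda>j. j - 1) ` ?J" if "x \<in> {..<K * n} - D" for x
  proof -
    have "Suc (x div K) \<in> ?J" using that by (auto simp: D_def)
    then show ?thesis by (intro image_eqI[of _ _ "Suc (x div K)"]) auto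
  qed
  moreover have "D \<subseteq> {..<K * n}" by (auto simp: D_def)
  ultimately have "perm_mean (K * n) K \<le> perm_avg M (\<lambda>\<sigma>. real (longest (perm_points (\<sigma> \<circ> c) K D))) + card ((\<lambda>j. j - 1) ` ?J)"
    using perm_avg_partial(2)[of D "K * n" M c "(\<lambda>j. j - 1) ` ?J" K] K(2) by auto
  also have "card ((\<lambda>j. j - 1) ` ?J) \<le> card ?J" by (rule card_image_le) simp
  also have "perm_avg M (\<lambda>\<sigma>. real (longest (perm_points (\<sigma> \<circ> c) K D))) \<le> perm_avg M (\<lambda>\<sigma>. real (longest (act \<sigma> ` \<omega>)))"
  proof (intro perm_avg_mono of_nat_mono longest_mono)
    fix \<sigma>
    have "(Suc ((\<sigma> \<circ> c) x), Suc (x div K)) = act \<sigma> (e x)" if "x \<in> D" for x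
      using e[OF that] by (simp add: act_def c_def)
    then show "perm_points (\<sigma> \<circ> c) K D \<subseteq> act \<sigma> ` \<omega>" unfolding perm_points_def using e(1) by auto
  qed (use fin in auto)
  finally show ?thesis by simp
qed

text \<open>With blocks of length 1 the label \<open>x\<close> goes to the \<open>x\<close>-th
  lowest point, counted from 0. Only relative heights matter, so row counts are replaced by the
  total number of points.\<close>

lemma perm_mean_1_le_perm_avg:
  assumes w: "\<omega> \<subseteq> bulk M n" "inj_on fst \<omega>" "inj_on snd \<omega>" and N: "N \<le> card \<omega>"
  shows "perm_mean N 1 \<le> perm_avg M (\<lambda>\<sigma>. real (longest (act \<sigma> ` \<omega>)))"
proof -
  have fin: "finite \<omega>" using w(1) finite_subset finite_bulk by blast
  have bulk: "1 \<le> fst x" "fst x \<le> M" "1 \<le> snd x" if "x \<in> \<omega>" for x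
    using that w(1) by (auto simp: bulk_def)
  have "card \<omega> = card (fst ` \<omega>)" using w(2) by (simp add: card_image)
  also have "\<dots> \<le> card {1..M}" using bulk by (intro card_mono) auto
  finally have NM: "N \<le> M" using N by simp
  define ys where "ys = sorted_list_of_set (snd ` \<omega>)"
  have len: "length ys = card \<omega>" using w(3) by (simp add: ys_def card_image)
  define e where "e = (\<lambda>x. inv_into \<omega> snd (ys ! x))"
  have e: "e x \<in> \<omega>" "snd (e x) = ys ! x" if "x < N" for x
  proof -
    have "ys ! x \<in> set ys" using that len N by (intro nth_mem) auto
    then have "ys ! x \<in> snd ` \<omega>" using fin by (simp add: ys_def)
    then show "e x \<in> \<omega>" "snd (e x) = ys ! x" by (auto simp: e_def inv_into_into f_inv_into_f)
  qed
  have less: "ys ! x < ys ! y" if "x < y" "y < N" for x y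
    using that len N by (intro sorted_wrt_nth_less[of "(<)"]) (auto simp: ys_def)
  define c where "c = (\<lambda>x. fst (e x) - 1)"
  have "inj_on c {..<N}"
  proof (rule inj_onI)
    fix x y assume xy: "x \<in> {..<N}" "y \<in> {..<N}" "c x = c y"
    then have x: "e x \<in> \<omega>" "e y \<in> \<omega>" using e by auto
    then have "fst (e x) = fst (e y)" using bulk(1)[OF x(1)] bulk(1)[OF x(2)] xy(3) by (simp add: c_def)
    then have "e x = e y" using w(2) x by (meson inj_onD)
    then have "ys ! x = ys ! y" using e(2) xy by (metis lessThan_iff)
    then show "x = y" using less[of x y] less[of y x] xy by (metis lessThan_iff nat_neq_iff order_less_irrefl)
  qed
  moreover have "c ` {..<N} \<subseteq> {..<M}"
  proof (rule image_subsetI)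
    fix x assume "x \<in> {..<N}"
    then show "c x \<in> {..<M}" using bulk[OF e(1), of x] by (auto simp: c_def)
  qed
  ultimately have "perm_mean N 1 \<le> perm_avg M (\<lambda>\<sigma>. real (longest (perm_points (\<sigma> \<circ> c) 1 {..<N}))) + card ({} :: nat set)"
    using perm_avg_partial(2)[of "{..<N}" N M c "{}" 1] NM by auto
  also have "\<dots> \<le> perm_avg M (\<lambda>\<sigma>. real (longest (act \<sigma> ` \<omega>)))"
    unfolding card.empty of_nat_0 add_0_right
  proof (intro perm_avg_mono of_nat_mono)
    fix \<sigma>
    have "longest (perm_points (\<sigma> \<circ> c) 1 {..<N}) \<le> longest ((\<lambda>x. act \<sigma> (e x)) ` {..<N})"
      unfolding perm_points_def
    proof (rule longest_image_le)
      fix x y assume xy: "x \<in> {..<N}" "y \<in> {..<N}"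
        "before (Suc ((\<sigma> \<circ> c) x), Suc (x div 1)) (Suc ((\<sigma> \<circ> c) y), Suc (y div 1))"
      then have "\<sigma> (c x) < \<sigma> (c y)" "x < y" by (auto simp: before_def)
      then show "before (act \<sigma> (e x)) (act \<sigma> (e y))"
        using less[of x y] e xy by (auto simp: before_def act_def c_def)
    qed simp
    also have "\<dots> \<le> longest (act \<sigma> ` \<omega>)" using fin e(1) by (intro longest_mono) auto
    finally show "longest (perm_points (\<sigma> \<circ> c) 1 {..<N}) \<le> longest (act \<sigma> ` \<omega>)" .
  qed
  finally show ?thesis .
qed

section \<open>Exceptional configurations and the comparison of means\<close>

lemma variance_card_le:
  assumes "finite U" "prob_on U p" "A \<subseteq> U"
  shows "variance U p (\<lambda>\<omega>. real (card (\<omega> \<inter> A))) \<le> (\<Sum>x\<in>A. p x)"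
proof -
  let ?f = "\<lambda>\<omega>. real (card (\<omega> \<inter> A))"
  have finA: "finite A" using assms finite_subset by auto
  have d: "(?f (insert x \<omega>) - ?f (\<omega> - {x}))\<^sup>2 = of_bool (x \<in> A)" for x \<omega>
  proof (cases "x \<in> A")
    case True
    have "insert x \<omega> \<inter> A = insert x ((\<omega> - {x}) \<inter> A)" using True by auto
    moreover have "card (insert x ((\<omega> - {x}) \<inter> A)) = Suc (card ((\<omega> - {x}) \<inter> A))"
      using finA by (intro card_insert_disjoint) auto
    ultimately show ?thesis using True by simp
  next
    case False
    then have "insert x \<omega> \<inter> A = (\<omega> - {x}) \<inter> A" by auto
    then show ?thesis using False by simp
  qed
  have "variance U p ?f \<le> (\<Sum>x\<in>U. p x * (1 - p x) * of_bool (x \<in> A))"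
    using efron_stein[OF assms(1,2), of ?f] assms(1) by (simp add: d)
  also have "\<dots> \<le> (\<Sum>x\<in>U. p x * of_bool (x \<in> A))"
    using assms(2) by (intro sum_mono mult_right_mono) (auto simp: prob_on_def mult_left_le)
  also have "\<dots> = (\<Sum>x\<in>A. p x)"
    using assms by (intro sum.mono_neutral_cong_right) auto
  finally show ?thesis .
qed

lemma expect_card_tails:
  assumes "finite U" "prob_on U p" "A \<subseteq> U"
  shows "(\<Sum>x\<in>A. p x) < real k \<Longrightarrow> expect U p (\<lambda>\<omega>. of_bool (k < card (\<omega> \<inter> A))) \<le> (\<Sum>x\<in>A. p x) / (k - (\<Sum>x\<in>A. p x))\<^sup>2"
    and "real k < (\<Sum>x\<in>A. p x) \<Longrightarrow> expect U p (\<lambda>\<omega>. of_bool (card (\<omega> \<inter> A) < k)) \<le> (\<Sum>x\<in>A. p x) / ((\<Sum>x\<in>A. p x) - k)\<^sup>2"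
proof -
  let ?t = "\<Sum>x\<in>A. p x" and ?f = "\<lambda>\<omega>. real (card (\<omega> \<inter> A))"
  have cheb: "expect U p (\<lambda>\<omega>. of_bool (\<bar>?f \<omega> - ?t\<bar> \<ge> d)) \<le> ?t / d\<^sup>2" if "d > 0" for d
  proof -
    have "expect U p (\<lambda>\<omega>. of_bool (\<bar>?f \<omega> - ?t\<bar> \<ge> d)) \<le> variance U p ?f / d\<^sup>2"
      using chebyshev[OF assms(1,2) that, of ?f] by (simp add: expect_card[OF assms(1,3)])
    also have "\<dots> \<le> ?t / d\<^sup>2" by (intro divide_right_mono variance_card_le assms) simp
    finally show ?thesis .
  qed
  show "expect U p (\<lambda>\<omega>. of_bool (k < card (\<omega> \<inter> A))) \<le> ?t / (k - ?t)\<^sup>2" if "?t < real k"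
  proof -
    have "expect U p (\<lambda>\<omega>. of_bool (k < card (\<omega> \<inter> A))) \<le> expect U p (\<lambda>\<omega>. of_bool (\<bar>?f \<omega> - ?t\<bar> \<ge> k - ?t))"
      by (rule expect_mono[OF assms(2)]) (auto simp: of_bool_def)
    then show ?thesis using cheb[of "k - ?t"] that by simp
  qed
  show "expect U p (\<lambda>\<omega>. of_bool (card (\<omega> \<inter> A) < k)) \<le> ?t / (?t - k)\<^sup>2" if "real k < ?t"
  proof -
    have "expect U p (\<lambda>\<omega>. of_bool (card (\<omega> \<inter> A) < k)) \<le> expect U p (\<lambda>\<omega>. of_bool (\<bar>?f \<omega> - ?t\<bar> \<ge> ?t - k))"
      by (rule expect_mono[OF assms(2)]) (auto simp: of_bool_def)
    then show ?thesis using cheb[of "?t - k"] that by simp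
  qed
qed

text \<open>Union bound over the ordered pairs \<open>Q\<close> that would collide.\<close>

lemma expect_not_inj_le:
  fixes p :: real
  assumes "finite U" "0 \<le> p" "p \<le> 1" "finite Q" "\<And>x y. x \<in> U \<Longrightarrow> y \<in> U \<Longrightarrow> x \<noteq> y \<Longrightarrow> f x = f y \<Longrightarrow> (x, y) \<in> Q"
    and "\<And>x y. (x, y) \<in> Q \<Longrightarrow> x \<in> U \<and> y \<in> U \<and> x \<noteq> y"
  shows "expect U (\<lambda>_. p) (\<lambda>\<omega>. of_bool (\<not> inj_on f \<omega>)) \<le> card Q * p\<^sup>2"
proof -
  have pr: "prob_on U (\<lambda>_. p)" using assms(2,3) by (simp add: prob_on_def)
  have "expect U (\<lambda>_. p) (\<lambda>\<omega>. of_bool (\<not> inj_on f \<omega>))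
      \<le> expect U (\<lambda>_. p) (\<lambda>\<omega>. \<Sum>q\<in>Q. of_bool (fst q \<in> \<omega> \<and> snd q \<in> \<omega>))"
  proof (rule expect_mono[OF pr])
    fix \<omega> assume w: "\<omega> \<subseteq> U"
    show "of_bool (\<not> inj_on f \<omega>) \<le> (\<Sum>q\<in>Q. of_bool (fst q \<in> \<omega> \<and> snd q \<in> \<omega>) :: real)"
    proof (cases "inj_on f \<omega>")
      case False
      then obtain x y where xy: "x \<in> \<omega>" "y \<in> \<omega>" "x \<noteq> y" "f x = f y" by (auto simp: inj_on_def)
      then have "(x, y) \<in> Q" using w assms(5) by blast
      then have "(\<Sum>q\<in>{(x, y)}. of_bool (fst q \<in> \<omega> \<and> snd q \<in> \<omega>) :: real) \<le> (\<Sum>q\<in>Q. of_bool (fst q \<in> \<omega> \<and> snd q \<in> \<omega>))"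
        using assms(4) by (intro sum_mono2) auto
      then show ?thesis using xy False by simp
    qed (simp add: sum_nonneg)
  qed
  also have "\<dots> = (\<Sum>q\<in>Q. p * p)"
    unfolding expect_sum
  proof (rule sum.cong[OF refl])
    fix q assume "q \<in> Q"
    then have "fst q \<in> U" "snd q \<in> U" "fst q \<noteq> snd q" using assms(6)[of "fst q" "snd q"] by auto
    then show "expect U (\<lambda>_. p) (\<lambda>\<omega>. of_bool (fst q \<in> \<omega> \<and> snd q \<in> \<omega>)) = p * p"
      using expect_mem2[OF assms(1), of "fst q" "snd q" "\<lambda>_. p"] by simp
  qed
  finally show ?thesis by (simp add: power2_eq_square)
qed

lemma expect_column_collision_le:
  fixes p :: real
  assumes "0 \<le> p" "p \<le> 1"
  shows "expect (bulk M n) (\<lambda>_. p) (\<lambda>\<omega>. of_bool (\<not> inj_on fst \<omega>)) \<le> M * real n ^ 2 * p\<^sup>2"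
proof -
  let ?Q = "{q\<in>bulk M n \<times> bulk M n. fst q \<noteq> snd q \<and> fst (fst q) = fst (snd q)}"
  have "expect (bulk M n) (\<lambda>_. p) (\<lambda>\<omega>. of_bool (\<not> inj_on fst \<omega>)) \<le> card ?Q * p\<^sup>2"
    by (rule expect_not_inj_le) (use assms in auto)
  moreover have "card ?Q \<le> card ({1..M} \<times> {1..n} \<times> {1..n})"
    by (rule card_inj_on_le[of "\<lambda>q. (fst (fst q), snd (fst q), snd (snd q))"]) (auto simp: inj_on_def bulk_def)
  then have "real (card ?Q) \<le> M * real n ^ 2" by (simp add: power2_eq_square flip: of_nat_mult)
  then have "card ?Q * p\<^sup>2 \<le> M * real n ^ 2 * p\<^sup>2" by (rule mult_right_mono) simp
  ultimately show ?thesis by linarith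
qed

lemma expect_row_collision_le:
  fixes p :: real
  assumes "0 \<le> p" "p \<le> 1"
  shows "expect (bulk M n) (\<lambda>_. p) (\<lambda>\<omega>. of_bool (\<not> inj_on snd \<omega>)) \<le> n * real M ^ 2 * p\<^sup>2"
proof -
  let ?Q = "{q\<in>bulk M n \<times> bulk M n. fst q \<noteq> snd q \<and> snd (fst q) = snd (snd q)}"
  have "expect (bulk M n) (\<lambda>_. p) (\<lambda>\<omega>. of_bool (\<not> inj_on snd \<omega>)) \<le> card ?Q * p\<^sup>2"
    by (rule expect_not_inj_le) (use assms in auto)
  moreover have "card ?Q \<le> card ({1..n} \<times> {1..M} \<times> {1..M})"
    by (rule card_inj_on_le[of "\<lambda>q. (snd (fst q), fst (fst q), fst (snd q))"]) (auto simp: inj_on_def bulk_def)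
  then have "real (card ?Q) \<le> n * real M ^ 2" by (simp add: power2_eq_square flip: of_nat_mult)
  then have "card ?Q * p\<^sup>2 \<le> n * real M ^ 2 * p\<^sup>2" by (rule mult_right_mono) simp
  ultimately show ?thesis by linarith
qed

lemma expect_card_rows:
  assumes "\<And>j. j \<in> {1..n} \<Longrightarrow> expect (bulk M n) p (\<lambda>\<omega>. of_bool (P (card (\<omega> \<inter> {1..M} \<times> {j})))) \<le> v"
  shows "expect (bulk M n) p (\<lambda>\<omega>. real (card {j\<in>{1..n}. P (card (row j \<omega>))})) \<le> n * v"
proof -
  have "expect (bulk M n) p (\<lambda>\<omega>. real (card {j\<in>{1..n}. P (card (row j \<omega>))}))
      = expect (bulk M n) p (\<lambda>\<omega>. \<Sum>j\<in>{1..n}. of_bool (P (card (\<omega> \<inter> {1..M} \<times> {j}))))"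
  proof (rule expect_cong[OF refl refl])
    fix \<omega> assume w: "\<omega> \<subseteq> bulk M n"
    have "row j \<omega> = \<omega> \<inter> {1..M} \<times> {j}" for j using w by (auto simp: bulk_def)
    then show "real (card {j\<in>{1..n}. P (card (row j \<omega>))}) = (\<Sum>j\<in>{1..n}. of_bool (P (card (\<omega> \<inter> {1..M} \<times> {j}))))"
      by (simp add: sum_of_bool_eq Int_def)
  qed
  also have "\<dots> \<le> (\<Sum>j\<in>{1..n}. v)" unfolding expect_sum by (intro sum_mono assms)
  finally show ?thesis by simp
qed

lemma longest_bulk_le: "\<omega> \<subseteq> bulk M n \<Longrightarrow> longest \<omega> \<le> n"
proof -
  assume w: "\<omega> \<subseteq> bulk M n"
  have "longest (\<omega> \<union> {}) \<le> card {1..n} + longest {}"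
    using w finite_subset[OF w] by (intro longest_Un_rows_le) (auto simp: bulk_def)
  moreover have "longest {} = 0" using longest_leI[of "{}" 0] by auto
  ultimately show ?thesis by simp
qed

lemma row_sum: "(\<Sum>x\<in>{1..M} \<times> {j}. p) = real M * p" for j :: nat
  by simp

text \<open>Overfull rows are counted by Chebyshev. On configurations with two points in one column
  the relative order is not that of a permutation, and the trivial bound \<open>n\<close> is paid
  instead.\<close>

lemma bern_mean_le_perm_mean:
  fixes p :: real
  assumes "0 < K" "K * n \<le> M" "0 \<le> p" "p \<le> 1" "M * p < K"
  shows "bern_mean M n p \<le> perm_mean (K * n) K + n * (M * p / (K - M * p)\<^sup>2) + n * (M * real n ^ 2 * p\<^sup>2)"
proof -
  let ?E = "expect (bulk M n) (\<lambda>_. p)"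
  let ?A = "\<lambda>\<omega>. perm_avg M (\<lambda>\<sigma>. real (longest (act \<sigma> ` \<omega>)))"
  let ?J = "\<lambda>\<omega>. real (card {j\<in>{1..n}. K < card (row j \<omega>)})"
  have pr: "prob_on (bulk M n) (\<lambda>_. p)" using assms by (simp add: prob_on_def)
  have "bern_mean M n p = ?E ?A" unfolding bern_mean_def by (rule expect_perm_avg)
  also have "\<dots> \<le> ?E (\<lambda>\<omega>. perm_mean (K * n) K + ?J \<omega> + n * of_bool (\<not> inj_on fst \<omega>))"
  proof (rule expect_mono[OF pr])
    fix \<omega> assume w: "\<omega> \<subseteq> bulk M n"
    show "?A \<omega> \<le> perm_mean (K * n) K + ?J \<omega> + n * of_bool (\<not> inj_on fst \<omega>)"
    proof (cases "inj_on fst \<omega>")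
      case True
      then show ?thesis using perm_avg_le_perm_mean[OF w True assms(1,2)] by simp
    next
      case False
      have "?A \<omega> \<le> perm_avg M (\<lambda>_. real n)"
      proof (intro perm_avg_mono of_nat_mono longest_bulk_le)
        fix \<sigma> assume "\<sigma> permutes {..<M}"
        then show "act \<sigma> ` \<omega> \<subseteq> bulk M n" using w act_bulk(2)[of \<sigma> M n] by auto
      qed
      then show ?thesis using False perm_mean_bounds(1)[OF assms(1), of "K * n"] by simp
    qed
  qed
  also have "\<dots> = perm_mean (K * n) K + ?E ?J + n * ?E (\<lambda>\<omega>. of_bool (\<not> inj_on fst \<omega>))"
    by (simp add: expect_add expect_cmult)
  also have "?E ?J \<le> n * (M * p / (K - M * p)\<^sup>2)"
  proof (rule expect_card_rows)
    fix j assume "j \<in> {1..n}"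
    then have "{1..M} \<times> {j} \<subseteq> bulk M n" by (auto simp: bulk_def)
    from expect_card_tails(1)[OF finite_bulk pr this, of K] assms(5)
    show "?E (\<lambda>\<omega>. of_bool (K < card (\<omega> \<inter> {1..M} \<times> {j}))) \<le> M * p / (K - M * p)\<^sup>2"
      unfolding row_sum by blast
  qed
  also have "n * ?E (\<lambda>\<omega>. of_bool (\<not> inj_on fst \<omega>)) \<le> n * (M * real n ^ 2 * p\<^sup>2)"
    using assms by (intro mult_left_mono expect_column_collision_le) auto
  finally show ?thesis by simp
qed

text \<open>The intensity now lies above \<open>K\<close>, so that deficient rows are the
  exceptional ones; on column collisions \<open>perm_mean (K * n) K \<le> n\<close> is used.\<close>

lemma perm_mean_le_bern_mean:
  fixes p :: real
  assumes "0 < K" "K * n \<le> M" "0 \<le> p" "p \<le> 1" "K < M * p"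
  shows "perm_mean (K * n) K \<le> bern_mean M n p + n * (M * p / (M * p - K)\<^sup>2) + n * (M * real n ^ 2 * p\<^sup>2)"
proof -
  let ?E = "expect (bulk M n) (\<lambda>_. p)"
  let ?A = "\<lambda>\<omega>. perm_avg M (\<lambda>\<sigma>. real (longest (act \<sigma> ` \<omega>)))"
  let ?J = "\<lambda>\<omega>. real (card {j\<in>{1..n}. card (row j \<omega>) < K})"
  have pr: "prob_on (bulk M n) (\<lambda>_. p)" using assms by (simp add: prob_on_def)
  have "perm_mean (K * n) K = ?E (\<lambda>_. perm_mean (K * n) K)" by simp
  also have "\<dots> \<le> ?E (\<lambda>\<omega>. ?A \<omega> + ?J \<omega> + n * of_bool (\<not> inj_on fst \<omega>))"
  proof (rule expect_mono[OF pr])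
    fix \<omega> assume w: "\<omega> \<subseteq> bulk M n"
    show "perm_mean (K * n) K \<le> ?A \<omega> + ?J \<omega> + n * of_bool (\<not> inj_on fst \<omega>)"
    proof (cases "inj_on fst \<omega>")
      case True
      then show ?thesis using perm_mean_le_perm_avg[OF w True assms(1,2)] by simp
    next
      case False
      have "perm_avg M (\<lambda>_. 0) \<le> ?A \<omega>" by (intro perm_avg_mono) simp
      then show ?thesis using False perm_mean_bounds(2)[OF assms(1), of n] by simp
    qed
  qed
  also have "\<dots> = ?E ?A + ?E ?J + n * ?E (\<lambda>\<omega>. of_bool (\<not> inj_on fst \<omega>))"
    by (simp add: expect_add expect_cmult)
  also have "?E ?A = bern_mean M n p" unfolding bern_mean_def by (rule expect_perm_avg[symmetric])
  also have "?E ?J \<le> n * (M * p / (M * p - K)\<^sup>2)"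
  proof (rule expect_card_rows)
    fix j assume "j \<in> {1..n}"
    then have "{1..M} \<times> {j} \<subseteq> bulk M n" by (auto simp: bulk_def)
    from expect_card_tails(2)[OF finite_bulk pr this, of K] assms(5)
    show "?E (\<lambda>\<omega>. of_bool (card (\<omega> \<inter> {1..M} \<times> {j}) < K)) \<le> M * p / (M * p - K)\<^sup>2"
      unfolding row_sum by blast
  qed
  also have "n * ?E (\<lambda>\<omega>. of_bool (\<not> inj_on fst \<omega>)) \<le> n * (M * real n ^ 2 * p\<^sup>2)"
    using assms by (intro mult_left_mono expect_column_collision_le) auto
  finally show ?thesis by simp
qed

text \<open>There are three bad events: too few points, a shared column, a shared row. On each of
  them the trivial bound \<open>N\<close> is paid.\<close>

lemma perm_mean_1_le_bern_mean:
  fixes p :: real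
  assumes "0 \<le> p" "p \<le> 1" "N < real M * real n * p"
  shows "perm_mean N 1 \<le> bern_mean M n p + N * (real M * real n * p / (real M * real n * p - N)\<^sup>2 + M * real n ^ 2 * p\<^sup>2 + n * real M ^ 2 * p\<^sup>2)"
proof -
  let ?E = "expect (bulk M n) (\<lambda>_. p)"
  let ?A = "\<lambda>\<omega>. perm_avg M (\<lambda>\<sigma>. real (longest (act \<sigma> ` \<omega>)))"
  let ?c = "\<lambda>\<omega>. of_bool (card (\<omega> \<inter> bulk M n) < N) :: real"
  let ?c1 = "\<lambda>\<omega>. of_bool (\<not> inj_on fst \<omega>) :: real" and ?c2 = "\<lambda>\<omega>. of_bool (\<not> inj_on snd \<omega>) :: real"
  have pr: "prob_on (bulk M n) (\<lambda>_. p)" using assms by (simp add: prob_on_def)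
  have "perm_mean N 1 = ?E (\<lambda>_. perm_mean N 1)" by simp
  also have "\<dots> \<le> ?E (\<lambda>\<omega>. ?A \<omega> + N * (?c \<omega> + ?c1 \<omega> + ?c2 \<omega>))"
  proof (rule expect_mono[OF pr])
    fix \<omega> assume w: "\<omega> \<subseteq> bulk M n"
    then have eq: "\<omega> \<inter> bulk M n = \<omega>" by auto
    show "perm_mean N 1 \<le> ?A \<omega> + N * (?c \<omega> + ?c1 \<omega> + ?c2 \<omega>)"
    proof (cases "inj_on fst \<omega> \<and> inj_on snd \<omega> \<and> N \<le> card \<omega>")
      case True
      then show ?thesis using perm_mean_1_le_perm_avg[OF w] eq by simp
    next
      case False
      have "perm_avg M (\<lambda>_. 0) \<le> ?A \<omega>" by (intro perm_avg_mono) simp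
      moreover have "real N * 1 \<le> real N * (?c \<omega> + ?c1 \<omega> + ?c2 \<omega>)"
        using False eq by (intro mult_left_mono) (auto simp: of_bool_def)
      ultimately show ?thesis using perm_mean_bounds(3)[of 1 N] by simp
    qed
  qed
  also have "\<dots> = ?E ?A + N * (?E ?c + ?E ?c1 + ?E ?c2)"
    by (simp add: expect_add expect_cmult)
  also have "?E ?A = bern_mean M n p" unfolding bern_mean_def by (rule expect_perm_avg[symmetric])
  also have "N * (?E ?c + ?E ?c1 + ?E ?c2)
      \<le> N * (real M * real n * p / (real M * real n * p - N)\<^sup>2 + M * real n ^ 2 * p\<^sup>2 + n * real M ^ 2 * p\<^sup>2)"
  proof (intro mult_left_mono add_mono expect_column_collision_le expect_row_collision_le)
    have "(\<Sum>x\<in>bulk M n. p) = real M * real n * p" by (simp add: bulk_def)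
    from expect_card_tails(2)[OF finite_bulk pr order.refl, of N, unfolded this] assms(3)
    show "?E ?c \<le> real M * real n * p / (real M * real n * p - N)\<^sup>2" by simp
  qed (use assms in auto)
  finally show ?thesis by simp
qed

section \<open>Asymptotics\<close>

lemma sqrt_nk_le: "k \<le> n \<Longrightarrow> sqrt (real n * real k) \<le> n"
proof -
  assume "k \<le> n"
  then have "real n * real k \<le> (real n)\<^sup>2" by (simp add: power2_eq_square mult_left_mono)
  then show ?thesis by (simp add: real_le_lsqrt)
qed

text \<open>Source of the grid width \<open>4 * n ^ 5\<close>: with \<open>M\<close> columns the
  collision cost is n^3 t^2 / M, and t \<le> 2 n makes the numerator at most 4 n^5.\<close>

lemma collision_term:
  assumes "0 < n" "t \<le> 2 * real n" "0 \<le> t"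
  shows "n * (real (4 * n ^ 5) * real n ^ 2 * (t / real (4 * n ^ 5))\<^sup>2) \<le> 1"
proof -
  have n: "0 < real n" using assms by simp
  have "n * (real (4 * n ^ 5) * real n ^ 2 * (t / real (4 * n ^ 5))\<^sup>2) = t\<^sup>2 / (4 * real n ^ 2)"
    using n by (simp add: power2_eq_square power_numeral_reduce)
  also have "\<dots> \<le> (2 * real n)\<^sup>2 / (4 * real n ^ 2)"
    using assms by (intro divide_right_mono power_mono) auto
  also have "\<dots> = 1" using n by (simp add: power_mult_distrib)
  finally show ?thesis .
qed

text \<open>The intensity \<open>t = (1 + \<delta>) * k\<close> makes deficient rows rare: their
  mean number is at most \<open>n * t\<close> over the square of \<open>\<delta> * k\<close>,
  bounded because \<open>k \<ge> \<eta> * n\<close>. Raising the intensity costs the term of order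
  \<open>\<delta> * n\<close>.\<close>

lemma perm_mean_dense_upper:
  assumes "0 < \<eta>" "0 < \<delta>" "\<delta> \<le> 1" "0 < n" "1 \<le> k" "k \<le> n" "\<eta> * n \<le> real k"
  shows "perm_mean (k * n) k \<le> 2 * sqrt (real n * k) - k + 2 * \<delta> * n + (2 / (\<delta>\<^sup>2 * \<eta>) + 1)"
proof -
  define M where "M = 4 * n ^ 5"
  define t where "t = (1 + \<delta>) * real k"
  define u where "u = sqrt (real n * k)"
  have n: "0 < real n" "1 \<le> real n" and k: "0 < real k" "real k \<le> n" using assms by auto
  have u: "u\<^sup>2 = n * k" "0 < u" "u \<le> n" using n k sqrt_nk_le[OF assms(6)] by (auto simp: u_def)
  have ku: "k \<le> u" unfolding u_def using k by (intro real_le_rsqrt) (simp add: power2_eq_square mult_right_mono)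
  have t: "0 < t" "t \<le> 2 * n" "real k < t" "t - k = \<delta> * k"
  proof -
    show "0 < t" using assms k by (simp add: t_def)
    have "(1 + \<delta>) * real k \<le> 2 * real n" using assms k by (intro mult_mono) auto
    then show "t \<le> 2 * n" by (simp add: t_def)
    show "real k < t" "t - k = \<delta> * k" using assms k by (auto simp: t_def algebra_simps)
  qed
  have nM: "4 * n \<le> M" "n * n \<le> M"
  proof -
    have "n ^ 1 \<le> n ^ 5" using assms by (intro power_increasing) auto
    then show "4 * n \<le> M" by (simp add: M_def)
    have "n ^ 2 \<le> n ^ 5" using assms by (intro power_increasing) auto
    then show "n * n \<le> M" by (simp add: M_def power2_eq_square)
  qed
  have M: "0 < real M" "4 * real n \<le> real M"
    using of_nat_mono[OF nM(1), where 'a=real] n by auto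
  have tM: "t < M" "t \<le> M" using t M n by linarith+
  have "k * n \<le> M" using assms(6) nM(2) by (meson le_trans mult_le_mono1)
  then have "perm_mean (k * n) k \<le> bern_mean M n (t / M) + n * (M * (t / M) / (M * (t / M) - k)\<^sup>2) + n * (M * real n ^ 2 * (t / M)\<^sup>2)"
    using assms t M tM by (intro perm_mean_le_bern_mean) auto
  also have "M * (t / M) = t" using M by simp
  also have "n * (M * real n ^ 2 * (t / M)\<^sup>2) \<le> 1"
    unfolding M_def using assms(4) t by (intro collision_term) auto
  also have "n * (t / (t - k)\<^sup>2) \<le> 2 / (\<delta>\<^sup>2 * \<eta>)"
  proof -
    have "n * (t / (t - k)\<^sup>2) = (1 + \<delta>) * (n / (\<delta>\<^sup>2 * k))"
      unfolding t(4) using k by (simp add: t_def power2_eq_square mult_ac)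
    also have "\<dots> \<le> 2 * (1 / (\<delta>\<^sup>2 * \<eta>))"
    proof (rule mult_mono)
      have "n * (\<delta>\<^sup>2 * \<eta>) = \<delta>\<^sup>2 * (\<eta> * n)" by simp
      also have "\<dots> \<le> \<delta>\<^sup>2 * k" using assms by (intro mult_left_mono) auto
      finally show "n / (\<delta>\<^sup>2 * k) \<le> 1 / (\<delta>\<^sup>2 * \<eta>)" using assms k by (simp add: divide_le_eq pos_le_divide_eq)
    qed (use assms in auto)
    finally show ?thesis by simp
  qed
  also have "bern_mean M n (t / M) \<le> 2 * u - k + 2 * \<delta> * n"
  proof -
    \<comment> \<open>Near the minimiser, within order \<open>\<delta> * n\<close>. What matters is
      \<open>0 \<le> a\<close> and \<open>u \<le> a + t\<close>, so that
      \<open>n * t / (a + t)\<close> is at most \<open>(1 + \<delta>) * u\<close>.\<close>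
    define a where "a = u - k + \<delta> * n"
    have "\<delta> * n \<le> 1 * real n" using assms by (intro mult_right_mono) auto
    moreover have "0 \<le> \<delta> * n" using assms by simp
    ultimately have a: "0 \<le> a" "a < M" unfolding a_def using ku u(3) M(2) n k by linarith+
    have "bern_mean M n (t / M) \<le> a + n * t / (a + t)"
      using a t tM by (intro bern_mean_upper) auto
    also have "n * t / (a + t) \<le> n * t / u"
    proof (rule divide_left_mono)
      have "0 \<le> \<delta> * n" using assms by simp
      then show ut: "u \<le> a + t" using t(3) by (simp add: a_def)
      show "0 < (a + t) * u" using ut u(2) by (intro mult_pos_pos) linarith+
      show "0 \<le> n * t" using t n by simp
    qed
    also have "n * t / u = (1 + \<delta>) * u"
    proof -
      have "n * t = (1 + \<delta>) * u\<^sup>2" using u(1) by (simp add: t_def)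
      then show ?thesis using u(2) by (simp add: power2_eq_square)
    qed
    also have "(1 + \<delta>) * u = u + \<delta> * u" by (simp add: algebra_simps)
    also have "\<delta> * u \<le> \<delta> * n" using u(3) assms by (intro mult_left_mono) auto
    finally show ?thesis by (simp add: a_def)
  qed
  finally show ?thesis by (simp add: u_def)
qed

text \<open>The hypothesis says \<open>sqrt s \<ge> 10 / g\<close>, so
  \<open>s * g \<ge> 10 * sqrt s\<close>; as also \<open>sqrt s \<ge> 10\<close>, this dominates
  \<open>2 + 6 * sqrt s\<close>.\<close>

lemma linear_beats_sqrt:
  fixes g s :: real
  assumes "0 < g" "g \<le> 1" "100 / g\<^sup>2 \<le> s"
  shows "2 + 3 * sqrt (2 * s) < s * g"
proof -
  define x where "x = sqrt s"
  have "0 < 100 / g\<^sup>2" using assms by simp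
  then have s0: "0 < s" using assms(3) by linarith
  have x: "x\<^sup>2 = s" "0 < x" using s0 by (auto simp: x_def)
  have "(10 / g)\<^sup>2 \<le> s" using assms by (simp add: power_divide)
  then have xg: "10 / g \<le> x" unfolding x_def by (rule real_le_rsqrt)
  then have "10 \<le> x * g" using assms(1) by (simp add: divide_le_eq)
  then have "10 * x \<le> x * g * x" using x by (intro mult_right_mono) auto
  also have "\<dots> = s * g" using x by (simp add: power2_eq_square)
  finally have 1: "10 * x \<le> s * g" .
  have "10 \<le> 10 / g" using assms by (simp add: pos_le_divide_eq)
  then have "10 \<le> x" using xg by linarith
  moreover have "sqrt (2 * s) \<le> 2 * x"
    unfolding real_sqrt_mult x_def using s0 sqrt2_less_2 by (intro mult_right_mono) auto
  ultimately show ?thesis using 1 by linarith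
qed

text \<open>The intensity \<open>t = (1 - \<delta>) * k\<close> makes overfull rows rare and gives
  the condition \<open>t \<le> (1 - \<delta>) * n\<close> of \<open>bern_mean_lower_cases\<close>.
  With \<open>\<delta> \<le> 1 / 2\<close> one has \<open>s \<ge> \<eta> * n / 2\<close>, so
  \<open>large\<close> yields the threshold of \<open>linear_beats_sqrt\<close>, the axis entry of
  the maximum is ruled out, and the bulk entry remains.\<close>

lemma perm_mean_dense_lower:
  assumes "0 < \<eta>" "\<eta> \<le> 1" "0 < \<delta>" "\<delta> \<le> 1 / 2" "0 < n" "1 \<le> k" "k \<le> n" "\<eta> * n \<le> real k"
    and large: "200 / (\<eta> * (1 - sqrt (1 - \<delta>)) ^ 4) \<le> n"
  shows "2 * sqrt (real n * k) - k - 5 * \<delta> * n - (2 + 9 / (2 * \<delta>) + 1 / (\<delta>\<^sup>2 * \<eta>)) \<le> perm_mean (k * n) k"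
proof -
  define M where "M = 4 * n ^ 5"
  define t where "t = (1 - \<delta>) * real k"
  define u where "u = sqrt (real n * k)"
  define s where "s = sqrt (n * t)"
  define r where "r = sqrt (1 - \<delta>)"
  have n: "0 < real n" "1 \<le> real n" and k: "0 < real k" "real k \<le> n" using assms by auto
  have u: "u\<^sup>2 = n * k" "0 < u" "u \<le> n" using n k sqrt_nk_le[OF assms(7)] by (auto simp: u_def)
  have r: "0 < r" "r < 1" "r\<^sup>2 = 1 - \<delta>" "1 - \<delta> \<le> r" "1 / 2 \<le> r"
  proof -
    show "0 < r" "r < 1" "r\<^sup>2 = 1 - \<delta>" using assms by (auto simp: r_def)
    have "(1 - \<delta>)\<^sup>2 \<le> 1 - \<delta>" using assms by (auto simp: power2_eq_square mult_left_le)
    then show "1 - \<delta> \<le> r" unfolding r_def by (rule real_le_rsqrt)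
    then show "1 / 2 \<le> r" using assms by linarith
  qed
  have su: "s = r * u" by (simp add: s_def t_def r_def u_def mult_ac flip: real_sqrt_mult)
  have t: "0 < t" "t \<le> k" "t < k" "k - t = \<delta> * k"
    using assms k by (auto simp: t_def algebra_simps)
  have t': "t \<le> (1 - \<delta>) * n" unfolding t_def using assms k by (intro mult_left_mono) auto
  have nM: "4 * n \<le> M" "n * n \<le> M"
  proof -
    have "n ^ 1 \<le> n ^ 5" using assms by (intro power_increasing) auto
    then show "4 * n \<le> M" by (simp add: M_def)
    have "n ^ 2 \<le> n ^ 5" using assms by (intro power_increasing) auto
    then show "n * n \<le> M" by (simp add: M_def power2_eq_square)
  qed
  have M: "0 < real M" "4 * real n \<le> real M" "real n ^ 2 \<le> real M"
    using of_nat_mono[OF nM(1), where 'a=real] of_nat_mono[OF nM(2), where 'a=real] n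
    by (auto simp: power2_eq_square)
  have tM: "t \<le> M" using t M k by linarith
  have "n / r < M"
  proof -
    have "n / r \<le> n / (1 / 2)" using r n by (intro divide_left_mono) auto
    then show ?thesis using M n by simp
  qed
  with bern_mean_lower_cases[of \<delta> t n M] assms t t' M
  have cases: "2 * s - t - 1 \<le> max (bern_mean M n (t / M) + 2 * \<delta> * s) (2 * s - t - s * (1 - r)\<^sup>2 + 1) + 3 * sqrt (2 * s)"
    by (simp add: s_def r_def)
  have "2 + 3 * sqrt (2 * s) < s * (1 - r)\<^sup>2"
  proof (rule linear_beats_sqrt)
    show "0 < (1 - r)\<^sup>2" "(1 - r)\<^sup>2 \<le> 1" using r by (auto simp: power_le_one)
    have "\<eta> * n \<le> u"
    proof -
      have "(\<eta> * n)\<^sup>2 = (\<eta> * n) * (\<eta> * n)" by (simp add: power2_eq_square)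
      also have "\<dots> \<le> real n * real k" using assms n by (intro mult_mono) (auto simp: mult_left_le_one_le)
      finally show ?thesis unfolding u_def by (intro real_le_rsqrt)
    qed
    then have "1 / 2 * (\<eta> * n) \<le> r * u" using r assms n by (intro mult_mono) auto
    moreover have "200 / (1 - r) ^ 4 \<le> \<eta> * n"
      using large assms by (simp add: r_def field_simps)
    ultimately show "100 / ((1 - r)\<^sup>2)\<^sup>2 \<le> s" by (simp add: su)
  qed
  then have bern_mean: "2 * s - t - 1 - 3 * sqrt (2 * s) - 2 * \<delta> * s \<le> bern_mean M n (t / M)"
    using cases by (auto simp: max_def split: if_splits)
  have "k * n \<le> M" using assms(7) nM(2) by (meson le_trans mult_le_mono1)
  then have "bern_mean M n (t / M) \<le> perm_mean (k * n) k + n * (M * (t / M) / (k - M * (t / M))\<^sup>2) + n * (M * real n ^ 2 * (t / M)\<^sup>2)"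
    using assms t M tM by (intro bern_mean_le_perm_mean) auto
  also have "M * (t / M) = t" using M by simp
  also have "n * (M * real n ^ 2 * (t / M)\<^sup>2) \<le> 1"
    unfolding M_def using assms(5) t k by (intro collision_term) auto
  also have "n * (t / (k - t)\<^sup>2) \<le> 1 / (\<delta>\<^sup>2 * \<eta>)"
  proof -
    have "n * (t / (k - t)\<^sup>2) \<le> n * (k / (\<delta> * k)\<^sup>2)"
      unfolding t(4) using t(2) n by (intro mult_left_mono divide_right_mono) auto
    also have "\<dots> = n / (\<delta>\<^sup>2 * k)" using k assms by (simp add: power2_eq_square)
    also have "\<dots> \<le> 1 / (\<delta>\<^sup>2 * \<eta>)"
    proof -
      have "n * (\<delta>\<^sup>2 * \<eta>) = \<delta>\<^sup>2 * (\<eta> * n)" by simp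
      also have "\<dots> \<le> \<delta>\<^sup>2 * k" using assms by (intro mult_left_mono) auto
      finally show "n / (\<delta>\<^sup>2 * k) \<le> 1 / (\<delta>\<^sup>2 * \<eta>)" using assms k by (simp add: divide_le_eq pos_le_divide_eq)
    qed
    finally show ?thesis .
  qed
  finally have perm_mean: "bern_mean M n (t / M) \<le> perm_mean (k * n) k + 1 / (\<delta>\<^sup>2 * \<eta>) + 1" by simp
  have sn: "0 \<le> s" "s \<le> n"
  proof -
    show "0 \<le> s" using r u by (simp add: su)
    have "r * u \<le> 1 * u" using r u by (intro mult_right_mono) auto
    then show "s \<le> n" unfolding su using u(3) by linarith
  qed
  have "2 * u - 2 * \<delta> * n \<le> 2 * s"
  proof -
    have "(1 - \<delta>) * u \<le> s" unfolding su using r u by (intro mult_right_mono) auto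
    moreover have "\<delta> * u \<le> \<delta> * n" using u assms by (intro mult_left_mono) auto
    moreover have "(1 - \<delta>) * u = u - \<delta> * u" by (simp add: algebra_simps)
    ultimately show ?thesis by linarith
  qed
  moreover have "2 * \<delta> * s \<le> 2 * \<delta> * n" using sn assms by (intro mult_left_mono) auto
  \<comment> \<open>The fluctuation term is absorbed by completing the square: a small multiple of
    \<open>n\<close> plus a constant, which is the origin of
    \<open>9 / (2 * \<delta>)\<close>.\<close>
  moreover have "3 * sqrt (2 * s) \<le> \<delta> * n + 9 / (2 * \<delta>)"
  proof -
    define x where "x = sqrt (2 * s)"
    have "0 \<le> \<delta> / 2 * (x - 3 / \<delta>)\<^sup>2" using assms by simp
    also have "\<dots> = \<delta> / 2 * x\<^sup>2 - 3 * x + 9 / (2 * \<delta>)"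
      using assms by (simp add: power2_eq_square field_simps)
    finally have "3 * x \<le> \<delta> / 2 * x\<^sup>2 + 9 / (2 * \<delta>)" by linarith
    moreover have "x\<^sup>2 = 2 * s" using sn by (simp add: x_def)
    moreover have "\<delta> * s \<le> \<delta> * n" using sn assms by (intro mult_left_mono) auto
    ultimately show ?thesis by (simp add: x_def)
  qed
  ultimately have "2 * u - k - 5 * \<delta> * n - (2 + 9 / (2 * \<delta>) + 1 / (\<delta>\<^sup>2 * \<eta>)) \<le> perm_mean (k * n) k"
    using bern_mean perm_mean t(2) by linarith
  then show ?thesis by (simp add: u_def)
qed

text \<open>A square grid with equal source and sink rates: for \<open>q = sqrt p\<close> the rate
  \<open>q / (1 + q)\<close> is balanced with itself, and the stationary mean is at most
  \<open>2 * q * R = 2 * sqrt t\<close>. The side \<open>R = N ^ 3\<close> keeps the collision costs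
  bounded.\<close>

lemma perm_mean_1_upper:
  assumes "0 < \<delta>" "\<delta> \<le> 1" "2 \<le> N"
  shows "perm_mean N 1 \<le> 2 * sqrt N + 2 * \<delta> * sqrt N + (2 / \<delta>\<^sup>2 + 16)"
proof -
  define R where "R = N ^ 3"
  define t where "t = (1 + \<delta>) * real N"
  define p where "p = t / real R ^ 2"
  define q where "q = sqrt p"
  have N: "0 < real N" "2 \<le> real N" using assms by auto
  have R: "0 < real R" "real R = real N ^ 3" using assms by (auto simp: R_def)
  have t: "0 < t" "t \<le> 2 * N" "N < t" "t - N = \<delta> * N"
  proof -
    have "0 < \<delta> * N" "\<delta> * N \<le> 1 * N" using assms N by (auto intro: mult_right_mono)
    moreover have "t = N + \<delta> * N" by (simp add: t_def algebra_simps)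
    ultimately show "0 < t" "t \<le> 2 * N" "N < t" "t - N = \<delta> * N" using N by linarith+
  qed
  have "2 * real N \<le> real R ^ 2"
  proof -
    have "2 * real N \<le> real N ^ 2" using N by (simp add: power2_eq_square)
    also have "\<dots> \<le> real N ^ 6" using N by (intro power_increasing) auto
    also have "\<dots> = real R ^ 2" unfolding R(2) by (simp flip: power_mult)
    finally show ?thesis .
  qed
  then have p: "0 < p" "p \<le> 1" using t R by (auto simp: p_def divide_le_eq)
  have RRp: "real R * real R * p = t" using R by (simp add: p_def power2_eq_square)
  have q: "0 < q" "q\<^sup>2 = p" using p by (auto simp: q_def)
  have "balanced (q / (1 + q)) (q / (1 + q)) p"
  proof -
    have q1: "1 - q / (1 + q) = 1 / (1 + q)" using q by (simp add: field_simps)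
    have "p * (1 - q / (1 + q)) * (1 - q / (1 + q)) = q / (1 + q) * (q / (1 + q))"
      unfolding q1 q(2)[symmetric] by (simp add: power2_eq_square)
    then show ?thesis using q p by (simp add: balanced_def)
  qed
  then have "bern_mean R R p \<le> q / (1 + q) * R + q / (1 + q) * R" by (rule bern_mean_le)
  also have "\<dots> \<le> q * R + q * R"
    using q R by (intro add_mono mult_right_mono) (auto simp: divide_le_eq)
  also have "\<dots> = 2 * sqrt t"
    using R(1) by (simp add: q_def p_def real_sqrt_divide)
  also have "sqrt t \<le> (1 + \<delta>) * sqrt N"
  proof -
    have "sqrt (1 + \<delta>) \<le> 1 + \<delta>" using assms by (intro real_le_lsqrt) (auto simp: power2_eq_square algebra_simps)
    then show ?thesis unfolding t_def real_sqrt_mult by (intro mult_right_mono) auto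
  qed
  finally have b: "bern_mean R R p \<le> 2 * sqrt N + 2 * \<delta> * sqrt N" by (simp add: algebra_simps)
  have "perm_mean N 1 \<le> bern_mean R R p + N * (real R * real R * p / (real R * real R * p - N)\<^sup>2 + R * real R ^ 2 * p\<^sup>2 + R * real R ^ 2 * p\<^sup>2)"
    using p t RRp by (intro perm_mean_1_le_bern_mean) auto
  also have "N * (real R * real R * p / (real R * real R * p - N)\<^sup>2 + R * real R ^ 2 * p\<^sup>2 + R * real R ^ 2 * p\<^sup>2) \<le> 2 / \<delta>\<^sup>2 + 16"
  proof -
    have "N * (t / (t - N)\<^sup>2) \<le> 2 / \<delta>\<^sup>2"
    proof -
      have "N * (t / (t - N)\<^sup>2) \<le> N * (2 * N / (\<delta> * N)\<^sup>2)"
        unfolding t(4) using t(2) N by (intro mult_left_mono divide_right_mono) auto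
      also have "\<dots> = 2 / \<delta>\<^sup>2" using N by (simp add: power2_eq_square)
      finally show ?thesis .
    qed
    moreover have "N * (R * real R ^ 2 * p\<^sup>2) \<le> 8"
    proof -
      have "N * (R * real R ^ 2 * p\<^sup>2) = N * (t\<^sup>2 / R)" using R(1) by (simp add: p_def power2_eq_square)
      also have "\<dots> \<le> N * ((2 * real N)\<^sup>2 / R)"
        using t(1,2) R(1) by (intro mult_left_mono divide_right_mono power_mono) auto
      also have "\<dots> = 4" unfolding R(2) using N by (simp add: power2_eq_square power3_eq_cube)
      finally show ?thesis by simp
    qed
    ultimately show ?thesis unfolding RRp distrib_left by linarith
  qed
  finally show ?thesis using b by linarith
qed

text \<open>With u = sqrt (n k), merging about h sqrt (n / k) letters gives roughly u / h letters of
  multiplicity h u. Their product is still about u^2, so the main term survives, the correction -K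
  costs at most h u, and the ratio of multiplicity to number of letters is of order h^2, as the
  dense bound requires.\<close>

lemma perm_mean_sparse_lower:
  assumes h: "0 < h" "h \<le> 1 / 2" and e: "0 < e"
  shows "\<exists>n0. \<forall>n\<ge>n0. \<forall>k. 1 \<le> k \<longrightarrow> real k < h\<^sup>2 * n \<longrightarrow>
    2 * sqrt (real n * k) - (h + e) * sqrt (real n * k) \<le> perm_mean (k * n) k"
proof -
  define d where "d = min (1 / 2) (e * h / 40)"
  \<comment> \<open>The factor 1/4 pays for rounding: \<open>q\<close> is only known to be at least
    half of \<open>h * y\<close>, and \<open>K / (n / q)\<close> is quadratic in
    \<open>q\<close>.\<close>
  define \<eta> where "\<eta> = h\<^sup>2 / 4"
  define C where "C = 2 + 9 / (2 * d) + 1 / (d\<^sup>2 * \<eta>)"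
  define B where "B = max (200 / (\<eta> * (1 - sqrt (1 - d)) ^ 4)) (C / (e * h / 8))"
  have d: "0 < d" "d \<le> 1 / 2" "5 * d \<le> e * h / 8" using h e by (auto simp: d_def)
  have h2: "h\<^sup>2 \<le> 1 / 4" using power_mono[OF h(2), of 2] h by (simp add: power2_eq_square)
  have \<eta>: "0 < \<eta>" "\<eta> \<le> 1" using h h2 by (auto simp: \<eta>_def)
  \<comment> \<open>With n' \<ge> sqrt n / 2: 16 makes rounding \<open>n / q\<close> down lose at
    most half of it, the second entry gives \<open>B \<le> n'\<close>, and the third gives
    \<open>q \<le> e / 4 * n\<close>, which controls the relative loss in n' K.\<close>
  obtain n0 :: nat where n0: "max (max 16 (4 * B\<^sup>2)) ((4 / e)\<^sup>2) \<le> n0" using real_arch_simple by blast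
  show ?thesis
  proof (intro exI[of _ n0] allI impI)
    fix n k :: nat assume nn: "n0 \<le> n" and k1: "1 \<le> k" and kn: "real k < h\<^sup>2 * n"
    have big: "16 \<le> real n" "4 * B\<^sup>2 \<le> real n" "(4 / e)\<^sup>2 \<le> real n"
      using n0 of_nat_mono[OF nn, where 'a=real] by linarith+
    have n: "0 < real n" and k: "1 \<le> real k" "0 < real k" using big k1 by auto
    define u where "u = sqrt (real n * k)"
    define y where "y = sqrt (n / k)"
    have u: "0 < u" "u\<^sup>2 = n * k" using n k by (auto simp: u_def)
    have y: "0 < y" "y\<^sup>2 = n / k" using n k by (auto simp: y_def)
    have yu: "y * k = u" "u * y = n"
    proof -
      have "(y * k)\<^sup>2 = u\<^sup>2" unfolding power_mult_distrib y(2) u(2) using k by (simp add: power2_eq_square)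
      then show yk: "y * k = u" using y(1) u(1) k by (simp add: power2_eq_iff_nonneg)
      have "u * y = y\<^sup>2 * k" unfolding yk[symmetric] by (simp add: power2_eq_square)
      then show "u * y = n" using y(2) k by simp
    qed
    have hy: "1 < h * y"
    proof -
      have "1 < h\<^sup>2 * n / k" using kn k by simp
      also have "\<dots> = (h * y)\<^sup>2" using y(2) by (simp add: power_mult_distrib)
      finally show ?thesis using h y by (metis less_eq_real_def mult_pos_pos one_power2 power2_less_imp_less)
    qed
    \<comment> \<open>Merging \<open>q\<close> letters gives \<open>n' = n div q\<close> letters of multiplicity \<open>K = k q\<close>, with \<open>K / n'\<close> of
      order \<open>h\<^sup>2\<close>.\<close>
    define q where "q = nat \<lfloor>h * y\<rfloor>"
    have q: "1 \<le> q" "real q \<le> h * y" "h * y \<le> 2 * real q"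
    proof -
      show "1 \<le> q" using hy by (simp add: q_def le_nat_iff)
      show "real q \<le> h * y" using hy by (simp add: q_def)
      have "h * y < real q + 1" using hy by (simp add: q_def)
      then show "h * y \<le> 2 * real q" using \<open>1 \<le> q\<close> by linarith
    qed
    have q0: "0 < real q" using q(1) by simp
    have yn: "y \<le> sqrt n" unfolding y_def using k n by (intro real_sqrt_le_mono) (simp add: divide_le_eq)
    define K n' where "K = k * q" and "n' = n div q"
    have n'_le: "real n' \<le> n / q" unfolding n'_def by (rule of_nat_div_le_of_nat)
    have n'_ge: "n / q - 1 \<le> real n'"
    proof -
      have "n < (n' + 1) * q" using q(1) dividend_less_div_times[of q n] by (simp add: n'_def algebra_simps)
      then have "real n < real ((n' + 1) * q)" by (simp only: of_nat_less_iff)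
      then show ?thesis using q0 by (simp add: field_simps)
    qed
    have sq: "sqrt n * sqrt n = n" "4 \<le> sqrt n" using n big(1) by (auto intro: real_le_rsqrt)
    have nq: "sqrt n \<le> n / q"
    proof -
      have "h * y \<le> 1 * y" using h y by (intro mult_right_mono) auto
      then have "real q \<le> sqrt n" using q(2) yn by linarith
      then have "sqrt n * real q \<le> sqrt n * sqrt n" by (intro mult_left_mono) auto
      then show ?thesis using sq q0 by (simp add: pos_le_divide_eq)
    qed
    have half: "n / q \<le> 2 * real n'" using n'_ge nq sq by linarith
    have n'_big: "sqrt n / 2 \<le> real n'" using half nq by linarith
    have Bn: "B \<le> real n'"
    proof -
      have "(2 * B)\<^sup>2 \<le> n" using big(2) by (simp add: power_mult_distrib)
      then have "2 * B \<le> sqrt n" by (rule real_le_rsqrt)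
      then show ?thesis using n'_big by linarith
    qed
    have Ku: "real K \<le> h * u"
    proof -
      have "real k * real q \<le> k * (h * y)" using q k by (intro mult_left_mono) auto
      also have "\<dots> = h * u" using yu(1) by (simp add: mult_ac)
      finally show ?thesis by (simp add: K_def)
    qed
    have nqu: "n / q \<le> 2 * u / h"
    proof -
      have "n * h = u * (h * y)" using yu(2) by (simp add: mult_ac)
      also have "\<dots> \<le> u * (2 * real q)" using q u by (intro mult_left_mono) auto
      finally show ?thesis using q0 h by (simp add: divide_le_eq pos_le_divide_eq mult_ac)
    qed
    have Knq: "real K \<le> h\<^sup>2 * (n / q)" "\<eta> * (n / q) \<le> real K"
    proof -
      have "real K * q = k * (real q)\<^sup>2" by (simp add: K_def power2_eq_square)
      moreover have "k * (real q)\<^sup>2 \<le> k * (h * y)\<^sup>2" using q q0 k by (intro mult_left_mono power_mono) auto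
      moreover have ky: "k * (h * y)\<^sup>2 = h\<^sup>2 * n" using y(2) k by (simp add: power_mult_distrib)
      ultimately show "real K \<le> h\<^sup>2 * (n / q)" using q0 by (simp add: pos_le_divide_eq)
      have "k * (h * y)\<^sup>2 \<le> k * (2 * real q)\<^sup>2" using q hy k by (intro mult_left_mono power_mono) auto
      then have "h\<^sup>2 * n \<le> 4 * (real K * q)" unfolding ky by (simp add: K_def power2_eq_square mult_ac)
      then show "\<eta> * (n / q) \<le> real K" using q0 by (simp add: \<eta>_def divide_le_eq)
    qed
    have Kn': "K \<le> n'"
    proof -
      have "h\<^sup>2 * (n / q) \<le> 1 / 4 * (n / q)" using h2 q0 n by (intro mult_right_mono) auto
      then have "real K \<le> real n'" using Knq(1) half by linarith
      then show ?thesis by simp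
    qed
    have \<eta>n': "\<eta> * n' \<le> real K"
    proof -
      have "\<eta> * n' \<le> \<eta> * (n / q)" using n'_le \<eta> by (intro mult_left_mono) auto
      then show ?thesis using Knq(2) by linarith
    qed
    have n'0: "0 < n'" using n'_big sq(2) by (cases n') auto
    have "2 * sqrt (real n' * K) - K - 5 * d * n' - C \<le> perm_mean (K * n') K"
      unfolding C_def
    proof (rule perm_mean_dense_lower)
      show "1 \<le> K" using k1 q by (simp add: K_def)
      show "200 / (\<eta> * (1 - sqrt (1 - d)) ^ 4) \<le> real n'" using Bn by (simp add: B_def)
    qed (fact \<eta> d n'0 Kn' \<eta>n')+
    also have "\<dots> \<le> perm_mean (k * n) k"
    proof -
      have "K * n' \<le> k * n" by (simp add: K_def n'_def mult.assoc)
      then show ?thesis unfolding K_def by (rule perm_mean_merge)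
    qed
    finally have main: "2 * sqrt (real n' * K) - K - 5 * d * n' - C \<le> perm_mean (k * n) k" .
    have err: "5 * d * n' + C \<le> e / 2 * u"
    proof -
      have "5 * d * n' \<le> e * h / 8 * n'" using d by (intro mult_right_mono) auto
      moreover have "C \<le> e * h / 8 * n'" using Bn h e by (simp add: B_def divide_le_eq mult.commute)
      moreover have "e * h / 8 * n' \<le> e * h / 8 * (2 * u / h)" using n'_le nqu h e by (intro mult_left_mono) auto
      moreover have "e * h / 8 * (2 * u / h) = e / 4 * u" using h by simp
      ultimately show ?thesis by linarith
    qed
    \<comment> \<open>The case split keeps \<open>1 - e / 4\<close> nonnegative for the comparison
      of squares; otherwise the left side is negative and there is nothing to prove.\<close>
    have "u - e / 4 * u \<le> sqrt (real n' * K)"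
    proof (cases "e / 4 \<le> 1")
      case True
      have "(u - e / 4 * u)\<^sup>2 \<le> real n' * K"
      proof -
        have "real q \<le> e / 4 * n"
        proof -
          have "real q \<le> sqrt n"
          proof -
            have "h * y \<le> 1 * y" using h y by (intro mult_right_mono) auto
            then show ?thesis using q(2) yn by linarith
          qed
          moreover have "4 / e \<le> sqrt n" using big(3) by (rule real_le_rsqrt)
          then have "1 \<le> e / 4 * sqrt n" using e by (simp add: divide_le_eq mult.commute)
          then have "1 * sqrt n \<le> e / 4 * sqrt n * sqrt n" by (intro mult_right_mono) auto
          ultimately show ?thesis using sq(1) by (simp add: mult.assoc)
        qed
        then have "k * real q \<le> k * (e / 4 * n)" using k by (intro mult_left_mono) auto
        then have "(1 - e / 4) * (n * k) \<le> (n / q - 1) * (k * real q)"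
          using q0 by (simp add: algebra_simps)
        also have "\<dots> \<le> real n' * K" unfolding K_def of_nat_mult using n'_ge by (intro mult_right_mono) auto
        finally have 1: "(1 - e / 4) * u\<^sup>2 \<le> real n' * K" unfolding u(2) .
        have "(1 - e / 4)\<^sup>2 \<le> 1 - e / 4" using True e by (simp add: power2_eq_square mult_left_le)
        then have "(1 - e / 4)\<^sup>2 * u\<^sup>2 \<le> (1 - e / 4) * u\<^sup>2" by (intro mult_right_mono) auto
        moreover have "(u - e / 4 * u)\<^sup>2 = (1 - e / 4)\<^sup>2 * u\<^sup>2"
          by (simp add: power_mult_distrib[symmetric] algebra_simps)
        ultimately show ?thesis using 1 by linarith
      qed
      then show ?thesis by (rule real_le_rsqrt)
    next
      case False
      then have "1 * u \<le> e / 4 * u" using u by (intro mult_right_mono) auto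
      moreover have "0 \<le> sqrt (real n' * K)" by simp
      ultimately show ?thesis by linarith
    qed
    then have "2 * u - (h + e) * u \<le> 2 * sqrt (real n' * K) - K - 5 * d * n' - C"
      using err Ku by (simp add: algebra_simps)
    then show "2 * sqrt (real n * k) - (h + e) * sqrt (real n * k) \<le> perm_mean (k * n) k"
      using main unfolding u_def by linarith
  qed
qed

text \<open>The regimes are separated at k = h^2 n. Above it n \<le> sqrt (n k) / h, so errors
  proportional to n are harmless; below it k \<le> h sqrt (n k), so the term -k is itself an
  error.\<close>

lemma perm_mean_asymptotics:
  assumes e: "0 < e"
  shows "\<exists>n0. \<forall>n\<ge>n0. \<forall>k. 1 \<le> k \<longrightarrow> k \<le> n \<longrightarrow>
    \<bar>perm_mean (k * n) k - (2 * sqrt (real n * k) - k)\<bar> \<le> e * sqrt (real n * k)"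
proof -
  define h where "h = min (1 / 2) (e / 2)"
  have h: "0 < h" "h \<le> 1 / 2" "h \<le> e / 2" using e by (auto simp: h_def)
  \<comment> \<open>In the dense case \<open>h * n \<le> u\<close>, so \<open>5 * d * n\<close> is
    at most \<open>e / 2 * u\<close>; the other half of the error pays for the constant
    \<open>C\<close>.\<close>
  define d where "d = min (1 / 2) (e * h / 10)"
  have d: "0 < d" "d \<le> 1 / 2" "d \<le> 1" "10 * d \<le> e * h" using h e by (auto simp: d_def)
  define \<eta> where "\<eta> = h\<^sup>2"
  have \<eta>: "0 < \<eta>" "\<eta> \<le> 1" using h by (auto simp: \<eta>_def power_le_one)
  define C where "C = Max {2 / (d\<^sup>2 * \<eta>) + 1, 2 + 9 / (2 * d) + 1 / (d\<^sup>2 * \<eta>)}"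
  define d' where "d' = min 1 (e / 8)"
  have d': "0 < d'" "d' \<le> 1" "2 * d' \<le> e / 4" using e by (auto simp: d'_def)
  define C' where "C' = 2 / d'\<^sup>2 + 16"
  obtain n1 where n1: "\<And>n k. n1 \<le> n \<Longrightarrow> 1 \<le> k \<Longrightarrow> real k < h\<^sup>2 * n \<Longrightarrow>
      2 * sqrt (real n * k) - (h + e / 2) * sqrt (real n * k) \<le> perm_mean (k * n) k"
    using perm_mean_sparse_lower[of h "e / 2"] h e by auto
  obtain n2 :: nat where n2: "max (max (C / (e * h / 2)) (200 / (\<eta> * (1 - sqrt (1 - d)) ^ 4))) (max 2 ((C' / (e / 4))\<^sup>2)) \<le> n2"
    using real_arch_simple by blast
  show ?thesis
  proof (intro exI[of _ "max n1 n2"] allI impI)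
    fix n k :: nat assume nn: "max n1 n2 \<le> n" and k1: "1 \<le> k" and kn: "k \<le> n"
    have "real n2 \<le> real n" using nn by simp
    then have big: "C / (e * h / 2) \<le> n" "200 / (\<eta> * (1 - sqrt (1 - d)) ^ 4) \<le> n" "2 \<le> real n" "(C' / (e / 4))\<^sup>2 \<le> n"
      using n2 by linarith+
    have n: "0 < real n" "0 < n" and k: "1 \<le> real k" using big k1 by auto
    define u where "u = sqrt (real n * k)"
    have u: "0 < u" "u\<^sup>2 = n * k" using n k by (auto simp: u_def)
    show "\<bar>perm_mean (k * n) k - (2 * sqrt (real n * k) - k)\<bar> \<le> e * sqrt (real n * k)"
    proof (cases "\<eta> * n \<le> k")
      case True
      have hu: "h * n \<le> u"
      proof -
        have "(h * n)\<^sup>2 = n * (\<eta> * n)" by (simp add: \<eta>_def power2_eq_square)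
        also have "\<dots> \<le> real n * real k" using True by (intro mult_left_mono) auto
        finally show ?thesis unfolding u_def by (rule real_le_rsqrt)
      qed
      have C: "2 / (d\<^sup>2 * \<eta>) + 1 \<le> C" "2 + 9 / (2 * d) + 1 / (d\<^sup>2 * \<eta>) \<le> C" by (auto simp: C_def)
      have "C \<le> e * h / 2 * n" using big(1) e h by (simp add: divide_le_eq mult.commute)
      moreover have "5 * d * n \<le> e * h / 2 * n" using d by (intro mult_right_mono) auto
      moreover have "2 * d * n \<le> e * h / 2 * n" using d by (intro mult_right_mono) auto
      moreover have "e * (h * n) \<le> e * u" using hu e by (intro mult_left_mono) auto
      moreover have "e * h / 2 * n = e * (h * n) / 2" by simp
      moreover have "perm_mean (k * n) k \<le> 2 * u - k + 2 * d * n + (2 / (d\<^sup>2 * \<eta>) + 1)"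
        unfolding u_def by (rule perm_mean_dense_upper) (fact \<eta> d n k1 kn True)+
      moreover have "2 * u - k - 5 * d * n - (2 + 9 / (2 * d) + 1 / (d\<^sup>2 * \<eta>)) \<le> perm_mean (k * n) k"
        unfolding u_def by (rule perm_mean_dense_lower) (fact \<eta> d n k1 kn True big)+
      ultimately show ?thesis using C unfolding u_def[symmetric] by linarith
    next
      case False
      then have kh: "real k < h\<^sup>2 * n" by (simp add: \<eta>_def)
      \<comment> \<open>Hence \<open>k\<close> is at most \<open>e / 2 * u\<close>, and bounds
        around \<open>2 * u\<close> without the correction suffice on both sides.\<close>
      have ku: "k \<le> h * u"
      proof -
        have "(real k)\<^sup>2 \<le> h\<^sup>2 * n * k" using kh k by (simp add: power2_eq_square mult_right_mono)
        also have "\<dots> = (h * u)\<^sup>2" using u(2) by (simp add: power_mult_distrib)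
        finally show ?thesis using h u by (auto intro: power2_le_imp_le)
      qed
      have hu: "h * u \<le> e / 2 * u" using h u by (intro mult_right_mono) auto
      have low: "2 * u - (h + e / 2) * u \<le> perm_mean (k * n) k"
        unfolding u_def using nn k1 kh by (intro n1) auto
      have "perm_mean (k * n) k \<le> perm_mean (k * n) 1" using perm_mean_merge[of "k * n" "k * n" 1 k] by simp
      also have "\<dots> \<le> 2 * sqrt (k * n) + 2 * d' * sqrt (k * n) + C'"
      proof -
        have "1 * n \<le> k * n" using k1 by (intro mult_le_mono1)
        then have "2 \<le> k * n" using big(3) by linarith
        then show ?thesis unfolding C'_def using d' by (intro perm_mean_1_upper) auto
      qed
      also have "sqrt (k * n) = u" by (simp add: u_def mult.commute)
      also have "2 * d' * u \<le> e / 4 * u" using d' u by (intro mult_right_mono) auto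
      also have "C' \<le> e / 4 * u"
      proof -
        have "C' / (e / 4) \<le> sqrt n" using big(4) by (rule real_le_rsqrt)
        also have "\<dots> \<le> u" unfolding u_def using k n by (intro real_sqrt_le_mono) simp
        finally show ?thesis using e by (simp add: divide_le_eq mult.commute)
      qed
      finally have up: "perm_mean (k * n) k \<le> 2 * u + e / 4 * u + e / 4 * u" by simp
      have "(h + e / 2) * u = h * u + e / 2 * u" by (simp add: algebra_simps)
      then show ?thesis unfolding u_def[symmetric] using low up ku hu k by linarith
    qed
  qed
qed

theorem theorem1:
  fixes k :: "nat \<Rightarrow> nat"
  assumes "\<forall>n\<ge>1. 1 \<le> k n \<and> k n \<le> n"
  shows "(\<lambda>n. expected_L_lt (k n) n - (2 * sqrt (real n * real (k n)) - real (k n)))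
           \<in> o(\<lambda>n. sqrt (real n * real (k n)))"
proof (rule landau_o.smallI)
  fix e :: real assume "0 < e"
  then obtain n0 where n0: "\<And>n k. n0 \<le> n \<Longrightarrow> 1 \<le> k \<Longrightarrow> k \<le> n \<Longrightarrow>
      \<bar>perm_mean (k * n) k - (2 * sqrt (real n * k) - k)\<bar> \<le> e * sqrt (real n * k)"
    using perm_mean_asymptotics by blast
  show "\<forall>\<^sub>F n in sequentially. norm (expected_L_lt (k n) n - (2 * sqrt (real n * real (k n)) - real (k n)))
      \<le> e * norm (sqrt (real n * real (k n)))"
  proof (rule eventually_sequentiallyI[of "max 1 n0"])
    fix n assume "max 1 n0 \<le> n"
    then show "norm (expected_L_lt (k n) n - (2 * sqrt (real n * real (k n)) - real (k n)))
        \<le> e * norm (sqrt (real n * real (k n)))"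
      using n0[of n "k n"] assms by (simp add: expected_L_lt_eq_perm_mean)
  qed
qed

end
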